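(* Let $k$ be a field of characteristic zero, let $p,q,r\ge 2$ be integers, and let $A=k[x,y,z]/(x^p+y^q+z^r-1)$, $\Omega=\Omega^1_{A/k}$. Then $c_1(\Omega)=0$ in the Lie-Rinehart cohomology group $\operatorname{H}^2(\operatorname{Der}_k(A),A)$.
   Context: $\Omega$ is a finitely generated projective $A$-module. The Lie-Rinehart cohomology $\operatorname{H}^*(\operatorname{Der}_k(A),A)$ is the cohomology of the complex of $A$-multilinear alternating forms $\operatorname{Hom}_A(\wedge^\bullet_A\operatorname{Der}_k(A),A)$ with the usual Chevalley-Eilenberg/de Rham differential $d\omega(\delta_0,\dots,\delta_m)=\sum_i(-1)^i\delta_i(\omega(\dots,\widehat{\delta_i},\dots))+\sum_{i<j}(-1)^{i+j}\omega([\delta_i,\delta_j],\dots,\widehat{\delta_i},\dots,\widehat{\delta_j},\dots)$. For a finitely generated projective $A$-module $E$, choose a connection $\nabla:\operatorname{Der}_k(A)\to\operatorname{End}_k(E)$ ($A$-linear with $\nabla(\delta)(ae)=a\nabla(\delta)(e)+\delta(a)e$), with curvature $R_\nabla(\delta\wedge\eta)=[\nabla(\delta),\nabla(\eta)]-\nabla([\delta,\eta])\in\operatorname{End}_A(E)$. The first Chern class $c_1(E)$ is the class of the closed 2-form $\delta\wedge\eta\mapsto\operatorname{tr}(R_\nabla(\delta\wedge\eta))$; it does not depend on the choice of $\nabla$. *)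

theory Defs
  imports
    "HOL-Algebra.Algebra"
    "HOL-Algebra.Algebraic_Closure_Type"
    "HOL-Computational_Algebra.Polynomial"
begin

text \<open>
  Throughout, \<open>K\<close> is a commutative ring and \<open>A\<close> a commutative \<open>K\<close>-algebra in the sense of
  \<^locale>\<open>algebra\<close>. Maps between carriers are extensional functions. The module records below
  inherit the fields \<open>mult\<close> and \<open>one\<close> from rings; these carry no meaning for a module and
  are left undefined.
\<close>

section \<open>Derivations\<close>

definition derivations ::
  "('k, 'm) ring_scheme \<Rightarrow> ('k, 'a, 'n) module_scheme \<Rightarrow> ('a \<Rightarrow> 'a) set" where
  "derivations K A = {D \<in> carrier A \<rightarrow>\<^sub>E carrier A.
     (\<forall>a\<in>carrier A. \<forall>b\<in>carrier A. D (a \<oplus>\<^bsub>A\<^esub> b) = D a \<oplus>\<^bsub>A\<^esub> D b) \<and>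
     (\<forall>c\<in>carrier K. \<forall>a\<in>carrier A. D (c \<odot>\<^bsub>A\<^esub> a) = c \<odot>\<^bsub>A\<^esub> D a) \<and>
     (\<forall>a\<in>carrier A. \<forall>b\<in>carrier A.
        D (a \<otimes>\<^bsub>A\<^esub> b) = a \<otimes>\<^bsub>A\<^esub> D b \<oplus>\<^bsub>A\<^esub> b \<otimes>\<^bsub>A\<^esub> D a)}"

definition Der ::
  "('k, 'm) ring_scheme \<Rightarrow> ('k, 'a, 'n) module_scheme \<Rightarrow> ('a, 'a \<Rightarrow> 'a) module" where
  "Der K A = \<lparr>carrier = derivations K A,
     monoid.mult = undefined, monoid.one = undefined,
     ring.zero = (\<lambda>x\<in>carrier A. \<zero>\<^bsub>A\<^esub>),
     ring.add = (\<lambda>D E. \<lambda>x\<in>carrier A. D x \<oplus>\<^bsub>A\<^esub> E x),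
     module.smult = (\<lambda>a D. \<lambda>x\<in>carrier A. a \<otimes>\<^bsub>A\<^esub> D x)\<rparr>"

definition der_bracket ::
  "('k, 'a, 'n) module_scheme \<Rightarrow> ('a \<Rightarrow> 'a) \<Rightarrow> ('a \<Rightarrow> 'a) \<Rightarrow> 'a \<Rightarrow> 'a" where
  "der_bracket A D E = (\<lambda>x\<in>carrier A. D (E x) \<ominus>\<^bsub>A\<^esub> E (D x))"

section \<open>Lie-Rinehart cohomology of the derivations with coefficients in the algebra\<close>

definition der_tuples ::
  "('k, 'm) ring_scheme \<Rightarrow> ('k, 'a, 'n) module_scheme \<Rightarrow> nat \<Rightarrow> ('a \<Rightarrow> 'a) list set" where
  "der_tuples K A m = {ds. length ds = m \<and> set ds \<subseteq> derivations K A}"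

definition lr_forms ::
  "('k, 'm) ring_scheme \<Rightarrow> ('k, 'a, 'n) module_scheme \<Rightarrow> nat \<Rightarrow> (('a \<Rightarrow> 'a) list \<Rightarrow> 'a) set" where
  "lr_forms K A m = {\<omega> \<in> der_tuples K A m \<rightarrow>\<^sub>E carrier A.
     (\<forall>ds\<in>der_tuples K A m. \<forall>i<m. \<forall>D\<in>derivations K A. \<forall>E\<in>derivations K A.
        \<omega> (ds[i := D \<oplus>\<^bsub>Der K A\<^esub> E]) = \<omega> (ds[i := D]) \<oplus>\<^bsub>A\<^esub> \<omega> (ds[i := E])) \<and>
     (\<forall>ds\<in>der_tuples K A m. \<forall>i<m. \<forall>D\<in>derivations K A. \<forall>a\<in>carrier A.
        \<omega> (ds[i := a \<odot>\<^bsub>Der K A\<^esub> D]) = a \<otimes>\<^bsub>A\<^esub> \<omega> (ds[i := D])) \<and>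
     (\<forall>ds\<in>der_tuples K A m. \<forall>i j. i < j \<and> j < m \<and> ds ! i = ds ! j \<longrightarrow> \<omega> ds = \<zero>\<^bsub>A\<^esub>)}"

text \<open>The additive group of \<open>m\<close>-forms, written as a (multiplicative) group record so that the
  library quotient \<^const>\<open>FactGroup\<close> applies; its unit is the zero form.\<close>

definition lr_cochains ::
  "('k, 'm) ring_scheme \<Rightarrow> ('k, 'a, 'n) module_scheme \<Rightarrow> nat \<Rightarrow> (('a \<Rightarrow> 'a) list \<Rightarrow> 'a) monoid" where
  "lr_cochains K A m = \<lparr>carrier = lr_forms K A m,
     monoid.mult = (\<lambda>\<omega> \<eta>. \<lambda>ds\<in>der_tuples K A m. \<omega> ds \<oplus>\<^bsub>A\<^esub> \<eta> ds),
     one = (\<lambda>ds\<in>der_tuples K A m. \<zero>\<^bsub>A\<^esub>)\<rparr>"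

definition del_nth :: "nat \<Rightarrow> 'b list \<Rightarrow> 'b list" where
  "del_nth i xs = take i xs @ drop (Suc i) xs"

text \<open>In the second sum \<open>i < j\<close>, so the \<open>j\<close>-th entry is deleted before the \<open>i\<close>-th one.\<close>

definition lr_d ::
  "('k, 'm) ring_scheme \<Rightarrow> ('k, 'a, 'n) module_scheme \<Rightarrow> nat \<Rightarrow>
   (('a \<Rightarrow> 'a) list \<Rightarrow> 'a) \<Rightarrow> ('a \<Rightarrow> 'a) list \<Rightarrow> 'a" where
  "lr_d K A m \<omega> = (\<lambda>ds\<in>der_tuples K A (Suc m).
     (\<Oplus>\<^bsub>A\<^esub>i\<in>{..m}. (\<ominus>\<^bsub>A\<^esub> \<one>\<^bsub>A\<^esub>) [^]\<^bsub>A\<^esub> i \<otimes>\<^bsub>A\<^esub> (ds ! i) (\<omega> (del_nth i ds)))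
     \<oplus>\<^bsub>A\<^esub>
     (\<Oplus>\<^bsub>A\<^esub>j\<in>{..m}. \<Oplus>\<^bsub>A\<^esub>i\<in>{..<j}. (\<ominus>\<^bsub>A\<^esub> \<one>\<^bsub>A\<^esub>) [^]\<^bsub>A\<^esub> (i + j) \<otimes>\<^bsub>A\<^esub>
        \<omega> (der_bracket A (ds ! i) (ds ! j) # del_nth i (del_nth j ds))))"

definition lr_cocycles ::
  "('k, 'm) ring_scheme \<Rightarrow> ('k, 'a, 'n) module_scheme \<Rightarrow> nat \<Rightarrow> (('a \<Rightarrow> 'a) list \<Rightarrow> 'a) set" where
  "lr_cocycles K A m = kernel (lr_cochains K A m) (lr_cochains K A (Suc m)) (lr_d K A m)"

definition lr_coboundaries ::
  "('k, 'm) ring_scheme \<Rightarrow> ('k, 'a, 'n) module_scheme \<Rightarrow> nat \<Rightarrow> (('a \<Rightarrow> 'a) list \<Rightarrow> 'a) set" where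
  "lr_coboundaries K A m = (case m of
       0 \<Rightarrow> {\<one>\<^bsub>lr_cochains K A 0\<^esub>}
     | Suc n \<Rightarrow> lr_d K A n ` lr_forms K A n)"

text \<open>The zero class is the unit \<open>\<one>\<close> of this group record.\<close>

definition lr_cohomology ::
  "('k, 'm) ring_scheme \<Rightarrow> ('k, 'a, 'n) module_scheme \<Rightarrow> nat \<Rightarrow> (('a \<Rightarrow> 'a) list \<Rightarrow> 'a) set monoid" where
  "lr_cohomology K A m =
     (lr_cochains K A m)\<lparr>carrier := lr_cocycles K A m\<rparr> Mod lr_coboundaries K A m"

definition lr_class ::
  "('k, 'm) ring_scheme \<Rightarrow> ('k, 'a, 'n) module_scheme \<Rightarrow> nat \<Rightarrow>
   (('a \<Rightarrow> 'a) list \<Rightarrow> 'a) \<Rightarrow> (('a \<Rightarrow> 'a) list \<Rightarrow> 'a) set" where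
  "lr_class K A m \<omega> = lr_coboundaries K A m #>\<^bsub>lr_cochains K A m\<^esub> \<omega>"

section \<open>Connections and the first Chern class\<close>

text \<open>The action of \<open>c \<in> K\<close> on an \<open>A\<close>-module is that of \<open>c \<odot> 1 \<in> A\<close>.\<close>

definition k_endos ::
  "('k, 'm) ring_scheme \<Rightarrow> ('k, 'a, 'n) module_scheme \<Rightarrow> ('a, 'e, 'l) module_scheme \<Rightarrow> ('e \<Rightarrow> 'e) set" where
  "k_endos K A E = {\<phi> \<in> carrier E \<rightarrow>\<^sub>E carrier E.
     (\<forall>x\<in>carrier E. \<forall>y\<in>carrier E. \<phi> (x \<oplus>\<^bsub>E\<^esub> y) = \<phi> x \<oplus>\<^bsub>E\<^esub> \<phi> y) \<and>
     (\<forall>c\<in>carrier K. \<forall>x\<in>carrier E.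
        \<phi> ((c \<odot>\<^bsub>A\<^esub> \<one>\<^bsub>A\<^esub>) \<odot>\<^bsub>E\<^esub> x) = (c \<odot>\<^bsub>A\<^esub> \<one>\<^bsub>A\<^esub>) \<odot>\<^bsub>E\<^esub> \<phi> x)}"

definition connections ::
  "('k, 'm) ring_scheme \<Rightarrow> ('k, 'a, 'n) module_scheme \<Rightarrow> ('a, 'e, 'l) module_scheme \<Rightarrow>
   (('a \<Rightarrow> 'a) \<Rightarrow> 'e \<Rightarrow> 'e) set" where
  "connections K A E = {\<Gamma> \<in> derivations K A \<rightarrow>\<^sub>E k_endos K A E.
     (\<forall>D\<in>derivations K A. \<forall>D'\<in>derivations K A. \<forall>e\<in>carrier E.
        \<Gamma> (D \<oplus>\<^bsub>Der K A\<^esub> D') e = \<Gamma> D e \<oplus>\<^bsub>E\<^esub> \<Gamma> D' e) \<and>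
     (\<forall>a\<in>carrier A. \<forall>D\<in>derivations K A. \<forall>e\<in>carrier E.
        \<Gamma> (a \<odot>\<^bsub>Der K A\<^esub> D) e = a \<odot>\<^bsub>E\<^esub> \<Gamma> D e) \<and>
     (\<forall>D\<in>derivations K A. \<forall>a\<in>carrier A. \<forall>e\<in>carrier E.
        \<Gamma> D (a \<odot>\<^bsub>E\<^esub> e) = a \<odot>\<^bsub>E\<^esub> \<Gamma> D e \<oplus>\<^bsub>E\<^esub> D a \<odot>\<^bsub>E\<^esub> e)}"

definition curvature ::
  "('k, 'a, 'n) module_scheme \<Rightarrow> ('a, 'e, 'l) module_scheme \<Rightarrow> (('a \<Rightarrow> 'a) \<Rightarrow> 'e \<Rightarrow> 'e) \<Rightarrow>
   ('a \<Rightarrow> 'a) \<Rightarrow> ('a \<Rightarrow> 'a) \<Rightarrow> 'e \<Rightarrow> 'e" where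
  "curvature A E \<Gamma> D D' = (\<lambda>e\<in>carrier E.
     (\<Gamma> D (\<Gamma> D' e) \<ominus>\<^bsub>E\<^esub> \<Gamma> D' (\<Gamma> D e)) \<ominus>\<^bsub>E\<^esub> \<Gamma> (der_bracket A D D') e)"

definition lin_functionals ::
  "('a, 'n) ring_scheme \<Rightarrow> ('a, 'e, 'l) module_scheme \<Rightarrow> ('e \<Rightarrow> 'a) set" where
  "lin_functionals A E = {\<theta> \<in> carrier E \<rightarrow>\<^sub>E carrier A.
     (\<forall>x\<in>carrier E. \<forall>y\<in>carrier E. \<theta> (x \<oplus>\<^bsub>E\<^esub> y) = \<theta> x \<oplus>\<^bsub>A\<^esub> \<theta> y) \<and>
     (\<forall>a\<in>carrier A. \<forall>x\<in>carrier E. \<theta> (a \<odot>\<^bsub>E\<^esub> x) = a \<otimes>\<^bsub>A\<^esub> \<theta> x)}"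

text \<open>A dual basis in the sense of the dual basis lemma; one exists iff \<open>E\<close> is finitely generated
  projective.\<close>

definition dual_basis ::
  "('a, 'n) ring_scheme \<Rightarrow> ('a, 'e, 'l) module_scheme \<Rightarrow> nat \<Rightarrow> (nat \<Rightarrow> 'e) \<Rightarrow> (nat \<Rightarrow> 'e \<Rightarrow> 'a) \<Rightarrow> bool" where
  "dual_basis A E n e \<theta> \<longleftrightarrow>
     (\<forall>i<n. e i \<in> carrier E \<and> \<theta> i \<in> lin_functionals A E) \<and>
     (\<forall>x\<in>carrier E. x = (\<Oplus>\<^bsub>E\<^esub>i\<in>{..<n}. \<theta> i x \<odot>\<^bsub>E\<^esub> e i))"

text \<open>The trace \<open>End\<^sub>A(E) \<cong> E\<^sup>* \<otimes> E \<rightarrow> A\<close> of an endomorphism of a finitely generated projective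
  module: under this isomorphism \<open>\<phi>\<close> is \<open>\<Sum>\<^sub>i \<theta>\<^sub>i \<otimes> \<phi>(e\<^sub>i)\<close> for every dual basis.\<close>

definition proj_trace ::
  "('a, 'n) ring_scheme \<Rightarrow> ('a, 'e, 'l) module_scheme \<Rightarrow> ('e \<Rightarrow> 'e) \<Rightarrow> 'a" where
  "proj_trace A E \<phi> =
     (THE t. \<exists>n e \<theta>. dual_basis A E n e \<theta> \<and> t = (\<Oplus>\<^bsub>A\<^esub>i\<in>{..<n}. \<theta> i (\<phi> (e i))))"

definition chern_form ::
  "('k, 'm) ring_scheme \<Rightarrow> ('k, 'a, 'n) module_scheme \<Rightarrow> ('a, 'e, 'l) module_scheme \<Rightarrow>
   (('a \<Rightarrow> 'a) \<Rightarrow> 'e \<Rightarrow> 'e) \<Rightarrow> ('a \<Rightarrow> 'a) list \<Rightarrow> 'a" where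
  "chern_form K A E \<Gamma> =
     (\<lambda>ds\<in>der_tuples K A 2. proj_trace A E (curvature A E \<Gamma> (ds ! 0) (ds ! 1)))"

text \<open>The definite description denotes a determined class only if a connection exists and the class
  does not depend on the connection, as is the case for \<open>E\<close> finitely generated projective.\<close>

definition chern1 ::
  "('k, 'm) ring_scheme \<Rightarrow> ('k, 'a, 'n) module_scheme \<Rightarrow> ('a, 'e, 'l) module_scheme \<Rightarrow>
   (('a \<Rightarrow> 'a) list \<Rightarrow> 'a) set" where
  "chern1 K A E =
     (THE c. \<exists>\<Gamma>\<in>connections K A E. c = lr_class K A 2 (chern_form K A E \<Gamma>))"

section \<open>Kaehler differentials\<close>

definition free_module :: "('a, 'n) ring_scheme \<Rightarrow> 's set \<Rightarrow> ('a, 's \<Rightarrow> 'a) module" where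
  "free_module R S = \<lparr>carrier = {f \<in> S \<rightarrow>\<^sub>E carrier R. finite {s \<in> S. f s \<noteq> \<zero>\<^bsub>R\<^esub>}},
     monoid.mult = undefined, monoid.one = undefined,
     ring.zero = (\<lambda>s\<in>S. \<zero>\<^bsub>R\<^esub>),
     ring.add = (\<lambda>f g. \<lambda>s\<in>S. f s \<oplus>\<^bsub>R\<^esub> g s),
     module.smult = (\<lambda>a f. \<lambda>s\<in>S. a \<otimes>\<^bsub>R\<^esub> f s)\<rparr>"

definition free_gen :: "('a, 'n) ring_scheme \<Rightarrow> 's set \<Rightarrow> 's \<Rightarrow> 's \<Rightarrow> 'a" where
  "free_gen R S s = (\<lambda>t\<in>S. if t = s then \<one>\<^bsub>R\<^esub> else \<zero>\<^bsub>R\<^esub>)"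

definition gen_submodule ::
  "('a, 'n) ring_scheme \<Rightarrow> ('a, 'e, 'l) module_scheme \<Rightarrow> 'e set \<Rightarrow> 'e set" where
  "gen_submodule R M S = \<Inter>{N. submodule N R M \<and> S \<subseteq> N}"

definition quot_module :: "('a, 'e, 'l) module_scheme \<Rightarrow> 'e set \<Rightarrow> ('a, 'e set) module" where
  "quot_module M N = \<lparr>carrier = a_rcosets\<^bsub>M\<^esub> N,
     monoid.mult = undefined, monoid.one = undefined,
     ring.zero = N,
     ring.add = set_add M,
     module.smult = (\<lambda>a C. \<Union>x\<in>C. N +>\<^bsub>M\<^esub> (a \<odot>\<^bsub>M\<^esub> x))\<rparr>"

text \<open>\<open>\<Omega>\<^sup>1\<^sub>A\<^sub>/\<^sub>K\<close> is the free \<open>A\<close>-module on the symbols \<open>da\<close> (\<open>a \<in> A\<close>), modulo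
  \<open>d(a + b) = da + db\<close>, \<open>d(c a) = c da\<close> for \<open>c \<in> K\<close>, and \<open>d(a b) = a db + b da\<close>.
  The symbol \<open>da\<close> is the generator \<open>free_gen A (carrier A) a\<close>.\<close>

definition kaehler_relations ::
  "('k, 'm) ring_scheme \<Rightarrow> ('k, 'a, 'n) module_scheme \<Rightarrow> ('a \<Rightarrow> 'a) set" where
  "kaehler_relations K A =
     (let F = free_module A (carrier A); d = free_gen A (carrier A) in
       {d (a \<oplus>\<^bsub>A\<^esub> b) \<ominus>\<^bsub>F\<^esub> (d a \<oplus>\<^bsub>F\<^esub> d b) | a b. a \<in> carrier A \<and> b \<in> carrier A} \<union>
       {d (c \<odot>\<^bsub>A\<^esub> a) \<ominus>\<^bsub>F\<^esub> (c \<odot>\<^bsub>A\<^esub> \<one>\<^bsub>A\<^esub>) \<odot>\<^bsub>F\<^esub> d a | c a. c \<in> carrier K \<and> a \<in> carrier A} \<union>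
       {d (a \<otimes>\<^bsub>A\<^esub> b) \<ominus>\<^bsub>F\<^esub> (a \<odot>\<^bsub>F\<^esub> d b \<oplus>\<^bsub>F\<^esub> b \<odot>\<^bsub>F\<^esub> d a) | a b.
          a \<in> carrier A \<and> b \<in> carrier A})"

definition kaehler ::
  "('k, 'm) ring_scheme \<Rightarrow> ('k, 'a, 'n) module_scheme \<Rightarrow> ('a, ('a \<Rightarrow> 'a) set) module" where
  "kaehler K A =
     (let F = free_module A (carrier A) in quot_module F (gen_submodule A F (kaehler_relations K A)))"

section \<open>The coordinate ring of the surface\<close>

text \<open>The polynomial ring \<open>k[x,y,z]\<close> is the iterated type \<open>k[x][y][z]\<close>: \<open>x\<close> is the
  innermost variable, \<open>z\<close> the outermost.\<close>

definition surface_poly :: "nat \<Rightarrow> nat \<Rightarrow> nat \<Rightarrow> 'k::field_char_0 poly poly poly" where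
  "surface_poly p q r =
     (let x = [:[:[:0, 1:]:]:]; y = [:[:0, 1:]:]; z = [:0, 1:] in x ^ p + y ^ q + z ^ r - 1)"

definition surface_algebra ::
  "nat \<Rightarrow> nat \<Rightarrow> nat \<Rightarrow> ('k::field_char_0, 'k poly poly poly set) module" where
  "surface_algebra p q r =
     (let P = ring_of_type_algebra; I = PIdl\<^bsub>P\<^esub> (surface_poly p q r); Q = P Quot I in
       \<lparr>carrier = carrier Q, monoid.mult = monoid.mult Q, monoid.one = \<one>\<^bsub>Q\<^esub>,
        ring.zero = \<zero>\<^bsub>Q\<^esub>, ring.add = ring.add Q,
        module.smult = (\<lambda>c C. (I +>\<^bsub>P\<^esub> [:[:[:c:]:]:]) \<otimes>\<^bsub>Q\<^esub> C)\<rparr>)"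

end

theory Submission
  imports Defs
begin

text \<open>Write \<open>f = x\<^sup>p + y\<^sup>q + z\<^sup>r - 1\<close>, let \<open>g = (p x\<^sup>p\<^sup>-\<^sup>1, q y\<^sup>q\<^sup>-\<^sup>1, r z\<^sup>r\<^sup>-\<^sup>1)\<close> be its gradient and
  \<open>u = (x/p, y/q, z/r)\<close>. Then \<open>\<Sum>\<^sub>i g\<^sub>i u\<^sub>i = f + 1\<close>, which is \<open>1\<close> in \<open>A\<close>: the gradient is a unimodular vector,
  so \<open>\<Omega> = A\<^sup>3 / A g\<close> satisfies \<open>\<Omega> \<oplus> A \<cong> A\<^sup>3\<close>. A module that becomes free after adding a free
  summand has trivial first Chern class. Concretely, let \<open>\<Gamma>\<close> be any connection on \<open>\<Omega>\<close>. Its direct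
  sum with the trivial connection on the summand \<open>A g\<close> is a connection \<open>d + B\<close> on \<open>A\<^sup>3\<close> for a matrix
  \<open>B\<close> of one-forms. The summand \<open>A g\<close> is flat, so the traces of the curvatures on \<open>\<Omega>\<close> and on \<open>A\<^sup>3\<close>
  agree. On \<open>A\<^sup>3\<close> the curvature is \<open>dB + B \<and> B\<close>, whose trace is \<open>d (tr B)\<close> because \<open>tr (B \<and> B)\<close> vanishes.

  In terms of the generators \<open>e\<^sub>i\<close> of \<open>\<Omega>\<close> (the differentials of the coordinates) and the
  coordinate functionals \<open>\<theta>\<^sub>i\<close> of the embedding \<open>\<Omega> \<rightarrow> A\<^sup>3\<close>, this primitive is
  \<open>tr B (D) = \<Sum>\<^sub>i \<theta>\<^sub>i (\<Gamma>\<^sub>D e\<^sub>i) + \<Sum>\<^sub>i g\<^sub>i D u\<^sub>i\<close>. The proof below takes this formula as its starting point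
  and verifies it directly in \<open>trace_curvature\<close>, without constructing the connection on \<open>A\<^sup>3\<close>. Hence
  the Chern form of every connection is exact (\<open>chern_form_exact\<close>). As connections exist
  (\<open>projection_connection\<close>), the only value of the class is zero (\<open>chern1_trivial\<close>).

  To apply this to \<open>\<Omega>\<close> one needs its coordinate functionals. By the universal property
  (\<open>kaehler_universal\<close>) they correspond to three derivations \<open>D\<^sub>i\<close> of \<open>A\<close>, namely
  \<open>D\<^sub>i = \<partial>\<^sub>i - g\<^sub>i (\<Sum>\<^sub>j u\<^sub>j \<partial>\<^sub>j)\<close>, which descend from the polynomial ring because they send \<open>f\<close> to
  \<open>- g\<^sub>i f\<close>. That they form a dual basis together with the differentials of the coordinates needs to be
  checked only on these differentials, since they generate \<open>\<Omega>\<close> (\<open>chern1_kaehler_trivial\<close>).\<close>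

section \<open>Derivations of an algebra\<close>

locale comm_algebra = A: cring A
  for K :: "('k, 'm) ring_scheme" and A :: "('k, 'a, 'n) module_scheme" +
  assumes algebra: "algebra K A"
begin

lemma scalar_closed [simp]: "c \<in> carrier K \<Longrightarrow> a \<in> carrier A \<Longrightarrow> c \<odot>\<^bsub>A\<^esub> a \<in> carrier A"
  by (rule module.smult_closed[OF algebra.axioms(1)[OF algebra]])

lemma scalar_mult:
  "c \<in> carrier K \<Longrightarrow> a \<in> carrier A \<Longrightarrow> b \<in> carrier A \<Longrightarrow>
   (c \<odot>\<^bsub>A\<^esub> a) \<otimes>\<^bsub>A\<^esub> b = c \<odot>\<^bsub>A\<^esub> (a \<otimes>\<^bsub>A\<^esub> b)"
  by (rule algebra.smult_assoc2[OF algebra])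

lemma scalar_eq_mult:
  assumes "c \<in> carrier K" "a \<in> carrier A"
  shows "c \<odot>\<^bsub>A\<^esub> a = (c \<odot>\<^bsub>A\<^esub> \<one>\<^bsub>A\<^esub>) \<otimes>\<^bsub>A\<^esub> a"
  using scalar_mult[OF assms(1) A.one_closed assms(2)] assms by simp

text \<open>Linearity over \<open>K\<close> comes for free from the Leibniz rule once the scalars \<open>c \<odot> \<one>\<close> are killed, because
  \<open>c \<odot> a = (c \<odot> \<one>) \<otimes> a\<close>.\<close>

lemma derivationI:
  assumes "D \<in> carrier A \<rightarrow>\<^sub>E carrier A"
    and "\<And>a b. a \<in> carrier A \<Longrightarrow> b \<in> carrier A \<Longrightarrow> D (a \<oplus>\<^bsub>A\<^esub> b) = D a \<oplus>\<^bsub>A\<^esub> D b"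
    and "\<And>a b. a \<in> carrier A \<Longrightarrow> b \<in> carrier A \<Longrightarrow>
           D (a \<otimes>\<^bsub>A\<^esub> b) = a \<otimes>\<^bsub>A\<^esub> D b \<oplus>\<^bsub>A\<^esub> b \<otimes>\<^bsub>A\<^esub> D a"
    and const: "\<And>c. c \<in> carrier K \<Longrightarrow> D (c \<odot>\<^bsub>A\<^esub> \<one>\<^bsub>A\<^esub>) = \<zero>\<^bsub>A\<^esub>"
  shows "D \<in> derivations K A"
proof -
  have "D (c \<odot>\<^bsub>A\<^esub> a) = c \<odot>\<^bsub>A\<^esub> D a" if c: "c \<in> carrier K" and a: "a \<in> carrier A" for c a
  proof -
    have Da: "D a \<in> carrier A" using assms(1) a by blast
    have "D (c \<odot>\<^bsub>A\<^esub> a) = D ((c \<odot>\<^bsub>A\<^esub> \<one>\<^bsub>A\<^esub>) \<otimes>\<^bsub>A\<^esub> a)"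
      by (simp only: scalar_eq_mult[OF c a])
    also have "\<dots> = (c \<odot>\<^bsub>A\<^esub> \<one>\<^bsub>A\<^esub>) \<otimes>\<^bsub>A\<^esub> D a"
      using assms(3)[of "c \<odot>\<^bsub>A\<^esub> \<one>\<^bsub>A\<^esub>" a] const[OF c] c a Da by simp
    finally show ?thesis by (simp only: scalar_eq_mult[OF c Da])
  qed
  then show ?thesis using assms unfolding derivations_def by auto
qed

context
  fixes D assumes D: "D \<in> derivations K A"
begin

lemma der_closed [simp]: "a \<in> carrier A \<Longrightarrow> D a \<in> carrier A"
  using D unfolding derivations_def by auto

lemma der_add: "a \<in> carrier A \<Longrightarrow> b \<in> carrier A \<Longrightarrow> D (a \<oplus>\<^bsub>A\<^esub> b) = D a \<oplus>\<^bsub>A\<^esub> D b"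
  using D unfolding derivations_def by auto

lemma der_mult: "a \<in> carrier A \<Longrightarrow> b \<in> carrier A \<Longrightarrow>
    D (a \<otimes>\<^bsub>A\<^esub> b) = a \<otimes>\<^bsub>A\<^esub> D b \<oplus>\<^bsub>A\<^esub> b \<otimes>\<^bsub>A\<^esub> D a"
  using D unfolding derivations_def by auto

lemma der_zero [simp]: "D \<zero>\<^bsub>A\<^esub> = \<zero>\<^bsub>A\<^esub>"
  using der_add[of "\<zero>\<^bsub>A\<^esub>" "\<zero>\<^bsub>A\<^esub>"] by (simp add: A.add.l_cancel_one')

lemma der_one [simp]: "D \<one>\<^bsub>A\<^esub> = \<zero>\<^bsub>A\<^esub>"
  using der_mult[of "\<one>\<^bsub>A\<^esub>" "\<one>\<^bsub>A\<^esub>"] by (simp add: A.add.l_cancel_one')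

lemma der_scalar_one [simp]: 
  assumes "c \<in> carrier K" shows "D (c \<odot>\<^bsub>A\<^esub> \<one>\<^bsub>A\<^esub>) = \<zero>\<^bsub>A\<^esub>"
proof -
  have "D (c \<odot>\<^bsub>A\<^esub> \<one>\<^bsub>A\<^esub>) = c \<odot>\<^bsub>A\<^esub> \<zero>\<^bsub>A\<^esub>"
    using D assms der_one unfolding derivations_def by auto
  then show ?thesis using assms scalar_eq_mult[of c "\<zero>\<^bsub>A\<^esub>"] by simp
qed

lemma der_finsum:
  assumes "finite I" "f \<in> I \<rightarrow> carrier A"
  shows "D (\<Oplus>\<^bsub>A\<^esub>i\<in>I. f i) = (\<Oplus>\<^bsub>A\<^esub>i\<in>I. D (f i))"
  using assms by (induction I) (auto simp: der_add Pi_def)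

end

lemma der_plus_apply [simp]: "a \<in> carrier A \<Longrightarrow> (D \<oplus>\<^bsub>Der K A\<^esub> E) a = D a \<oplus>\<^bsub>A\<^esub> E a"
  by (simp add: Der_def)

lemma der_smult_apply [simp]: "a \<in> carrier A \<Longrightarrow> (b \<odot>\<^bsub>Der K A\<^esub> D) a = b \<otimes>\<^bsub>A\<^esub> D a"
  by (simp add: Der_def)

lemma der_bracket_apply [simp]:
  "a \<in> carrier A \<Longrightarrow> der_bracket A D E a = D (E a) \<ominus>\<^bsub>A\<^esub> E (D a)"
  by (simp add: der_bracket_def)

lemma der_plus_closed [simp]:
  assumes D: "D \<in> derivations K A" and E: "E \<in> derivations K A"
  shows "D \<oplus>\<^bsub>Der K A\<^esub> E \<in> derivations K A"
proof (rule derivationI)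
  show "D \<oplus>\<^bsub>Der K A\<^esub> E \<in> carrier A \<rightarrow>\<^sub>E carrier A" using D E by (auto simp: Der_def)
  fix a b assume ab: "a \<in> carrier A" "b \<in> carrier A"
  then have [simp]: "D a \<in> carrier A" "D b \<in> carrier A" "E a \<in> carrier A" "E b \<in> carrier A"
    using D E by simp_all
  show "(D \<oplus>\<^bsub>Der K A\<^esub> E) (a \<oplus>\<^bsub>A\<^esub> b) = (D \<oplus>\<^bsub>Der K A\<^esub> E) a \<oplus>\<^bsub>A\<^esub> (D \<oplus>\<^bsub>Der K A\<^esub> E) b"
    using ab by (simp add: der_add[OF D] der_add[OF E] A.a_ac)
  show "(D \<oplus>\<^bsub>Der K A\<^esub> E) (a \<otimes>\<^bsub>A\<^esub> b) =
        a \<otimes>\<^bsub>A\<^esub> (D \<oplus>\<^bsub>Der K A\<^esub> E) b \<oplus>\<^bsub>A\<^esub> b \<otimes>\<^bsub>A\<^esub> (D \<oplus>\<^bsub>Der K A\<^esub> E) a"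
    using ab by (simp add: der_mult[OF D] der_mult[OF E] A.r_distr A.a_ac)
qed (use D E in simp)

lemma der_smult_closed [simp]:
  assumes D: "D \<in> derivations K A" and c: "c \<in> carrier A"
  shows "c \<odot>\<^bsub>Der K A\<^esub> D \<in> derivations K A"
proof (rule derivationI)
  show "c \<odot>\<^bsub>Der K A\<^esub> D \<in> carrier A \<rightarrow>\<^sub>E carrier A" using D c by (auto simp: Der_def)
  fix a b assume ab: "a \<in> carrier A" "b \<in> carrier A"
  then have [simp]: "D a \<in> carrier A" "D b \<in> carrier A" using D by simp_all
  show "(c \<odot>\<^bsub>Der K A\<^esub> D) (a \<oplus>\<^bsub>A\<^esub> b) = (c \<odot>\<^bsub>Der K A\<^esub> D) a \<oplus>\<^bsub>A\<^esub> (c \<odot>\<^bsub>Der K A\<^esub> D) b"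
    using ab c by (simp add: der_add[OF D] A.r_distr)
  show "(c \<odot>\<^bsub>Der K A\<^esub> D) (a \<otimes>\<^bsub>A\<^esub> b) =
        a \<otimes>\<^bsub>A\<^esub> (c \<odot>\<^bsub>Der K A\<^esub> D) b \<oplus>\<^bsub>A\<^esub> b \<otimes>\<^bsub>A\<^esub> (c \<odot>\<^bsub>Der K A\<^esub> D) a"
    using ab c by (simp add: der_mult[OF D] A.r_distr A.m_ac)
qed (use D c in simp)

lemma der_bracket_closed [simp]:
  assumes D: "D \<in> derivations K A" and E: "E \<in> derivations K A"
  shows "der_bracket A D E \<in> derivations K A"
proof (rule derivationI)
  show "der_bracket A D E \<in> carrier A \<rightarrow>\<^sub>E carrier A" using D E by (auto simp: der_bracket_def)
  fix a b assume ab: "a \<in> carrier A" "b \<in> carrier A"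
  have cl: "D x \<in> carrier A" "E x \<in> carrier A" if "x \<in> carrier A" for x
    using D E that by simp_all
  note c = ab cl[OF ab(1)] cl[OF ab(2)]
    cl[OF cl(1)[OF ab(1)]] cl[OF cl(2)[OF ab(1)]] cl[OF cl(1)[OF ab(2)]] cl[OF cl(2)[OF ab(2)]]
  show "der_bracket A D E (a \<oplus>\<^bsub>A\<^esub> b) = der_bracket A D E a \<oplus>\<^bsub>A\<^esub> der_bracket A D E b"
  proof -
    have "D (E a) \<oplus>\<^bsub>A\<^esub> D (E b) \<ominus>\<^bsub>A\<^esub> (E (D a) \<oplus>\<^bsub>A\<^esub> E (D b)) =
          (D (E a) \<ominus>\<^bsub>A\<^esub> E (D a)) \<oplus>\<^bsub>A\<^esub> (D (E b) \<ominus>\<^bsub>A\<^esub> E (D b))"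
      using c by algebra
    then show ?thesis using c by (simp add: der_add[OF D] der_add[OF E])
  qed
  show "der_bracket A D E (a \<otimes>\<^bsub>A\<^esub> b) =
        a \<otimes>\<^bsub>A\<^esub> der_bracket A D E b \<oplus>\<^bsub>A\<^esub> b \<otimes>\<^bsub>A\<^esub> der_bracket A D E a"
  proof -
    have "(a \<otimes>\<^bsub>A\<^esub> D (E b) \<oplus>\<^bsub>A\<^esub> E b \<otimes>\<^bsub>A\<^esub> D a \<oplus>\<^bsub>A\<^esub> (b \<otimes>\<^bsub>A\<^esub> D (E a) \<oplus>\<^bsub>A\<^esub> E a \<otimes>\<^bsub>A\<^esub> D b)) \<ominus>\<^bsub>A\<^esub>
        (a \<otimes>\<^bsub>A\<^esub> E (D b) \<oplus>\<^bsub>A\<^esub> D b \<otimes>\<^bsub>A\<^esub> E a \<oplus>\<^bsub>A\<^esub> (b \<otimes>\<^bsub>A\<^esub> E (D a) \<oplus>\<^bsub>A\<^esub> D a \<otimes>\<^bsub>A\<^esub> E b)) =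
        a \<otimes>\<^bsub>A\<^esub> (D (E b) \<ominus>\<^bsub>A\<^esub> E (D b)) \<oplus>\<^bsub>A\<^esub> b \<otimes>\<^bsub>A\<^esub> (D (E a) \<ominus>\<^bsub>A\<^esub> E (D a))"
      using c by algebra
    then show ?thesis
      using c by (simp add: der_add[OF D] der_add[OF E] der_mult[OF D] der_mult[OF E])
  qed
next
  fix c assume "c \<in> carrier K"
  then show "der_bracket A D E (c \<odot>\<^bsub>A\<^esub> \<one>\<^bsub>A\<^esub>) = \<zero>\<^bsub>A\<^esub>" using D E by (simp add: A.minus_eq)
qed

section \<open>Exact two-forms\<close>

lemma der_tuples_1: "der_tuples K A (Suc 0) = {[D] | D. D \<in> derivations K A}"
  unfolding der_tuples_def by (auto simp: length_Suc_conv)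

lemma der_tuples_2:
  "der_tuples K A 2 = {[D, E] | D E. D \<in> derivations K A \<and> E \<in> derivations K A}"
  unfolding der_tuples_def numeral_2_eq_2 by (auto simp: length_Suc_conv)

text \<open>In degree one there is nothing to alternate, so a one-form is the same as an \<open>A\<close>-linear map on
  derivations.\<close>

lemma one_formI:
  assumes "\<And>D. D \<in> derivations K A \<Longrightarrow> \<beta> D \<in> carrier A"
    and "\<And>D E. D \<in> derivations K A \<Longrightarrow> E \<in> derivations K A \<Longrightarrow>
           \<beta> (D \<oplus>\<^bsub>Der K A\<^esub> E) = \<beta> D \<oplus>\<^bsub>A\<^esub> \<beta> E"
    and "\<And>a D. a \<in> carrier A \<Longrightarrow> D \<in> derivations K A \<Longrightarrow> \<beta> (a \<odot>\<^bsub>Der K A\<^esub> D) = a \<otimes>\<^bsub>A\<^esub> \<beta> D"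
  shows "(\<lambda>ds\<in>der_tuples K A (Suc 0). \<beta> (ds ! 0)) \<in> lr_forms K A (Suc 0)"
  using assms unfolding lr_forms_def by (auto simp: der_tuples_1)

lemma one_formD:
  assumes "\<omega> \<in> lr_forms K A (Suc 0)"
  shows "D \<in> derivations K A \<Longrightarrow> \<omega> [D] \<in> carrier A"
    and "D \<in> derivations K A \<Longrightarrow> E \<in> derivations K A \<Longrightarrow>
           \<omega> [D \<oplus>\<^bsub>Der K A\<^esub> E] = \<omega> [D] \<oplus>\<^bsub>A\<^esub> \<omega> [E]"
    and "a \<in> carrier A \<Longrightarrow> D \<in> derivations K A \<Longrightarrow> \<omega> [a \<odot>\<^bsub>Der K A\<^esub> D] = a \<otimes>\<^bsub>A\<^esub> \<omega> [D]"
proof -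
  show "D \<in> derivations K A \<Longrightarrow> \<omega> [D] \<in> carrier A"
    using assms unfolding lr_forms_def by (auto simp: der_tuples_1)
  show "\<omega> [D \<oplus>\<^bsub>Der K A\<^esub> E] = \<omega> [D] \<oplus>\<^bsub>A\<^esub> \<omega> [E]"
    if "D \<in> derivations K A" "E \<in> derivations K A"
  proof -
    have "\<forall>ds\<in>der_tuples K A (Suc 0). \<forall>i<Suc 0. \<forall>D\<in>derivations K A. \<forall>E\<in>derivations K A.
        \<omega> (ds[i := D \<oplus>\<^bsub>Der K A\<^esub> E]) = \<omega> (ds[i := D]) \<oplus>\<^bsub>A\<^esub> \<omega> (ds[i := E])"
      using assms unfolding lr_forms_def by simp
    from this[rule_format, of "[D]" 0 D E] show ?thesis using that by (simp add: der_tuples_1)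
  qed
  show "\<omega> [a \<odot>\<^bsub>Der K A\<^esub> D] = a \<otimes>\<^bsub>A\<^esub> \<omega> [D]" if "a \<in> carrier A" "D \<in> derivations K A"
  proof -
    have "\<forall>ds\<in>der_tuples K A (Suc 0). \<forall>i<Suc 0. \<forall>D\<in>derivations K A. \<forall>a\<in>carrier A.
        \<omega> (ds[i := a \<odot>\<^bsub>Der K A\<^esub> D]) = a \<otimes>\<^bsub>A\<^esub> \<omega> (ds[i := D])"
      using assms unfolding lr_forms_def by simp
    from this[rule_format, of "[D]" 0 D a] show ?thesis using that by (simp add: der_tuples_1)
  qed
qed

lemma lr_d_1:
  assumes "\<omega> \<in> lr_forms K A (Suc 0)" "D \<in> derivations K A" "E \<in> derivations K A"
  shows "lr_d K A (Suc 0) \<omega> [D, E] =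
    D (\<omega> [E]) \<ominus>\<^bsub>A\<^esub> E (\<omega> [D]) \<ominus>\<^bsub>A\<^esub> \<omega> [der_bracket A D E]"
proof -
  have [simp]: "\<omega> [D] \<in> carrier A" "\<omega> [E] \<in> carrier A" "\<omega> [der_bracket A D E] \<in> carrier A"
    using assms one_formD(1) by simp_all
  have c: "D (\<omega> [E]) \<in> carrier A" "E (\<omega> [D]) \<in> carrier A" using assms by simp_all
  have sets: "{..Suc 0} = {0, Suc 0}" "{..<Suc 0} = {0}" by auto
  have "[D, E] \<in> der_tuples K A (Suc (Suc 0))"
    using assms by (simp add: der_tuples_def)
  then have "lr_d K A (Suc 0) \<omega> [D, E] =
      D (\<omega> [E]) \<oplus>\<^bsub>A\<^esub> (\<ominus>\<^bsub>A\<^esub> \<one>\<^bsub>A\<^esub>) \<otimes>\<^bsub>A\<^esub> E (\<omega> [D]) \<oplus>\<^bsub>A\<^esub> (\<ominus>\<^bsub>A\<^esub> \<one>\<^bsub>A\<^esub>) \<otimes>\<^bsub>A\<^esub> \<omega> [der_bracket A D E]"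
    using c by (simp add: lr_d_def del_nth_def sets)
  then show ?thesis using c by (simp add: A.l_minus A.minus_eq)
qed

lemma lr_d_1_add:
  assumes \<omega>: "\<omega> \<in> lr_forms K A (Suc 0)" and \<eta>: "\<eta> \<in> lr_forms K A (Suc 0)"
    and \<xi>: "\<xi> \<in> lr_forms K A (Suc 0)"
    and sum: "\<And>D. D \<in> derivations K A \<Longrightarrow> \<xi> [D] = \<omega> [D] \<oplus>\<^bsub>A\<^esub> \<eta> [D]"
  shows "lr_d K A (Suc 0) \<omega> \<otimes>\<^bsub>lr_cochains K A 2\<^esub> lr_d K A (Suc 0) \<eta> = lr_d K A (Suc 0) \<xi>"
proof
  fix ds
  show "(lr_d K A (Suc 0) \<omega> \<otimes>\<^bsub>lr_cochains K A 2\<^esub> lr_d K A (Suc 0) \<eta>) ds = lr_d K A (Suc 0) \<xi> ds"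
  proof (cases "ds \<in> der_tuples K A 2")
    case True
    then obtain D E where ds: "ds = [D, E]" and D: "D \<in> derivations K A"
      and E: "E \<in> derivations K A"
      unfolding der_tuples_2 by auto
    let ?B = "der_bracket A D E"
    have cl: "\<omega> [Z] \<in> carrier A" "\<eta> [Z] \<in> carrier A" if "Z \<in> derivations K A" for Z
      using that one_formD(1)[OF \<omega>] one_formD(1)[OF \<eta>] by simp_all
    have c: "D (\<omega> [E]) \<in> carrier A" "D (\<eta> [E]) \<in> carrier A" "E (\<omega> [D]) \<in> carrier A"
      "E (\<eta> [D]) \<in> carrier A" "\<omega> [?B] \<in> carrier A" "\<eta> [?B] \<in> carrier A"
      using D E cl by simp_all
    have "(D (\<omega> [E]) \<ominus>\<^bsub>A\<^esub> E (\<omega> [D]) \<ominus>\<^bsub>A\<^esub> \<omega> [?B]) \<oplus>\<^bsub>A\<^esub> (D (\<eta> [E]) \<ominus>\<^bsub>A\<^esub> E (\<eta> [D]) \<ominus>\<^bsub>A\<^esub> \<eta> [?B]) =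
      (D (\<omega> [E]) \<oplus>\<^bsub>A\<^esub> D (\<eta> [E])) \<ominus>\<^bsub>A\<^esub> (E (\<omega> [D]) \<oplus>\<^bsub>A\<^esub> E (\<eta> [D])) \<ominus>\<^bsub>A\<^esub> (\<omega> [?B] \<oplus>\<^bsub>A\<^esub> \<eta> [?B])"
      using c by algebra
    then show ?thesis
      using True D E cl unfolding ds
      by (simp add: lr_cochains_def lr_d_1[OF \<omega>] lr_d_1[OF \<eta>] lr_d_1[OF \<xi>] sum
          der_add[OF D] der_add[OF E])
  next
    case False
    then show ?thesis unfolding lr_cochains_def lr_d_def by (simp add: numeral_2_eq_2)
  qed
qed

lemma one_form_sum:
  assumes \<omega>: "\<omega> \<in> lr_forms K A (Suc 0)" and \<eta>: "\<eta> \<in> lr_forms K A (Suc 0)"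
  obtains \<xi> where "\<xi> \<in> lr_forms K A (Suc 0)"
    and "\<And>D. D \<in> derivations K A \<Longrightarrow> \<xi> [D] = \<omega> [D] \<oplus>\<^bsub>A\<^esub> \<eta> [D]"
proof
  show "(\<lambda>ds\<in>der_tuples K A (Suc 0). \<omega> [ds ! 0] \<oplus>\<^bsub>A\<^esub> \<eta> [ds ! 0]) \<in> lr_forms K A (Suc 0)"
  proof (rule one_formI[of "\<lambda>D. \<omega> [D] \<oplus>\<^bsub>A\<^esub> \<eta> [D]"])
    fix D E assume "D \<in> derivations K A" "E \<in> derivations K A"
    then show "\<omega> [D \<oplus>\<^bsub>Der K A\<^esub> E] \<oplus>\<^bsub>A\<^esub> \<eta> [D \<oplus>\<^bsub>Der K A\<^esub> E] =
        \<omega> [D] \<oplus>\<^bsub>A\<^esub> \<eta> [D] \<oplus>\<^bsub>A\<^esub> (\<omega> [E] \<oplus>\<^bsub>A\<^esub> \<eta> [E])"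
      using one_formD[OF \<omega>] one_formD[OF \<eta>] by (simp add: A.a_ac)
  qed (use one_formD[OF \<omega>] one_formD[OF \<eta>] in \<open>simp_all add: A.r_distr\<close>)
qed (auto simp: der_tuples_1)

lemma one_form_diff:
  assumes \<omega>: "\<omega> \<in> lr_forms K A (Suc 0)" and \<eta>: "\<eta> \<in> lr_forms K A (Suc 0)"
  obtains \<xi> where "\<xi> \<in> lr_forms K A (Suc 0)"
    and "\<And>D. D \<in> derivations K A \<Longrightarrow> \<omega> [D] = \<xi> [D] \<oplus>\<^bsub>A\<^esub> \<eta> [D]"
proof
  show "(\<lambda>ds\<in>der_tuples K A (Suc 0). \<omega> [ds ! 0] \<ominus>\<^bsub>A\<^esub> \<eta> [ds ! 0]) \<in> lr_forms K A (Suc 0)"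
  proof (rule one_formI[of "\<lambda>D. \<omega> [D] \<ominus>\<^bsub>A\<^esub> \<eta> [D]"])
    fix D E assume "D \<in> derivations K A" "E \<in> derivations K A"
    then show "\<omega> [D \<oplus>\<^bsub>Der K A\<^esub> E] \<ominus>\<^bsub>A\<^esub> \<eta> [D \<oplus>\<^bsub>Der K A\<^esub> E] =
        (\<omega> [D] \<ominus>\<^bsub>A\<^esub> \<eta> [D]) \<oplus>\<^bsub>A\<^esub> (\<omega> [E] \<ominus>\<^bsub>A\<^esub> \<eta> [E])"
      using one_formD[OF \<omega>] one_formD[OF \<eta>] by (simp add: A.minus_eq A.minus_add A.a_ac)
  qed (use one_formD[OF \<omega>] one_formD[OF \<eta>] in \<open>simp_all add: A.minus_eq A.r_distr A.r_minus\<close>)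
  fix D assume "D \<in> derivations K A"
  then show "\<omega> [D] = (\<lambda>ds\<in>der_tuples K A (Suc 0). \<omega> [ds ! 0] \<ominus>\<^bsub>A\<^esub> \<eta> [ds ! 0]) [D] \<oplus>\<^bsub>A\<^esub> \<eta> [D]"
    using one_formD(1)[OF \<omega>] one_formD(1)[OF \<eta>]
    by (auto simp: der_tuples_1 A.minus_eq A.a_assoc A.l_neg)
qed

lemma lr_coboundaries_2: "lr_coboundaries K A 2 = lr_d K A (Suc 0) ` lr_forms K A (Suc 0)"
  by (simp add: lr_coboundaries_def numeral_2_eq_2)

text \<open>The coboundaries are closed under sums and differences, so translating them by one of them gives them
  back; as a coset they are the unit of the quotient.\<close>

lemma lr_class_coboundary:
  assumes "\<omega> \<in> lr_coboundaries K A 2"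
  shows "lr_class K A 2 \<omega> = \<one>\<^bsub>lr_cohomology K A 2\<^esub>"
proof -
  obtain \<eta> where \<eta>: "\<eta> \<in> lr_forms K A (Suc 0)" "\<omega> = lr_d K A (Suc 0) \<eta>"
    using assms unfolding lr_coboundaries_2 by blast
  have "lr_coboundaries K A 2 #>\<^bsub>lr_cochains K A 2\<^esub> \<omega> = lr_coboundaries K A 2"
  proof
    show "lr_coboundaries K A 2 #>\<^bsub>lr_cochains K A 2\<^esub> \<omega> \<subseteq> lr_coboundaries K A 2"
    proof
      fix \<zeta> assume "\<zeta> \<in> lr_coboundaries K A 2 #>\<^bsub>lr_cochains K A 2\<^esub> \<omega>"
      then obtain \<xi> where "\<xi> \<in> lr_forms K A (Suc 0)"
        "\<zeta> = lr_d K A (Suc 0) \<xi> \<otimes>\<^bsub>lr_cochains K A 2\<^esub> \<omega>"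
        unfolding r_coset_def lr_coboundaries_2 by blast
      then show "\<zeta> \<in> lr_coboundaries K A 2"
        unfolding lr_coboundaries_2 \<eta>(2) by (metis one_form_sum lr_d_1_add \<eta>(1) imageI)
    qed
    show "lr_coboundaries K A 2 \<subseteq> lr_coboundaries K A 2 #>\<^bsub>lr_cochains K A 2\<^esub> \<omega>"
    proof
      fix \<zeta> assume "\<zeta> \<in> lr_coboundaries K A 2"
      then obtain \<xi> where \<xi>: "\<xi> \<in> lr_forms K A (Suc 0)" "\<zeta> = lr_d K A (Suc 0) \<xi>"
        unfolding lr_coboundaries_2 by blast
      obtain \<xi>' where "\<xi>' \<in> lr_forms K A (Suc 0)"
        "\<zeta> = lr_d K A (Suc 0) \<xi>' \<otimes>\<^bsub>lr_cochains K A 2\<^esub> lr_d K A (Suc 0) \<eta>"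
        using one_form_diff[OF \<xi>(1) \<eta>(1)] lr_d_1_add[OF _ \<eta>(1) \<xi>(1)] \<xi>(2) by metis
      then show "\<zeta> \<in> lr_coboundaries K A 2 #>\<^bsub>lr_cochains K A 2\<^esub> \<omega>"
        unfolding r_coset_def lr_coboundaries_2 \<eta>(2) by blast
    qed
  qed
  then show ?thesis unfolding lr_class_def lr_cohomology_def FactGroup_def by simp
qed

end

locale module_over_algebra = comm_algebra K A + E: module A E
  for K :: "('k, 'm) ring_scheme" and A :: "('k, 'a, 'n) module_scheme"
    and E :: "('a, 'e, 'l) module_scheme"

section \<open>Finite sums\<close>

lemma (in abelian_monoid) finsum_swap:
  assumes "finite I" "finite J"
    and "\<And>i j. i \<in> I \<Longrightarrow> j \<in> J \<Longrightarrow> f i j \<in> carrier G"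
  shows "(\<Oplus>i\<in>I. \<Oplus>j\<in>J. f i j) = (\<Oplus>j\<in>J. \<Oplus>i\<in>I. f i j)"
  using assms
proof (induction I)
  case (insert k I)
  then have "(\<Oplus>i\<in>insert k I. \<Oplus>j\<in>J. f i j) = (\<Oplus>j\<in>J. f k j) \<oplus> (\<Oplus>j\<in>J. \<Oplus>i\<in>I. f i j)"
    by (simp add: Pi_def)
  also have "\<dots> = (\<Oplus>j\<in>J. f k j \<oplus> (\<Oplus>i\<in>I. f i j))"
    using insert by (simp add: finsum_addf Pi_def)
  also have "\<dots> = (\<Oplus>j\<in>J. \<Oplus>i\<in>insert k I. f i j)"
    using insert by (intro finsum_cong') (auto simp: Pi_def)
  finally show ?case .
qed simp

lemma (in abelian_group) finsum_minus:
  assumes "finite I" "f \<in> I \<rightarrow> carrier G"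
  shows "(\<Oplus>i\<in>I. \<ominus> f i) = \<ominus> (\<Oplus>i\<in>I. f i)"
  using assms by (induction I) (auto simp: Pi_def minus_add minus_equality[OF r_zero[OF zero_closed]])

lemma (in abelian_group) finsum_diff:
  assumes "finite I" "f \<in> I \<rightarrow> carrier G" "g \<in> I \<rightarrow> carrier G"
  shows "(\<Oplus>i\<in>I. f i \<ominus> g i) = (\<Oplus>i\<in>I. f i) \<ominus> (\<Oplus>i\<in>I. g i)"
proof -
  have "(\<Oplus>i\<in>I. f i \<ominus> g i) = (\<Oplus>i\<in>I. f i \<oplus> \<ominus> g i)"
    using assms by (intro finsum_cong') (auto simp: minus_eq)
  then show ?thesis using assms by (simp add: finsum_addf finsum_minus minus_eq Pi_def)
qed

section \<open>Dual bases and traces\<close>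

context module_over_algebra
begin

lemma functional_closed [simp]:
  "\<theta> \<in> lin_functionals A E \<Longrightarrow> x \<in> carrier E \<Longrightarrow> \<theta> x \<in> carrier A"
  unfolding lin_functionals_def by auto

lemma functional_add:
  "\<theta> \<in> lin_functionals A E \<Longrightarrow> x \<in> carrier E \<Longrightarrow> y \<in> carrier E \<Longrightarrow>
   \<theta> (x \<oplus>\<^bsub>E\<^esub> y) = \<theta> x \<oplus>\<^bsub>A\<^esub> \<theta> y"
  unfolding lin_functionals_def by auto

lemma functional_smult:
  "\<theta> \<in> lin_functionals A E \<Longrightarrow> a \<in> carrier A \<Longrightarrow> x \<in> carrier E \<Longrightarrow>
   \<theta> (a \<odot>\<^bsub>E\<^esub> x) = a \<otimes>\<^bsub>A\<^esub> \<theta> x"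
  unfolding lin_functionals_def by auto

lemma functional_zero [simp]: "\<theta> \<in> lin_functionals A E \<Longrightarrow> \<theta> \<zero>\<^bsub>E\<^esub> = \<zero>\<^bsub>A\<^esub>"
  using functional_smult[of \<theta> "\<zero>\<^bsub>A\<^esub>" "\<zero>\<^bsub>E\<^esub>"] by simp

lemma functional_minus:
  assumes "\<theta> \<in> lin_functionals A E" "x \<in> carrier E"
  shows "\<theta> (\<ominus>\<^bsub>E\<^esub> x) = \<ominus>\<^bsub>A\<^esub> \<theta> x"
proof -
  have "\<theta> x \<oplus>\<^bsub>A\<^esub> \<theta> (\<ominus>\<^bsub>E\<^esub> x) = \<zero>\<^bsub>A\<^esub>"
    using functional_add[of \<theta> x "\<ominus>\<^bsub>E\<^esub> x"] assms by (simp add: E.M.r_neg)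
  then show ?thesis
    using assms A.minus_equality[of "\<theta> (\<ominus>\<^bsub>E\<^esub> x)" "\<theta> x"] by (simp add: A.a_comm)
qed

lemma functional_diff:
  "\<theta> \<in> lin_functionals A E \<Longrightarrow> x \<in> carrier E \<Longrightarrow> y \<in> carrier E \<Longrightarrow>
   \<theta> (x \<ominus>\<^bsub>E\<^esub> y) = \<theta> x \<ominus>\<^bsub>A\<^esub> \<theta> y"
  by (simp add: E.M.minus_eq A.minus_eq functional_add functional_minus)

lemma functional_finsum:
  assumes "\<theta> \<in> lin_functionals A E" "finite I" "f \<in> I \<rightarrow> carrier E"
  shows "\<theta> (\<Oplus>\<^bsub>E\<^esub>i\<in>I. f i) = (\<Oplus>\<^bsub>A\<^esub>i\<in>I. \<theta> (f i))"
  using assms(2,3) by (induction I) (auto simp: assms(1) functional_add Pi_def)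

lemma functional_combination:
  assumes "\<theta> \<in> lin_functionals A E" "finite I" "a \<in> I \<rightarrow> carrier A" "f \<in> I \<rightarrow> carrier E"
  shows "\<theta> (\<Oplus>\<^bsub>E\<^esub>i\<in>I. a i \<odot>\<^bsub>E\<^esub> f i) = (\<Oplus>\<^bsub>A\<^esub>i\<in>I. a i \<otimes>\<^bsub>A\<^esub> \<theta> (f i))"
  using assms by (subst functional_finsum) (auto simp: Pi_def functional_smult intro!: A.finsum_cong')

text \<open>Values outside the carrier are left free here, so that maps given by plain lambda terms qualify.\<close>

definition linear_endo :: "('e \<Rightarrow> 'e) \<Rightarrow> bool" where
  "linear_endo \<phi> \<longleftrightarrow> (\<forall>x\<in>carrier E. \<phi> x \<in> carrier E) \<and>
     (\<forall>x\<in>carrier E. \<forall>y\<in>carrier E. \<phi> (x \<oplus>\<^bsub>E\<^esub> y) = \<phi> x \<oplus>\<^bsub>E\<^esub> \<phi> y) \<and>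
     (\<forall>a\<in>carrier A. \<forall>x\<in>carrier E. \<phi> (a \<odot>\<^bsub>E\<^esub> x) = a \<odot>\<^bsub>E\<^esub> \<phi> x)"

lemma linear_endo_combination:
  assumes "linear_endo \<phi>" "finite I" "a \<in> I \<rightarrow> carrier A" "f \<in> I \<rightarrow> carrier E"
  shows "\<phi> (\<Oplus>\<^bsub>E\<^esub>i\<in>I. a i \<odot>\<^bsub>E\<^esub> f i) = (\<Oplus>\<^bsub>E\<^esub>i\<in>I. a i \<odot>\<^bsub>E\<^esub> \<phi> (f i))"
  using assms(2-)
proof (induction I)
  case empty
  have "\<phi> (\<zero>\<^bsub>A\<^esub> \<odot>\<^bsub>E\<^esub> \<zero>\<^bsub>E\<^esub>) = \<zero>\<^bsub>A\<^esub> \<odot>\<^bsub>E\<^esub> \<phi> \<zero>\<^bsub>E\<^esub>"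
    using assms(1) A.zero_closed E.M.zero_closed unfolding linear_endo_def by blast
  moreover have "\<phi> \<zero>\<^bsub>E\<^esub> \<in> carrier E" using assms(1) unfolding linear_endo_def by simp
  ultimately show ?case by simp
next
  case (insert k I)
  then show ?case using assms(1) by (simp add: Pi_def linear_endo_def)
qed

lemma dual_basisD:
  assumes "dual_basis A E n e \<theta>"
  shows "\<And>i. i < n \<Longrightarrow> e i \<in> carrier E" "\<And>i. i < n \<Longrightarrow> \<theta> i \<in> lin_functionals A E"
    "\<And>x. x \<in> carrier E \<Longrightarrow> x = (\<Oplus>\<^bsub>E\<^esub>i\<in>{..<n}. \<theta> i x \<odot>\<^bsub>E\<^esub> e i)"
  using assms unfolding dual_basis_def by blast+

lemma dual_basis_functional:
  assumes db: "dual_basis A E n e \<theta>" and \<psi>: "\<psi> \<in> lin_functionals A E" and x: "x \<in> carrier E"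
  shows "\<psi> x = (\<Oplus>\<^bsub>A\<^esub>i\<in>{..<n}. \<theta> i x \<otimes>\<^bsub>A\<^esub> \<psi> (e i))"
proof -
  have "\<psi> x = \<psi> (\<Oplus>\<^bsub>E\<^esub>i\<in>{..<n}. \<theta> i x \<odot>\<^bsub>E\<^esub> e i)"
    using dual_basisD(3)[OF db x] by simp
  then show ?thesis
    using dual_basisD(1,2)[OF db] x by (simp add: functional_combination[OF \<psi>] Pi_def)
qed

text \<open>Expanding each \<open>e\<^sub>i\<close> in the primed basis turns the left trace into a double sum over pairs of basis
  vectors; summing over \<open>i\<close> first recombines the unprimed basis and leaves the right trace.\<close>

lemma trace_independent:
  assumes db: "dual_basis A E n e \<theta>" and db': "dual_basis A E n' e' \<theta>'" and \<phi>: "linear_endo \<phi>"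
  shows "(\<Oplus>\<^bsub>A\<^esub>i\<in>{..<n}. \<theta> i (\<phi> (e i))) = (\<Oplus>\<^bsub>A\<^esub>j\<in>{..<n'}. \<theta>' j (\<phi> (e' j)))"
proof -
  note e = dual_basisD(1,2)[OF db] dual_basisD(1,2)[OF db']
  have \<phi>_closed [simp]: "\<phi> x \<in> carrier E" if "x \<in> carrier E" for x
    using \<phi> that unfolding linear_endo_def by blast
  have "\<theta> i (\<phi> (e i)) = (\<Oplus>\<^bsub>A\<^esub>j\<in>{..<n'}. \<theta>' j (e i) \<otimes>\<^bsub>A\<^esub> \<theta> i (\<phi> (e' j)))" if i: "i < n" for i
  proof -
    have "\<phi> (e i) = \<phi> (\<Oplus>\<^bsub>E\<^esub>j\<in>{..<n'}. \<theta>' j (e i) \<odot>\<^bsub>E\<^esub> e' j)"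
      using dual_basisD(3)[OF db'] e i by simp
    also have "\<dots> = (\<Oplus>\<^bsub>E\<^esub>j\<in>{..<n'}. \<theta>' j (e i) \<odot>\<^bsub>E\<^esub> \<phi> (e' j))"
      using e i by (simp add: linear_endo_combination[OF \<phi>] Pi_def)
    finally show ?thesis using e i by (simp add: functional_combination[OF e(2)[OF i]] Pi_def)
  qed
  then have "(\<Oplus>\<^bsub>A\<^esub>i\<in>{..<n}. \<theta> i (\<phi> (e i))) =
      (\<Oplus>\<^bsub>A\<^esub>i\<in>{..<n}. \<Oplus>\<^bsub>A\<^esub>j\<in>{..<n'}. \<theta>' j (e i) \<otimes>\<^bsub>A\<^esub> \<theta> i (\<phi> (e' j)))"
    by (intro A.finsum_cong' refl) (simp_all add: e Pi_def)
  also have "\<dots> = (\<Oplus>\<^bsub>A\<^esub>j\<in>{..<n'}. \<Oplus>\<^bsub>A\<^esub>i\<in>{..<n}. \<theta>' j (e i) \<otimes>\<^bsub>A\<^esub> \<theta> i (\<phi> (e' j)))"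
    by (intro A.finsum_swap) (simp_all add: e)
  also have "\<dots> = (\<Oplus>\<^bsub>A\<^esub>j\<in>{..<n'}. \<theta>' j (\<phi> (e' j)))"
  proof (intro A.finsum_cong')
    fix j assume j: "j \<in> {..<n'}"
    have "\<theta>' j (\<phi> (e' j)) = (\<Oplus>\<^bsub>A\<^esub>i\<in>{..<n}. \<theta> i (\<phi> (e' j)) \<otimes>\<^bsub>A\<^esub> \<theta>' j (e i))"
      using dual_basis_functional[OF db] e j by simp
    also have "\<dots> = (\<Oplus>\<^bsub>A\<^esub>i\<in>{..<n}. \<theta>' j (e i) \<otimes>\<^bsub>A\<^esub> \<theta> i (\<phi> (e' j)))"
      using j by (intro A.finsum_cong' refl) (simp_all add: e Pi_def A.m_comm)
    finally show "(\<Oplus>\<^bsub>A\<^esub>i\<in>{..<n}. \<theta>' j (e i) \<otimes>\<^bsub>A\<^esub> \<theta> i (\<phi> (e' j))) = \<theta>' j (\<phi> (e' j))" by simp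
  qed (simp_all add: e Pi_def)
  finally show ?thesis .
qed

lemma proj_trace_eq:
  assumes db: "dual_basis A E n e \<theta>" and \<phi>: "linear_endo \<phi>"
  shows "proj_trace A E \<phi> = (\<Oplus>\<^bsub>A\<^esub>i\<in>{..<n}. \<theta> i (\<phi> (e i)))"
  unfolding proj_trace_def
proof (rule the_equality)
  show "\<exists>n' e' \<theta>'. dual_basis A E n' e' \<theta>' \<and>
      (\<Oplus>\<^bsub>A\<^esub>i\<in>{..<n}. \<theta> i (\<phi> (e i))) = (\<Oplus>\<^bsub>A\<^esub>i\<in>{..<n'}. \<theta>' i (\<phi> (e' i)))"
    using db by blast
qed (metis trace_independent[OF _ db \<phi>])

section \<open>Connections\<close>

text \<open>The dual basis exhibits \<open>E\<close> as a direct summand of \<open>A\<^sup>n\<close>. Applying \<open>D\<close> to the coordinates and projecting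
  back to \<open>E\<close> gives a connection.\<close>

lemma projection_connection:
  assumes db: "dual_basis A E n e \<theta>"
  shows "(\<lambda>D\<in>derivations K A. \<lambda>x\<in>carrier E. \<Oplus>\<^bsub>E\<^esub>i\<in>{..<n}. D (\<theta> i x) \<odot>\<^bsub>E\<^esub> e i) \<in> connections K A E"
    (is "?G \<in> _")
proof -
  note e [simp] = dual_basisD(1,2)[OF db]
  let ?g = "\<lambda>D x. \<Oplus>\<^bsub>E\<^esub>i\<in>{..<n}. D (\<theta> i x) \<odot>\<^bsub>E\<^esub> e i"
  have closed: "?g D x \<in> carrier E" if "D \<in> derivations K A" "x \<in> carrier E" for D x
    using that by (intro E.M.finsum_closed) auto
  have add: "?g D (x \<oplus>\<^bsub>E\<^esub> y) = ?g D x \<oplus>\<^bsub>E\<^esub> ?g D y"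
    if D: "D \<in> derivations K A" and "x \<in> carrier E" "y \<in> carrier E" for D x y
  proof -
    have "?g D (x \<oplus>\<^bsub>E\<^esub> y) = (\<Oplus>\<^bsub>E\<^esub>i\<in>{..<n}. D (\<theta> i x) \<odot>\<^bsub>E\<^esub> e i \<oplus>\<^bsub>E\<^esub> D (\<theta> i y) \<odot>\<^bsub>E\<^esub> e i)"
      using that by (intro E.M.finsum_cong') (auto simp: functional_add der_add[OF D] E.smult_l_distr)
    then show ?thesis using that by (simp add: E.M.finsum_addf Pi_def)
  qed
  have leibniz: "?g D (a \<odot>\<^bsub>E\<^esub> x) = a \<odot>\<^bsub>E\<^esub> ?g D x \<oplus>\<^bsub>E\<^esub> D a \<odot>\<^bsub>E\<^esub> x"
    if D: "D \<in> derivations K A" and a: "a \<in> carrier A" and x: "x \<in> carrier E" for D a x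
  proof -
    have "?g D (a \<odot>\<^bsub>E\<^esub> x) =
        (\<Oplus>\<^bsub>E\<^esub>i\<in>{..<n}. a \<odot>\<^bsub>E\<^esub> (D (\<theta> i x) \<odot>\<^bsub>E\<^esub> e i) \<oplus>\<^bsub>E\<^esub> D a \<odot>\<^bsub>E\<^esub> (\<theta> i x \<odot>\<^bsub>E\<^esub> e i))"
      using that
      by (intro E.M.finsum_cong')
        (auto simp: functional_smult der_mult[OF D] E.smult_l_distr E.smult_assoc1[symmetric] A.m_comm)
    also have "\<dots> = a \<odot>\<^bsub>E\<^esub> ?g D x \<oplus>\<^bsub>E\<^esub> D a \<odot>\<^bsub>E\<^esub> (\<Oplus>\<^bsub>E\<^esub>i\<in>{..<n}. \<theta> i x \<odot>\<^bsub>E\<^esub> e i)"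
      using that by (simp add: E.M.finsum_addf E.finsum_smult_ldistr Pi_def)
    finally show ?thesis using dual_basisD(3)[OF db x] by simp
  qed
  have scalar: "?g D ((c \<odot>\<^bsub>A\<^esub> \<one>\<^bsub>A\<^esub>) \<odot>\<^bsub>E\<^esub> x) = (c \<odot>\<^bsub>A\<^esub> \<one>\<^bsub>A\<^esub>) \<odot>\<^bsub>E\<^esub> ?g D x"
    if "D \<in> derivations K A" "c \<in> carrier K" "x \<in> carrier E" for D c x
    using that leibniz[of D "c \<odot>\<^bsub>A\<^esub> \<one>\<^bsub>A\<^esub>" x] closed by simp
  have der_add: "?g (D \<oplus>\<^bsub>Der K A\<^esub> D') x = ?g D x \<oplus>\<^bsub>E\<^esub> ?g D' x"
    if "D \<in> derivations K A" "D' \<in> derivations K A" "x \<in> carrier E" for D D' x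
  proof -
    have "?g (D \<oplus>\<^bsub>Der K A\<^esub> D') x = (\<Oplus>\<^bsub>E\<^esub>i\<in>{..<n}. D (\<theta> i x) \<odot>\<^bsub>E\<^esub> e i \<oplus>\<^bsub>E\<^esub> D' (\<theta> i x) \<odot>\<^bsub>E\<^esub> e i)"
      using that by (intro E.M.finsum_cong') (auto simp: E.smult_l_distr)
    then show ?thesis using that by (simp add: E.M.finsum_addf Pi_def)
  qed
  have der_smult: "?g (a \<odot>\<^bsub>Der K A\<^esub> D) x = a \<odot>\<^bsub>E\<^esub> ?g D x"
    if "a \<in> carrier A" "D \<in> derivations K A" "x \<in> carrier E" for a D x
  proof -
    have "?g (a \<odot>\<^bsub>Der K A\<^esub> D) x = (\<Oplus>\<^bsub>E\<^esub>i\<in>{..<n}. a \<odot>\<^bsub>E\<^esub> (D (\<theta> i x) \<odot>\<^bsub>E\<^esub> e i))"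
      using that by (intro E.M.finsum_cong') (auto simp: E.smult_assoc1)
    then show ?thesis using that by (simp add: E.finsum_smult_ldistr Pi_def)
  qed
  have "?G D \<in> k_endos K A E" if "D \<in> derivations K A" for D
    using that closed add scalar unfolding k_endos_def by auto
  then show ?thesis
    using der_add der_smult leibniz unfolding connections_def by auto
qed

context
  fixes \<Gamma> assumes \<Gamma>: "\<Gamma> \<in> connections K A E"
begin

lemma connection_closed [simp]:
  assumes "D \<in> derivations K A" "x \<in> carrier E" shows "\<Gamma> D x \<in> carrier E"
proof -
  have "\<Gamma> D \<in> k_endos K A E" using \<Gamma> assms unfolding connections_def by auto
  then show ?thesis using assms unfolding k_endos_def by auto
qed

lemma connection_add:
  assumes "D \<in> derivations K A" "x \<in> carrier E" "y \<in> carrier E"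
  shows "\<Gamma> D (x \<oplus>\<^bsub>E\<^esub> y) = \<Gamma> D x \<oplus>\<^bsub>E\<^esub> \<Gamma> D y"
proof -
  have "\<Gamma> D \<in> k_endos K A E" using \<Gamma> assms unfolding connections_def by auto
  then show ?thesis using assms unfolding k_endos_def by auto
qed

lemma connection_leibniz:
  assumes "D \<in> derivations K A" "a \<in> carrier A" "x \<in> carrier E"
  shows "\<Gamma> D (a \<odot>\<^bsub>E\<^esub> x) = a \<odot>\<^bsub>E\<^esub> \<Gamma> D x \<oplus>\<^bsub>E\<^esub> D a \<odot>\<^bsub>E\<^esub> x"
  using \<Gamma> assms unfolding connections_def by auto

lemma connection_der_add:
  assumes "D \<in> derivations K A" "D' \<in> derivations K A" "x \<in> carrier E"
  shows "\<Gamma> (D \<oplus>\<^bsub>Der K A\<^esub> D') x = \<Gamma> D x \<oplus>\<^bsub>E\<^esub> \<Gamma> D' x"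
  using \<Gamma> assms unfolding connections_def by auto

lemma connection_der_smult:
  assumes "a \<in> carrier A" "D \<in> derivations K A" "x \<in> carrier E"
  shows "\<Gamma> (a \<odot>\<^bsub>Der K A\<^esub> D) x = a \<odot>\<^bsub>E\<^esub> \<Gamma> D x"
  using \<Gamma> assms unfolding connections_def by auto

lemma connection_zero:
  assumes "D \<in> derivations K A" shows "\<Gamma> D \<zero>\<^bsub>E\<^esub> = \<zero>\<^bsub>E\<^esub>"
  using connection_leibniz[OF assms, of "\<zero>\<^bsub>A\<^esub>" "\<zero>\<^bsub>E\<^esub>"] assms by simp

lemma connection_combination:
  assumes D: "D \<in> derivations K A" and "finite I" "a \<in> I \<rightarrow> carrier A" "f \<in> I \<rightarrow> carrier E"
  shows "\<Gamma> D (\<Oplus>\<^bsub>E\<^esub>i\<in>I. a i \<odot>\<^bsub>E\<^esub> f i) =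
    (\<Oplus>\<^bsub>E\<^esub>i\<in>I. a i \<odot>\<^bsub>E\<^esub> \<Gamma> D (f i)) \<oplus>\<^bsub>E\<^esub> (\<Oplus>\<^bsub>E\<^esub>i\<in>I. D (a i) \<odot>\<^bsub>E\<^esub> f i)"
  using assms(2-)
proof (induction I)
  case (insert k I)
  have "\<Gamma> D (\<Oplus>\<^bsub>E\<^esub>i\<in>insert k I. a i \<odot>\<^bsub>E\<^esub> f i) =
      \<Gamma> D (a k \<odot>\<^bsub>E\<^esub> f k) \<oplus>\<^bsub>E\<^esub> \<Gamma> D (\<Oplus>\<^bsub>E\<^esub>i\<in>I. a i \<odot>\<^bsub>E\<^esub> f i)"
    using insert D by (simp add: connection_add Pi_def)
  then show ?case
    using insert D by (simp add: connection_leibniz Pi_def E.M.a_ac)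
qed (use D connection_zero in simp)

text \<open>The first-order terms \<open>D a \<odot> \<Gamma> D' x\<close> and \<open>D' a \<odot> \<Gamma> D x\<close> occur in both orders of composition and
  cancel; the second-order terms \<open>D (D' a) \<odot> x\<close> and \<open>D' (D a) \<odot> x\<close> are cancelled by the bracket.\<close>

lemma curvature_linear:
  assumes D: "D \<in> derivations K A" and D': "D' \<in> derivations K A"
  shows "linear_endo (curvature A E \<Gamma> D D')"
  unfolding linear_endo_def
proof (intro conjI ballI)
  let ?R = "curvature A E \<Gamma> D D'" and ?B = "der_bracket A D D'"
  have [simp]: "?B \<in> derivations K A" using D D' by simp
  have R: "?R x = \<Gamma> D (\<Gamma> D' x) \<ominus>\<^bsub>E\<^esub> \<Gamma> D' (\<Gamma> D x) \<ominus>\<^bsub>E\<^esub> \<Gamma> ?B x" if "x \<in> carrier E" for x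
    using that by (simp add: curvature_def)
  fix x assume x: "x \<in> carrier E"
  show "?R x \<in> carrier E" using x D D' by (simp add: R)
  show "?R (x \<oplus>\<^bsub>E\<^esub> y) = ?R x \<oplus>\<^bsub>E\<^esub> ?R y" if y: "y \<in> carrier E" for y
    using x y D D' by (simp add: R connection_add E.M.minus_eq E.M.minus_add E.M.a_ac)
  show "?R (a \<odot>\<^bsub>E\<^esub> x) = a \<odot>\<^bsub>E\<^esub> ?R x" if a: "a \<in> carrier A" for a
  proof -
    let ?u = "\<Gamma> D (\<Gamma> D' x)" and ?v = "\<Gamma> D' (\<Gamma> D x)"
    have "\<Gamma> D (\<Gamma> D' (a \<odot>\<^bsub>E\<^esub> x)) = (a \<odot>\<^bsub>E\<^esub> ?u \<oplus>\<^bsub>E\<^esub> D a \<odot>\<^bsub>E\<^esub> \<Gamma> D' x) \<oplus>\<^bsub>E\<^esub>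
        (D' a \<odot>\<^bsub>E\<^esub> \<Gamma> D x \<oplus>\<^bsub>E\<^esub> D (D' a) \<odot>\<^bsub>E\<^esub> x)"
      using x a D D' by (simp add: connection_leibniz connection_add)
    moreover have "\<Gamma> D' (\<Gamma> D (a \<odot>\<^bsub>E\<^esub> x)) = (a \<odot>\<^bsub>E\<^esub> ?v \<oplus>\<^bsub>E\<^esub> D' a \<odot>\<^bsub>E\<^esub> \<Gamma> D x) \<oplus>\<^bsub>E\<^esub>
        (D a \<odot>\<^bsub>E\<^esub> \<Gamma> D' x \<oplus>\<^bsub>E\<^esub> D' (D a) \<odot>\<^bsub>E\<^esub> x)"
      using x a D D' by (simp add: connection_leibniz connection_add)
    moreover have "\<Gamma> ?B (a \<odot>\<^bsub>E\<^esub> x) = a \<odot>\<^bsub>E\<^esub> \<Gamma> ?B x \<oplus>\<^bsub>E\<^esub> (D (D' a) \<odot>\<^bsub>E\<^esub> x \<ominus>\<^bsub>E\<^esub> D' (D a) \<odot>\<^bsub>E\<^esub> x)"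
      using x a D D'
      by (simp add: connection_leibniz A.minus_eq E.M.minus_eq E.smult_l_distr E.smult_l_minus)
    moreover have "a \<odot>\<^bsub>E\<^esub> ?R x = a \<odot>\<^bsub>E\<^esub> ?u \<ominus>\<^bsub>E\<^esub> a \<odot>\<^bsub>E\<^esub> ?v \<ominus>\<^bsub>E\<^esub> a \<odot>\<^bsub>E\<^esub> \<Gamma> ?B x"
      using x a D D' by (simp add: R E.M.minus_eq E.smult_r_distr E.smult_r_minus)
    moreover have "((au \<oplus>\<^bsub>E\<^esub> p) \<oplus>\<^bsub>E\<^esub> (q \<oplus>\<^bsub>E\<^esub> s)) \<ominus>\<^bsub>E\<^esub> ((av \<oplus>\<^bsub>E\<^esub> q) \<oplus>\<^bsub>E\<^esub> (p \<oplus>\<^bsub>E\<^esub> t)) \<ominus>\<^bsub>E\<^esub> (ab \<oplus>\<^bsub>E\<^esub> (s \<ominus>\<^bsub>E\<^esub> t)) =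
        au \<ominus>\<^bsub>E\<^esub> av \<ominus>\<^bsub>E\<^esub> ab"
      if "au \<in> carrier E" "av \<in> carrier E" "ab \<in> carrier E" "p \<in> carrier E" "q \<in> carrier E"
        "s \<in> carrier E" "t \<in> carrier E" for au av ab p q s t
    proof -
      have "((au \<oplus>\<^bsub>E\<^esub> p) \<oplus>\<^bsub>E\<^esub> (q \<oplus>\<^bsub>E\<^esub> s)) \<ominus>\<^bsub>E\<^esub> ((av \<oplus>\<^bsub>E\<^esub> q) \<oplus>\<^bsub>E\<^esub> (p \<oplus>\<^bsub>E\<^esub> t)) \<ominus>\<^bsub>E\<^esub> (ab \<oplus>\<^bsub>E\<^esub> (s \<ominus>\<^bsub>E\<^esub> t)) =
        (au \<ominus>\<^bsub>E\<^esub> av \<ominus>\<^bsub>E\<^esub> ab) \<oplus>\<^bsub>E\<^esub> ((p \<oplus>\<^bsub>E\<^esub> \<ominus>\<^bsub>E\<^esub> p) \<oplus>\<^bsub>E\<^esub> (q \<oplus>\<^bsub>E\<^esub> \<ominus>\<^bsub>E\<^esub> q) \<oplus>\<^bsub>E\<^esub> (s \<oplus>\<^bsub>E\<^esub> \<ominus>\<^bsub>E\<^esub> s) \<oplus>\<^bsub>E\<^esub> (t \<oplus>\<^bsub>E\<^esub> \<ominus>\<^bsub>E\<^esub> t))"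
        using that by (simp add: E.M.minus_eq E.M.minus_add E.M.a_ac)
      then show ?thesis using that by (simp add: E.M.r_neg)
    qed
    ultimately show ?thesis using x a D D' by (simp add: R)
  qed
qed

end

end

section \<open>Modules with one unimodular relation\<close>

text \<open>This describes \<open>E = A\<^sup>n / A g\<close> for a vector \<open>g\<close> with \<open>\<Sum>\<^sub>i g\<^sub>i u\<^sub>i = 1\<close>. The \<open>e\<^sub>i\<close> are the images of the
  standard basis, and the \<open>\<theta>\<^sub>i\<close> embed \<open>E\<close> into \<open>A\<^sup>n\<close> as the kernel of \<open>u\<close>, a complement of the line
  \<open>A g\<close>. The matrix \<open>P = (\<theta>\<^sub>i (e\<^sub>j)) = 1 - g u\<^sup>T\<close> is the projection onto this complement; it kills \<open>g\<close>
  (lemma \<open>relation\<close>) and is killed by \<open>u\<^sup>T\<close> from the left (lemma \<open>corelation\<close>).\<close>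

locale unimodular_quotient = module_over_algebra K A E
  for K :: "('k, 'm) ring_scheme" and A :: "('k, 'a, 'n) module_scheme"
    and E :: "('a, 'e, 'l) module_scheme" +
  fixes n :: nat and e :: "nat \<Rightarrow> 'e" and \<theta> :: "nat \<Rightarrow> 'e \<Rightarrow> 'a" and g u :: "nat \<Rightarrow> 'a"
  assumes dual: "dual_basis A E n e \<theta>"
    and g_closed [simp]: "i < n \<Longrightarrow> g i \<in> carrier A"
    and u_closed [simp]: "i < n \<Longrightarrow> u i \<in> carrier A"
    and coordinates: "i < n \<Longrightarrow> j < n \<Longrightarrow>
      \<theta> i (e j) = (if i = j then \<one>\<^bsub>A\<^esub> else \<zero>\<^bsub>A\<^esub>) \<ominus>\<^bsub>A\<^esub> g i \<otimes>\<^bsub>A\<^esub> u j"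
    and unimodular: "(\<Oplus>\<^bsub>A\<^esub>i\<in>{..<n}. g i \<otimes>\<^bsub>A\<^esub> u i) = \<one>\<^bsub>A\<^esub>"
begin

lemma e_closed [simp]: "i < n \<Longrightarrow> e i \<in> carrier E"
  and \<theta>_functional [simp]: "i < n \<Longrightarrow> \<theta> i \<in> lin_functionals A E"
  and expand: "x \<in> carrier E \<Longrightarrow> x = (\<Oplus>\<^bsub>E\<^esub>i\<in>{..<n}. \<theta> i x \<odot>\<^bsub>E\<^esub> e i)"
  using dual_basisD[OF dual] by blast+

text \<open>Row \<open>i\<close> of \<open>(1 - g u\<^sup>T) a = a - g (u\<^sup>T a)\<close>.\<close>

lemma sum_coordinates_right:
  assumes a: "\<And>j. j < n \<Longrightarrow> a j \<in> carrier A" and i: "i < n"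
  shows "(\<Oplus>\<^bsub>A\<^esub>j\<in>{..<n}. a j \<otimes>\<^bsub>A\<^esub> \<theta> i (e j)) =
    a i \<ominus>\<^bsub>A\<^esub> g i \<otimes>\<^bsub>A\<^esub> (\<Oplus>\<^bsub>A\<^esub>j\<in>{..<n}. a j \<otimes>\<^bsub>A\<^esub> u j)"
proof -
  have "(\<Oplus>\<^bsub>A\<^esub>j\<in>{..<n}. a j \<otimes>\<^bsub>A\<^esub> \<theta> i (e j)) =
      (\<Oplus>\<^bsub>A\<^esub>j\<in>{..<n}. (if i = j then a j else \<zero>\<^bsub>A\<^esub>) \<ominus>\<^bsub>A\<^esub> g i \<otimes>\<^bsub>A\<^esub> (a j \<otimes>\<^bsub>A\<^esub> u j))"
  proof (intro A.finsum_cong' refl)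
    fix j assume "j \<in> {..<n}"
    then have c: "a j \<in> carrier A" "g i \<in> carrier A" "u j \<in> carrier A" "j < n" using a i by simp_all
    have "a j \<otimes>\<^bsub>A\<^esub> (\<one>\<^bsub>A\<^esub> \<ominus>\<^bsub>A\<^esub> g i \<otimes>\<^bsub>A\<^esub> u j) = a j \<ominus>\<^bsub>A\<^esub> g i \<otimes>\<^bsub>A\<^esub> (a j \<otimes>\<^bsub>A\<^esub> u j)"
      "a j \<otimes>\<^bsub>A\<^esub> (\<zero>\<^bsub>A\<^esub> \<ominus>\<^bsub>A\<^esub> g i \<otimes>\<^bsub>A\<^esub> u j) = \<zero>\<^bsub>A\<^esub> \<ominus>\<^bsub>A\<^esub> g i \<otimes>\<^bsub>A\<^esub> (a j \<otimes>\<^bsub>A\<^esub> u j)"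
      using c(1-3) by algebra+
    then show "a j \<otimes>\<^bsub>A\<^esub> \<theta> i (e j) =
        (if i = j then a j else \<zero>\<^bsub>A\<^esub>) \<ominus>\<^bsub>A\<^esub> g i \<otimes>\<^bsub>A\<^esub> (a j \<otimes>\<^bsub>A\<^esub> u j)"
      using coordinates[OF i c(4)] by auto
  qed (use a i in \<open>auto simp: Pi_def\<close>)
  also have "\<dots> = (\<Oplus>\<^bsub>A\<^esub>j\<in>{..<n}. if i = j then a j else \<zero>\<^bsub>A\<^esub>) \<ominus>\<^bsub>A\<^esub>
      (\<Oplus>\<^bsub>A\<^esub>j\<in>{..<n}. g i \<otimes>\<^bsub>A\<^esub> (a j \<otimes>\<^bsub>A\<^esub> u j))"
    using a i by (intro A.finsum_diff) (auto simp: Pi_def)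
  also have "(\<Oplus>\<^bsub>A\<^esub>j\<in>{..<n}. if i = j then a j else \<zero>\<^bsub>A\<^esub>) = a i"
    using a i by (intro A.finsum_singleton) (auto simp: Pi_def)
  also have "(\<Oplus>\<^bsub>A\<^esub>j\<in>{..<n}. g i \<otimes>\<^bsub>A\<^esub> (a j \<otimes>\<^bsub>A\<^esub> u j)) =
      g i \<otimes>\<^bsub>A\<^esub> (\<Oplus>\<^bsub>A\<^esub>j\<in>{..<n}. a j \<otimes>\<^bsub>A\<^esub> u j)"
    using a i by (intro A.finsum_rdistr[symmetric]) (auto simp: Pi_def)
  finally show ?thesis .
qed

lemma relation: "(\<Oplus>\<^bsub>E\<^esub>j\<in>{..<n}. g j \<odot>\<^bsub>E\<^esub> e j) = \<zero>\<^bsub>E\<^esub>" (is "?r = _")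
proof -
  have r: "?r \<in> carrier E" by (intro E.M.finsum_closed) auto
  have "\<theta> i ?r = \<zero>\<^bsub>A\<^esub>" if i: "i < n" for i
  proof -
    have "\<theta> i ?r = (\<Oplus>\<^bsub>A\<^esub>j\<in>{..<n}. g j \<otimes>\<^bsub>A\<^esub> \<theta> i (e j))"
      using i by (simp add: functional_combination[OF \<theta>_functional[OF i]] Pi_def)
    also have "\<dots> = g i \<ominus>\<^bsub>A\<^esub> g i \<otimes>\<^bsub>A\<^esub> \<one>\<^bsub>A\<^esub>"
      using i by (simp add: sum_coordinates_right unimodular)
    finally show ?thesis using i by (simp add: A.minus_eq A.r_neg)
  qed
  then have "(\<Oplus>\<^bsub>E\<^esub>i\<in>{..<n}. \<theta> i ?r \<odot>\<^bsub>E\<^esub> e i) = (\<Oplus>\<^bsub>E\<^esub>i\<in>{..<n}. \<zero>\<^bsub>E\<^esub>)"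
    by (intro E.M.finsum_cong' refl) (simp_all add: Pi_def)
  then show ?thesis using expand[OF r] by simp
qed

lemma corelation:
  assumes x: "x \<in> carrier E"
  shows "(\<Oplus>\<^bsub>A\<^esub>j\<in>{..<n}. u j \<otimes>\<^bsub>A\<^esub> \<theta> j x) = \<zero>\<^bsub>A\<^esub>"
proof -
  have on_basis: "(\<Oplus>\<^bsub>A\<^esub>j\<in>{..<n}. u j \<otimes>\<^bsub>A\<^esub> \<theta> j (e i)) = \<zero>\<^bsub>A\<^esub>" if i: "i < n" for i
  proof -
    have "(\<Oplus>\<^bsub>A\<^esub>j\<in>{..<n}. u j \<otimes>\<^bsub>A\<^esub> \<theta> j (e i)) =
        (\<Oplus>\<^bsub>A\<^esub>j\<in>{..<n}. (if i = j then u j else \<zero>\<^bsub>A\<^esub>) \<ominus>\<^bsub>A\<^esub> u i \<otimes>\<^bsub>A\<^esub> (g j \<otimes>\<^bsub>A\<^esub> u j))"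
    proof (intro A.finsum_cong' refl)
      fix j assume "j \<in> {..<n}"
      then have c: "u i \<in> carrier A" "g j \<in> carrier A" "u j \<in> carrier A" "j < n" using i by simp_all
      have "u j \<otimes>\<^bsub>A\<^esub> (\<one>\<^bsub>A\<^esub> \<ominus>\<^bsub>A\<^esub> g j \<otimes>\<^bsub>A\<^esub> u i) = u j \<ominus>\<^bsub>A\<^esub> u i \<otimes>\<^bsub>A\<^esub> (g j \<otimes>\<^bsub>A\<^esub> u j)"
        "u j \<otimes>\<^bsub>A\<^esub> (\<zero>\<^bsub>A\<^esub> \<ominus>\<^bsub>A\<^esub> g j \<otimes>\<^bsub>A\<^esub> u i) = \<zero>\<^bsub>A\<^esub> \<ominus>\<^bsub>A\<^esub> u i \<otimes>\<^bsub>A\<^esub> (g j \<otimes>\<^bsub>A\<^esub> u j)"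
        using c(1-3) by algebra+
      then show "u j \<otimes>\<^bsub>A\<^esub> \<theta> j (e i) =
          (if i = j then u j else \<zero>\<^bsub>A\<^esub>) \<ominus>\<^bsub>A\<^esub> u i \<otimes>\<^bsub>A\<^esub> (g j \<otimes>\<^bsub>A\<^esub> u j)"
        using coordinates[OF c(4) i] by auto
    qed (use i in \<open>auto simp: Pi_def\<close>)
    also have "\<dots> = (\<Oplus>\<^bsub>A\<^esub>j\<in>{..<n}. if i = j then u j else \<zero>\<^bsub>A\<^esub>) \<ominus>\<^bsub>A\<^esub>
        (\<Oplus>\<^bsub>A\<^esub>j\<in>{..<n}. u i \<otimes>\<^bsub>A\<^esub> (g j \<otimes>\<^bsub>A\<^esub> u j))"
      using i by (intro A.finsum_diff) (auto simp: Pi_def)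
    also have "(\<Oplus>\<^bsub>A\<^esub>j\<in>{..<n}. if i = j then u j else \<zero>\<^bsub>A\<^esub>) = u i"
      using i by (intro A.finsum_singleton) (auto simp: Pi_def)
    also have "(\<Oplus>\<^bsub>A\<^esub>j\<in>{..<n}. u i \<otimes>\<^bsub>A\<^esub> (g j \<otimes>\<^bsub>A\<^esub> u j)) =
        u i \<otimes>\<^bsub>A\<^esub> (\<Oplus>\<^bsub>A\<^esub>j\<in>{..<n}. g j \<otimes>\<^bsub>A\<^esub> u j)"
      using i by (intro A.finsum_rdistr[symmetric]) (auto simp: Pi_def)
    finally show ?thesis using i by (simp add: unimodular A.minus_eq A.r_neg)
  qed
  define \<psi> where "\<psi> = (\<lambda>x\<in>carrier E. \<Oplus>\<^bsub>A\<^esub>j\<in>{..<n}. u j \<otimes>\<^bsub>A\<^esub> \<theta> j x)"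
  have \<psi>: "\<psi> \<in> lin_functionals A E"
    unfolding lin_functionals_def
  proof (intro CollectI conjI ballI)
    show "\<psi> \<in> carrier E \<rightarrow>\<^sub>E carrier A" by (auto simp: \<psi>_def intro!: A.finsum_closed)
    show "\<psi> (y \<oplus>\<^bsub>E\<^esub> z) = \<psi> y \<oplus>\<^bsub>A\<^esub> \<psi> z" if y: "y \<in> carrier E" and z: "z \<in> carrier E" for y z
    proof -
      have "(\<Oplus>\<^bsub>A\<^esub>j\<in>{..<n}. u j \<otimes>\<^bsub>A\<^esub> \<theta> j (y \<oplus>\<^bsub>E\<^esub> z)) =
          (\<Oplus>\<^bsub>A\<^esub>j\<in>{..<n}. u j \<otimes>\<^bsub>A\<^esub> \<theta> j y \<oplus>\<^bsub>A\<^esub> u j \<otimes>\<^bsub>A\<^esub> \<theta> j z)"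
        using y z by (intro A.finsum_cong' refl)
          (simp_all add: Pi_def functional_add[OF \<theta>_functional] A.r_distr)
      then show ?thesis using y z by (simp add: \<psi>_def A.finsum_addf Pi_def)
    qed
    show "\<psi> (a \<odot>\<^bsub>E\<^esub> y) = a \<otimes>\<^bsub>A\<^esub> \<psi> y" if a: "a \<in> carrier A" and y: "y \<in> carrier E" for a y
    proof -
      have "(\<Oplus>\<^bsub>A\<^esub>j\<in>{..<n}. u j \<otimes>\<^bsub>A\<^esub> \<theta> j (a \<odot>\<^bsub>E\<^esub> y)) =
          (\<Oplus>\<^bsub>A\<^esub>j\<in>{..<n}. a \<otimes>\<^bsub>A\<^esub> (u j \<otimes>\<^bsub>A\<^esub> \<theta> j y))"
        using a y by (intro A.finsum_cong' refl)
          (simp_all add: Pi_def functional_smult[OF \<theta>_functional] A.m_lcomm)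
      then show ?thesis using a y by (simp add: \<psi>_def A.finsum_rdistr Pi_def)
    qed
  qed
  have "\<psi> x = (\<Oplus>\<^bsub>A\<^esub>i\<in>{..<n}. \<theta> i x \<otimes>\<^bsub>A\<^esub> \<psi> (e i))"
    by (rule dual_basis_functional[OF dual \<psi> x])
  also have "\<dots> = (\<Oplus>\<^bsub>A\<^esub>i\<in>{..<n}. \<zero>\<^bsub>A\<^esub>)"
    using x by (intro A.finsum_cong' refl) (simp_all add: Pi_def \<psi>_def on_basis)
  finally show ?thesis using x by (simp add: \<psi>_def)
qed

lemma der_pairing:
  assumes D: "D \<in> derivations K A"
    and "\<And>i. i < n \<Longrightarrow> a i \<in> carrier A" "\<And>i. i < n \<Longrightarrow> b i \<in> carrier A"
  shows "D (\<Oplus>\<^bsub>A\<^esub>i\<in>{..<n}. a i \<otimes>\<^bsub>A\<^esub> b i) =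
    (\<Oplus>\<^bsub>A\<^esub>i\<in>{..<n}. a i \<otimes>\<^bsub>A\<^esub> D (b i)) \<oplus>\<^bsub>A\<^esub> (\<Oplus>\<^bsub>A\<^esub>i\<in>{..<n}. D (a i) \<otimes>\<^bsub>A\<^esub> b i)"
proof -
  have "D (\<Oplus>\<^bsub>A\<^esub>i\<in>{..<n}. a i \<otimes>\<^bsub>A\<^esub> b i) = (\<Oplus>\<^bsub>A\<^esub>i\<in>{..<n}. a i \<otimes>\<^bsub>A\<^esub> D (b i) \<oplus>\<^bsub>A\<^esub> D (a i) \<otimes>\<^bsub>A\<^esub> b i)"
    using assms by (subst der_finsum[OF D], simp, simp add: Pi_def, intro A.finsum_cong' refl)
      (simp_all add: Pi_def der_mult[OF D] A.m_comm)
  then show ?thesis using assms by (simp add: A.finsum_addf Pi_def)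
qed

context
  fixes \<Gamma> assumes \<Gamma>: "\<Gamma> \<in> connections K A E"
begin

text \<open>With the matrix \<open>C\<^sub>D = (\<theta>\<^sub>i (\<Gamma>\<^sub>D e\<^sub>j))\<close>, the Leibniz rule gives
  \<open>\<Sum>\<^sub>i \<theta>\<^sub>i (\<Gamma>\<^sub>D (\<Gamma>\<^sub>D\<^sub>' e\<^sub>i)) = tr (C\<^sub>D C\<^sub>D\<^sub>') + tr (P D(C\<^sub>D\<^sub>'))\<close>. As \<open>P = 1 - g u\<^sup>T\<close>, the second trace differs from
  \<open>D (tr C\<^sub>D\<^sub>')\<close> by \<open>u\<^sup>T D(C\<^sub>D\<^sub>') g\<close>. Differentiating \<open>u\<^sup>T C\<^sub>D\<^sub>' = 0\<close> moves the derivative from the matrix to \<open>u\<close>,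
  and differentiating \<open>\<Sum>\<^sub>i g\<^sub>i e\<^sub>i = 0\<close> gives \<open>C\<^sub>D\<^sub>' g = - P D'(g)\<close>. What remains is expressed in \<open>u\<close> and \<open>g\<close>
  alone. The trace of the product and the product of the two sums at the end are symmetric in \<open>D\<close> and \<open>D'\<close>, so
  they drop out of the curvature.\<close>

lemma trace_composite:
  assumes D: "D \<in> derivations K A" and D': "D' \<in> derivations K A"
  shows "(\<Oplus>\<^bsub>A\<^esub>i\<in>{..<n}. \<theta> i (\<Gamma> D (\<Gamma> D' (e i)))) =
    ((\<Oplus>\<^bsub>A\<^esub>i\<in>{..<n}. \<Oplus>\<^bsub>A\<^esub>j\<in>{..<n}. \<theta> i (\<Gamma> D (e j)) \<otimes>\<^bsub>A\<^esub> \<theta> j (\<Gamma> D' (e i)))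
      \<oplus>\<^bsub>A\<^esub> D (\<Oplus>\<^bsub>A\<^esub>i\<in>{..<n}. \<theta> i (\<Gamma> D' (e i))))
    \<ominus>\<^bsub>A\<^esub> (\<Oplus>\<^bsub>A\<^esub>i\<in>{..<n}. D (u i) \<otimes>\<^bsub>A\<^esub> D' (g i))
    \<ominus>\<^bsub>A\<^esub> (\<Oplus>\<^bsub>A\<^esub>i\<in>{..<n}. g i \<otimes>\<^bsub>A\<^esub> D (u i)) \<otimes>\<^bsub>A\<^esub> (\<Oplus>\<^bsub>A\<^esub>i\<in>{..<n}. g i \<otimes>\<^bsub>A\<^esub> D' (u i))"
proof -
  note con = connection_closed[OF \<Gamma> D] connection_closed[OF \<Gamma> D']
  note [simp] = der_closed[OF D] der_closed[OF D'] con
  let ?C = "\<lambda>i j. \<theta> i (\<Gamma> D (e j))" and ?C' = "\<lambda>i j. \<theta> i (\<Gamma> D' (e j))"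
  have C [simp]: "?C i j \<in> carrier A" "?C' i j \<in> carrier A" if "i < n" "j < n" for i j
    using that by simp_all
  have u_C': "(\<Oplus>\<^bsub>A\<^esub>j\<in>{..<n}. D (?C' j i) \<otimes>\<^bsub>A\<^esub> u j) = \<ominus>\<^bsub>A\<^esub> (\<Oplus>\<^bsub>A\<^esub>j\<in>{..<n}. D (u j) \<otimes>\<^bsub>A\<^esub> ?C' j i)"
    if i: "i < n" for i
  proof -
    have "(\<Oplus>\<^bsub>A\<^esub>j\<in>{..<n}. u j \<otimes>\<^bsub>A\<^esub> D (?C' j i)) \<oplus>\<^bsub>A\<^esub> (\<Oplus>\<^bsub>A\<^esub>j\<in>{..<n}. D (u j) \<otimes>\<^bsub>A\<^esub> ?C' j i) = \<zero>\<^bsub>A\<^esub>"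
      using der_pairing[OF D, of u "\<lambda>j. ?C' j i"] i corelation[of "\<Gamma> D' (e i)"] D by simp
    moreover have "(\<Oplus>\<^bsub>A\<^esub>j\<in>{..<n}. u j \<otimes>\<^bsub>A\<^esub> D (?C' j i)) = (\<Oplus>\<^bsub>A\<^esub>j\<in>{..<n}. D (?C' j i) \<otimes>\<^bsub>A\<^esub> u j)"
      using i by (intro A.finsum_cong' refl) (simp_all add: Pi_def A.m_comm)
    ultimately show ?thesis using i A.minus_equality by (simp add: Pi_def)
  qed
  have C'_g: "(\<Oplus>\<^bsub>A\<^esub>i\<in>{..<n}. g i \<otimes>\<^bsub>A\<^esub> ?C' j i) =
      \<ominus>\<^bsub>A\<^esub> (D' (g j) \<oplus>\<^bsub>A\<^esub> g j \<otimes>\<^bsub>A\<^esub> (\<Oplus>\<^bsub>A\<^esub>i\<in>{..<n}. g i \<otimes>\<^bsub>A\<^esub> D' (u i)))" if j: "j < n" for j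
  proof -
    have "\<zero>\<^bsub>E\<^esub> = (\<Oplus>\<^bsub>E\<^esub>i\<in>{..<n}. g i \<odot>\<^bsub>E\<^esub> \<Gamma> D' (e i)) \<oplus>\<^bsub>E\<^esub> (\<Oplus>\<^bsub>E\<^esub>i\<in>{..<n}. D' (g i) \<odot>\<^bsub>E\<^esub> e i)"
      using connection_combination[OF \<Gamma> D', of "{..<n}" g e] connection_zero[OF \<Gamma> D']
      by (simp add: relation Pi_def)
    then have "\<theta> j \<zero>\<^bsub>E\<^esub> = \<theta> j (\<Oplus>\<^bsub>E\<^esub>i\<in>{..<n}. g i \<odot>\<^bsub>E\<^esub> \<Gamma> D' (e i)) \<oplus>\<^bsub>A\<^esub> \<theta> j (\<Oplus>\<^bsub>E\<^esub>i\<in>{..<n}. D' (g i) \<odot>\<^bsub>E\<^esub> e i)"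
      using j by (simp add: functional_add[OF \<theta>_functional[OF j], symmetric] Pi_def)
    then have "\<zero>\<^bsub>A\<^esub> = (\<Oplus>\<^bsub>A\<^esub>i\<in>{..<n}. g i \<otimes>\<^bsub>A\<^esub> ?C' j i) \<oplus>\<^bsub>A\<^esub> (\<Oplus>\<^bsub>A\<^esub>i\<in>{..<n}. D' (g i) \<otimes>\<^bsub>A\<^esub> \<theta> j (e i))"
      using j by (simp add: functional_combination[OF \<theta>_functional[OF j]] Pi_def)
    moreover have "(\<Oplus>\<^bsub>A\<^esub>i\<in>{..<n}. D' (g i) \<otimes>\<^bsub>A\<^esub> \<theta> j (e i)) =
        D' (g j) \<oplus>\<^bsub>A\<^esub> g j \<otimes>\<^bsub>A\<^esub> (\<Oplus>\<^bsub>A\<^esub>i\<in>{..<n}. g i \<otimes>\<^bsub>A\<^esub> D' (u i))"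
    proof -
      let ?s = "\<Oplus>\<^bsub>A\<^esub>i\<in>{..<n}. D' (g i) \<otimes>\<^bsub>A\<^esub> u i" and ?t = "\<Oplus>\<^bsub>A\<^esub>i\<in>{..<n}. g i \<otimes>\<^bsub>A\<^esub> D' (u i)"
      have "?t \<oplus>\<^bsub>A\<^esub> ?s = \<zero>\<^bsub>A\<^esub>"
        using der_pairing[OF D', of g u] D' by (simp add: unimodular)
      then have "?t = \<ominus>\<^bsub>A\<^esub> ?s" using A.minus_equality[of ?t ?s] by (simp add: Pi_def)
      then show ?thesis
        using j by (simp add: sum_coordinates_right A.minus_eq A.r_minus Pi_def)
    qed
    ultimately show ?thesis using j A.minus_equality by (simp add: Pi_def)
  qed
  have "\<theta> i (\<Gamma> D (\<Gamma> D' (e i))) = (\<Oplus>\<^bsub>A\<^esub>j\<in>{..<n}. ?C i j \<otimes>\<^bsub>A\<^esub> ?C' j i) \<oplus>\<^bsub>A\<^esub> D (?C' i i) \<oplus>\<^bsub>A\<^esub>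
      (\<Oplus>\<^bsub>A\<^esub>j\<in>{..<n}. D (u j) \<otimes>\<^bsub>A\<^esub> (g i \<otimes>\<^bsub>A\<^esub> ?C' j i))" if i: "i < n" for i
  proof -
    have "\<Gamma> D (\<Gamma> D' (e i)) = \<Gamma> D (\<Oplus>\<^bsub>E\<^esub>j\<in>{..<n}. ?C' j i \<odot>\<^bsub>E\<^esub> e j)"
      using expand[of "\<Gamma> D' (e i)"] i by simp
    also have "\<dots> = (\<Oplus>\<^bsub>E\<^esub>j\<in>{..<n}. ?C' j i \<odot>\<^bsub>E\<^esub> \<Gamma> D (e j)) \<oplus>\<^bsub>E\<^esub> (\<Oplus>\<^bsub>E\<^esub>j\<in>{..<n}. D (?C' j i) \<odot>\<^bsub>E\<^esub> e j)"
      using i by (intro connection_combination[OF \<Gamma> D]) (auto simp: Pi_def)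
    finally have "\<theta> i (\<Gamma> D (\<Gamma> D' (e i))) =
        (\<Oplus>\<^bsub>A\<^esub>j\<in>{..<n}. ?C' j i \<otimes>\<^bsub>A\<^esub> ?C i j) \<oplus>\<^bsub>A\<^esub> (\<Oplus>\<^bsub>A\<^esub>j\<in>{..<n}. D (?C' j i) \<otimes>\<^bsub>A\<^esub> \<theta> i (e j))"
      using i by (simp add: functional_add[OF \<theta>_functional[OF i]]
          functional_combination[OF \<theta>_functional[OF i]] Pi_def)
    also have "(\<Oplus>\<^bsub>A\<^esub>j\<in>{..<n}. ?C' j i \<otimes>\<^bsub>A\<^esub> ?C i j) = (\<Oplus>\<^bsub>A\<^esub>j\<in>{..<n}. ?C i j \<otimes>\<^bsub>A\<^esub> ?C' j i)"
      using i by (intro A.finsum_cong' refl) (simp_all add: Pi_def A.m_comm)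
    also have "(\<Oplus>\<^bsub>A\<^esub>j\<in>{..<n}. D (?C' j i) \<otimes>\<^bsub>A\<^esub> \<theta> i (e j)) =
        D (?C' i i) \<oplus>\<^bsub>A\<^esub> g i \<otimes>\<^bsub>A\<^esub> (\<Oplus>\<^bsub>A\<^esub>j\<in>{..<n}. D (u j) \<otimes>\<^bsub>A\<^esub> ?C' j i)"
      using i by (simp add: sum_coordinates_right u_C' A.minus_eq A.r_minus Pi_def)
    also have "g i \<otimes>\<^bsub>A\<^esub> (\<Oplus>\<^bsub>A\<^esub>j\<in>{..<n}. D (u j) \<otimes>\<^bsub>A\<^esub> ?C' j i) =
        (\<Oplus>\<^bsub>A\<^esub>j\<in>{..<n}. g i \<otimes>\<^bsub>A\<^esub> (D (u j) \<otimes>\<^bsub>A\<^esub> ?C' j i))"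
      using i by (intro A.finsum_rdistr) (auto simp: Pi_def)
    also have "\<dots> = (\<Oplus>\<^bsub>A\<^esub>j\<in>{..<n}. D (u j) \<otimes>\<^bsub>A\<^esub> (g i \<otimes>\<^bsub>A\<^esub> ?C' j i))"
      using i by (intro A.finsum_cong' refl) (simp_all add: Pi_def A.m_lcomm)
    finally show ?thesis using i by (simp add: Pi_def A.a_assoc)
  qed
  then have "(\<Oplus>\<^bsub>A\<^esub>i\<in>{..<n}. \<theta> i (\<Gamma> D (\<Gamma> D' (e i)))) =
      (\<Oplus>\<^bsub>A\<^esub>i\<in>{..<n}. (\<Oplus>\<^bsub>A\<^esub>j\<in>{..<n}. ?C i j \<otimes>\<^bsub>A\<^esub> ?C' j i) \<oplus>\<^bsub>A\<^esub> D (?C' i i) \<oplus>\<^bsub>A\<^esub>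
      (\<Oplus>\<^bsub>A\<^esub>j\<in>{..<n}. D (u j) \<otimes>\<^bsub>A\<^esub> (g i \<otimes>\<^bsub>A\<^esub> ?C' j i)))"
    by (intro A.finsum_cong' refl) (simp_all add: Pi_def)
  also have "\<dots> = (\<Oplus>\<^bsub>A\<^esub>i\<in>{..<n}. \<Oplus>\<^bsub>A\<^esub>j\<in>{..<n}. ?C i j \<otimes>\<^bsub>A\<^esub> ?C' j i) \<oplus>\<^bsub>A\<^esub> (\<Oplus>\<^bsub>A\<^esub>i\<in>{..<n}. D (?C' i i)) \<oplus>\<^bsub>A\<^esub>
      (\<Oplus>\<^bsub>A\<^esub>i\<in>{..<n}. \<Oplus>\<^bsub>A\<^esub>j\<in>{..<n}. D (u j) \<otimes>\<^bsub>A\<^esub> (g i \<otimes>\<^bsub>A\<^esub> ?C' j i))"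
    by (simp add: A.finsum_addf Pi_def)
  also have "(\<Oplus>\<^bsub>A\<^esub>i\<in>{..<n}. D (?C' i i)) = D (\<Oplus>\<^bsub>A\<^esub>i\<in>{..<n}. ?C' i i)"
    by (rule der_finsum[OF D, symmetric]) (auto simp: Pi_def)
  also have "(\<Oplus>\<^bsub>A\<^esub>i\<in>{..<n}. \<Oplus>\<^bsub>A\<^esub>j\<in>{..<n}. D (u j) \<otimes>\<^bsub>A\<^esub> (g i \<otimes>\<^bsub>A\<^esub> ?C' j i)) =
      \<ominus>\<^bsub>A\<^esub> ((\<Oplus>\<^bsub>A\<^esub>i\<in>{..<n}. D (u i) \<otimes>\<^bsub>A\<^esub> D' (g i)) \<oplus>\<^bsub>A\<^esub>
        (\<Oplus>\<^bsub>A\<^esub>i\<in>{..<n}. g i \<otimes>\<^bsub>A\<^esub> D (u i)) \<otimes>\<^bsub>A\<^esub> (\<Oplus>\<^bsub>A\<^esub>i\<in>{..<n}. g i \<otimes>\<^bsub>A\<^esub> D' (u i)))"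
  proof -
    let ?Y = "\<Oplus>\<^bsub>A\<^esub>i\<in>{..<n}. g i \<otimes>\<^bsub>A\<^esub> D' (u i)"
    have Y [simp]: "?Y \<in> carrier A" by (simp add: Pi_def)
    have "(\<Oplus>\<^bsub>A\<^esub>i\<in>{..<n}. \<Oplus>\<^bsub>A\<^esub>j\<in>{..<n}. D (u j) \<otimes>\<^bsub>A\<^esub> (g i \<otimes>\<^bsub>A\<^esub> ?C' j i)) =
        (\<Oplus>\<^bsub>A\<^esub>j\<in>{..<n}. \<Oplus>\<^bsub>A\<^esub>i\<in>{..<n}. D (u j) \<otimes>\<^bsub>A\<^esub> (g i \<otimes>\<^bsub>A\<^esub> ?C' j i))"
      by (intro A.finsum_swap) simp_all
    also have "\<dots> = (\<Oplus>\<^bsub>A\<^esub>j\<in>{..<n}. \<ominus>\<^bsub>A\<^esub> (D (u j) \<otimes>\<^bsub>A\<^esub> D' (g j) \<oplus>\<^bsub>A\<^esub> g j \<otimes>\<^bsub>A\<^esub> D (u j) \<otimes>\<^bsub>A\<^esub> ?Y))"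
    proof (intro A.finsum_cong' refl)
      fix j assume j: "j \<in> {..<n}"
      have "(\<Oplus>\<^bsub>A\<^esub>i\<in>{..<n}. D (u j) \<otimes>\<^bsub>A\<^esub> (g i \<otimes>\<^bsub>A\<^esub> ?C' j i)) =
          D (u j) \<otimes>\<^bsub>A\<^esub> (\<Oplus>\<^bsub>A\<^esub>i\<in>{..<n}. g i \<otimes>\<^bsub>A\<^esub> ?C' j i)"
        using j by (intro A.finsum_rdistr[symmetric]) (auto simp: Pi_def)
      also have "\<dots> = D (u j) \<otimes>\<^bsub>A\<^esub> \<ominus>\<^bsub>A\<^esub> (D' (g j) \<oplus>\<^bsub>A\<^esub> g j \<otimes>\<^bsub>A\<^esub> ?Y)" using C'_g j by simp
      also have "\<dots> = \<ominus>\<^bsub>A\<^esub> (D (u j) \<otimes>\<^bsub>A\<^esub> D' (g j) \<oplus>\<^bsub>A\<^esub> g j \<otimes>\<^bsub>A\<^esub> D (u j) \<otimes>\<^bsub>A\<^esub> ?Y)"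
        using j by (simp add: A.r_minus A.r_distr A.m_ac)
      finally show "(\<Oplus>\<^bsub>A\<^esub>i\<in>{..<n}. D (u j) \<otimes>\<^bsub>A\<^esub> (g i \<otimes>\<^bsub>A\<^esub> ?C' j i)) =
          \<ominus>\<^bsub>A\<^esub> (D (u j) \<otimes>\<^bsub>A\<^esub> D' (g j) \<oplus>\<^bsub>A\<^esub> g j \<otimes>\<^bsub>A\<^esub> D (u j) \<otimes>\<^bsub>A\<^esub> ?Y)" .
    qed (simp add: Pi_def)
    also have "\<dots> = \<ominus>\<^bsub>A\<^esub> ((\<Oplus>\<^bsub>A\<^esub>i\<in>{..<n}. D (u i) \<otimes>\<^bsub>A\<^esub> D' (g i)) \<oplus>\<^bsub>A\<^esub>
        (\<Oplus>\<^bsub>A\<^esub>i\<in>{..<n}. g i \<otimes>\<^bsub>A\<^esub> D (u i)) \<otimes>\<^bsub>A\<^esub> ?Y)"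
      by (simp add: A.finsum_minus A.finsum_addf A.finsum_ldistr Pi_def)
    finally show ?thesis .
  qed
  finally show ?thesis by (simp add: A.minus_eq A.minus_add A.a_assoc Pi_def)
qed

text \<open>After antisymmetrisation of \<open>trace_composite\<close>, the trace of the connection matrix accounts for all terms except
  \<open>\<Sum>\<^sub>i (D' u\<^sub>i) (D g\<^sub>i) - (D u\<^sub>i) (D' g\<^sub>i)\<close>. These are the differential of the one-form \<open>D \<mapsto> \<Sum>\<^sub>i g\<^sub>i D u\<^sub>i\<close>, which is
  the correction term in \<open>\<alpha>\<close>.\<close>

lemma trace_curvature:
  fixes \<alpha> defines "\<alpha> \<equiv> \<lambda>D.
    (\<Oplus>\<^bsub>A\<^esub>i\<in>{..<n}. \<theta> i (\<Gamma> D (e i))) \<oplus>\<^bsub>A\<^esub> (\<Oplus>\<^bsub>A\<^esub>i\<in>{..<n}. g i \<otimes>\<^bsub>A\<^esub> D (u i))"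
  assumes D: "D \<in> derivations K A" and D': "D' \<in> derivations K A"
  shows "proj_trace A E (curvature A E \<Gamma> D D') =
    D (\<alpha> D') \<ominus>\<^bsub>A\<^esub> D' (\<alpha> D) \<ominus>\<^bsub>A\<^esub> \<alpha> (der_bracket A D D')"
proof -
  let ?B = "der_bracket A D D'"
  have B: "?B \<in> derivations K A" using D D' by simp
  note [simp] = der_closed[OF D] der_closed[OF D'] der_closed[OF B]
    connection_closed[OF \<Gamma> D] connection_closed[OF \<Gamma> D'] connection_closed[OF \<Gamma> B]
  \<comment> \<open>\<open>S\<close>, \<open>U\<close> and \<open>Y\<close> name the sums in \<open>trace_composite\<close>; \<open>Z\<close> collects the second derivatives that arise
      when \<open>Y\<close> is differentiated.\<close>
  define \<tau> where "\<tau> = (\<lambda>D. \<Oplus>\<^bsub>A\<^esub>i\<in>{..<n}. \<theta> i (\<Gamma> D (e i)))"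
  define S where "S = (\<lambda>D D'. \<Oplus>\<^bsub>A\<^esub>i\<in>{..<n}. \<Oplus>\<^bsub>A\<^esub>j\<in>{..<n}. \<theta> i (\<Gamma> D (e j)) \<otimes>\<^bsub>A\<^esub> \<theta> j (\<Gamma> D' (e i)))"
  define U where "U = (\<lambda>(D :: 'a \<Rightarrow> 'a) (D' :: 'a \<Rightarrow> 'a). \<Oplus>\<^bsub>A\<^esub>i\<in>{..<n}. D (u i) \<otimes>\<^bsub>A\<^esub> D' (g i))"
  define Y where "Y = (\<lambda>(D :: 'a \<Rightarrow> 'a). \<Oplus>\<^bsub>A\<^esub>i\<in>{..<n}. g i \<otimes>\<^bsub>A\<^esub> D (u i))"
  define Z where "Z = (\<lambda>(D :: 'a \<Rightarrow> 'a) (D' :: 'a \<Rightarrow> 'a). \<Oplus>\<^bsub>A\<^esub>i\<in>{..<n}. g i \<otimes>\<^bsub>A\<^esub> D (D' (u i)))"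
  have \<alpha>: "\<alpha> d = \<tau> d \<oplus>\<^bsub>A\<^esub> Y d" for d
    by (simp add: \<alpha>_def \<tau>_def Y_def)
  have closed: "\<tau> D \<in> carrier A" "\<tau> D' \<in> carrier A" "\<tau> ?B \<in> carrier A"
    "S D D' \<in> carrier A" "S D' D \<in> carrier A" "U D D' \<in> carrier A" "U D' D \<in> carrier A"
    "Y D \<in> carrier A" "Y D' \<in> carrier A" "Y ?B \<in> carrier A" "Z D D' \<in> carrier A" "Z D' D \<in> carrier A"
    by (simp_all add: \<tau>_def S_def U_def Y_def Z_def Pi_def)
  have "S D D' = (\<Oplus>\<^bsub>A\<^esub>j\<in>{..<n}. \<Oplus>\<^bsub>A\<^esub>i\<in>{..<n}. \<theta> i (\<Gamma> D (e j)) \<otimes>\<^bsub>A\<^esub> \<theta> j (\<Gamma> D' (e i)))"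
    unfolding S_def by (intro A.finsum_swap) simp_all
  also have "\<dots> = S D' D"
    unfolding S_def by (intro A.finsum_cong' refl) (simp_all add: Pi_def A.m_comm)
  finally have S: "S D D' = S D' D" .
  have Y_der: "D (Y D') = Z D D' \<oplus>\<^bsub>A\<^esub> U D' D" "D' (Y D) = Z D' D \<oplus>\<^bsub>A\<^esub> U D D'"
  proof -
    have "(\<Oplus>\<^bsub>A\<^esub>i\<in>{..<n}. D (g i) \<otimes>\<^bsub>A\<^esub> D' (u i)) = U D' D"
      "(\<Oplus>\<^bsub>A\<^esub>i\<in>{..<n}. D' (g i) \<otimes>\<^bsub>A\<^esub> D (u i)) = U D D'"
      unfolding U_def by (intro A.finsum_cong' refl, simp_all add: Pi_def A.m_comm)+
    then show "D (Y D') = Z D D' \<oplus>\<^bsub>A\<^esub> U D' D" "D' (Y D) = Z D' D \<oplus>\<^bsub>A\<^esub> U D D'"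
      using der_pairing[OF D, of g "\<lambda>i. D' (u i)"] der_pairing[OF D', of g "\<lambda>i. D (u i)"]
      by (simp_all add: Y_def Z_def)
  qed
  have Y_B: "Y ?B = Z D D' \<ominus>\<^bsub>A\<^esub> Z D' D"
  proof -
    have "Y ?B = (\<Oplus>\<^bsub>A\<^esub>i\<in>{..<n}. g i \<otimes>\<^bsub>A\<^esub> D (D' (u i)) \<ominus>\<^bsub>A\<^esub> g i \<otimes>\<^bsub>A\<^esub> D' (D (u i)))"
      unfolding Y_def
      by (intro A.finsum_cong' refl) (simp_all add: Pi_def A.minus_eq A.r_distr A.r_minus)
    then show ?thesis by (simp add: Z_def A.finsum_diff Pi_def)
  qed
  have "proj_trace A E (curvature A E \<Gamma> D D') =
      (\<Oplus>\<^bsub>A\<^esub>i\<in>{..<n}. \<theta> i (curvature A E \<Gamma> D D' (e i)))"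
    by (rule proj_trace_eq[OF dual curvature_linear[OF \<Gamma> D D']])
  also have "\<dots> = (\<Oplus>\<^bsub>A\<^esub>i\<in>{..<n}. (\<theta> i (\<Gamma> D (\<Gamma> D' (e i))) \<ominus>\<^bsub>A\<^esub> \<theta> i (\<Gamma> D' (\<Gamma> D (e i)))) \<ominus>\<^bsub>A\<^esub> \<theta> i (\<Gamma> ?B (e i)))"
    by (intro A.finsum_cong' refl) (simp_all add: Pi_def curvature_def functional_diff[OF \<theta>_functional])
  also have "\<dots> = ((\<Oplus>\<^bsub>A\<^esub>i\<in>{..<n}. \<theta> i (\<Gamma> D (\<Gamma> D' (e i)))) \<ominus>\<^bsub>A\<^esub> (\<Oplus>\<^bsub>A\<^esub>i\<in>{..<n}. \<theta> i (\<Gamma> D' (\<Gamma> D (e i))))) \<ominus>\<^bsub>A\<^esub> \<tau> ?B"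
    by (simp add: A.finsum_diff \<tau>_def Pi_def)
  also have "\<dots> = (((S D D' \<oplus>\<^bsub>A\<^esub> D (\<tau> D')) \<ominus>\<^bsub>A\<^esub> U D D' \<ominus>\<^bsub>A\<^esub> Y D \<otimes>\<^bsub>A\<^esub> Y D') \<ominus>\<^bsub>A\<^esub>
      ((S D D' \<oplus>\<^bsub>A\<^esub> D' (\<tau> D)) \<ominus>\<^bsub>A\<^esub> U D' D \<ominus>\<^bsub>A\<^esub> Y D' \<otimes>\<^bsub>A\<^esub> Y D)) \<ominus>\<^bsub>A\<^esub> \<tau> ?B"
    using trace_composite[OF D D'] trace_composite[OF D' D] S
    by (simp add: \<tau>_def S_def U_def Y_def)
  also have "\<dots> = (D (\<tau> D') \<oplus>\<^bsub>A\<^esub> (Z D D' \<oplus>\<^bsub>A\<^esub> U D' D)) \<ominus>\<^bsub>A\<^esub> (D' (\<tau> D) \<oplus>\<^bsub>A\<^esub> (Z D' D \<oplus>\<^bsub>A\<^esub> U D D')) \<ominus>\<^bsub>A\<^esub>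
      (\<tau> ?B \<oplus>\<^bsub>A\<^esub> (Z D D' \<ominus>\<^bsub>A\<^esub> Z D' D))"
  proof -
    have "D (\<tau> D') \<in> carrier A" "D' (\<tau> D) \<in> carrier A" using closed by simp_all
    with closed show ?thesis by algebra
  qed
  also have "\<dots> = D (\<alpha> D') \<ominus>\<^bsub>A\<^esub> D' (\<alpha> D) \<ominus>\<^bsub>A\<^esub> \<alpha> ?B"
    using closed by (simp add: \<alpha> Y_der Y_B der_add[OF D] der_add[OF D'])
  finally show ?thesis .
qed

lemma chern_form_exact: "chern_form K A E \<Gamma> \<in> lr_coboundaries K A 2"
proof -
  define \<alpha> where "\<alpha> = (\<lambda>D.
    (\<Oplus>\<^bsub>A\<^esub>i\<in>{..<n}. \<theta> i (\<Gamma> D (e i))) \<oplus>\<^bsub>A\<^esub> (\<Oplus>\<^bsub>A\<^esub>i\<in>{..<n}. g i \<otimes>\<^bsub>A\<^esub> D (u i)))"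
  define \<omega> where "\<omega> = (\<lambda>ds\<in>der_tuples K A (Suc 0). \<alpha> (ds ! 0))"
  have \<omega>: "\<omega> \<in> lr_forms K A (Suc 0)"
    unfolding \<omega>_def
  proof (rule one_formI)
    fix D assume D: "D \<in> derivations K A"
    note [simp] = der_closed[OF D] connection_closed[OF \<Gamma> D]
    show "\<alpha> D \<in> carrier A" by (simp add: \<alpha>_def Pi_def)
    show "\<alpha> (D \<oplus>\<^bsub>Der K A\<^esub> D') = \<alpha> D \<oplus>\<^bsub>A\<^esub> \<alpha> D'" if D': "D' \<in> derivations K A" for D'
    proof -
      note [simp] = der_closed[OF D'] connection_closed[OF \<Gamma> D']
      have "(\<Oplus>\<^bsub>A\<^esub>i\<in>{..<n}. \<theta> i (\<Gamma> (D \<oplus>\<^bsub>Der K A\<^esub> D') (e i))) =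
          (\<Oplus>\<^bsub>A\<^esub>i\<in>{..<n}. \<theta> i (\<Gamma> D (e i)) \<oplus>\<^bsub>A\<^esub> \<theta> i (\<Gamma> D' (e i)))"
        using D D' by (intro A.finsum_cong' refl)
          (simp_all add: Pi_def connection_der_add[OF \<Gamma>] functional_add[OF \<theta>_functional])
      moreover have "(\<Oplus>\<^bsub>A\<^esub>i\<in>{..<n}. g i \<otimes>\<^bsub>A\<^esub> (D \<oplus>\<^bsub>Der K A\<^esub> D') (u i)) =
          (\<Oplus>\<^bsub>A\<^esub>i\<in>{..<n}. g i \<otimes>\<^bsub>A\<^esub> D (u i) \<oplus>\<^bsub>A\<^esub> g i \<otimes>\<^bsub>A\<^esub> D' (u i))"
        by (intro A.finsum_cong' refl) (simp_all add: Pi_def A.r_distr)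
      ultimately show ?thesis by (simp add: \<alpha>_def A.finsum_addf Pi_def A.a_ac)
    qed
    show "\<alpha> (a \<odot>\<^bsub>Der K A\<^esub> D) = a \<otimes>\<^bsub>A\<^esub> \<alpha> D" if a: "a \<in> carrier A" for a
    proof -
      have "(\<Oplus>\<^bsub>A\<^esub>i\<in>{..<n}. \<theta> i (\<Gamma> (a \<odot>\<^bsub>Der K A\<^esub> D) (e i))) =
          (\<Oplus>\<^bsub>A\<^esub>i\<in>{..<n}. a \<otimes>\<^bsub>A\<^esub> \<theta> i (\<Gamma> D (e i)))"
        using D a by (intro A.finsum_cong' refl)
          (simp_all add: Pi_def connection_der_smult[OF \<Gamma>] functional_smult[OF \<theta>_functional])
      moreover have "(\<Oplus>\<^bsub>A\<^esub>i\<in>{..<n}. g i \<otimes>\<^bsub>A\<^esub> (a \<odot>\<^bsub>Der K A\<^esub> D) (u i)) =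
          (\<Oplus>\<^bsub>A\<^esub>i\<in>{..<n}. a \<otimes>\<^bsub>A\<^esub> (g i \<otimes>\<^bsub>A\<^esub> D (u i)))"
        using a by (intro A.finsum_cong' refl) (simp_all add: Pi_def A.m_lcomm)
      ultimately show ?thesis
        using a by (simp add: \<alpha>_def A.finsum_rdistr[symmetric] A.r_distr Pi_def)
    qed
  qed
  have "chern_form K A E \<Gamma> ds = lr_d K A (Suc 0) \<omega> ds" for ds
  proof (cases "ds \<in> der_tuples K A 2")
    case True
    then obtain D D' where ds: "ds = [D, D']" "D \<in> derivations K A" "D' \<in> derivations K A"
      unfolding der_tuples_2 by auto
    have val: "\<omega> [Z] = \<alpha> Z" if "Z \<in> derivations K A" for Z
      using that by (auto simp: \<omega>_def der_tuples_1)
    have "chern_form K A E \<Gamma> ds = proj_trace A E (curvature A E \<Gamma> D D')"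
      using True by (simp add: chern_form_def ds(1))
    also have "\<dots> = D (\<alpha> D') \<ominus>\<^bsub>A\<^esub> D' (\<alpha> D) \<ominus>\<^bsub>A\<^esub> \<alpha> (der_bracket A D D')"
      unfolding \<alpha>_def by (rule trace_curvature[OF ds(2,3)])
    also have "\<dots> = lr_d K A (Suc 0) \<omega> ds"
      unfolding ds(1) using ds(2,3) by (simp add: lr_d_1[OF \<omega>] val)
    finally show ?thesis .
  next
    case False
    then show ?thesis unfolding chern_form_def lr_d_def by (simp add: numeral_2_eq_2)
  qed
  then show ?thesis unfolding lr_coboundaries_2 using \<omega> by blast
qed

end

text \<open>Every connection yields the zero class, and there is at least one connection, so the definite description in
  \<^const>\<open>chern1\<close> denotes the zero class.\<close>

theorem chern1_trivial: "chern1 K A E = \<one>\<^bsub>lr_cohomology K A 2\<^esub>"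
proof -
  have "lr_class K A 2 (chern_form K A E \<Gamma>) = \<one>\<^bsub>lr_cohomology K A 2\<^esub>"
    if "\<Gamma> \<in> connections K A E" for \<Gamma>
    by (rule lr_class_coboundary[OF chern_form_exact[OF that]])
  then show ?thesis
    unfolding chern1_def using projection_connection[OF dual] by (intro the_equality) auto
qed

end

section \<open>Free modules, generated submodules and quotients\<close>

context cring
begin

lemma free_module_simps:
  "carrier (free_module R S) = {f \<in> S \<rightarrow>\<^sub>E carrier R. finite {s \<in> S. f s \<noteq> \<zero>}}"
  "\<zero>\<^bsub>free_module R S\<^esub> = (\<lambda>s\<in>S. \<zero>)"
  "f \<oplus>\<^bsub>free_module R S\<^esub> g = (\<lambda>s\<in>S. f s \<oplus> g s)"
  "a \<odot>\<^bsub>free_module R S\<^esub> f = (\<lambda>s\<in>S. a \<otimes> f s)"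
  by (simp_all add: free_module_def)

lemma free_moduleD:
  assumes "f \<in> carrier (free_module R S)"
  shows "s \<in> S \<Longrightarrow> f s \<in> carrier R" "finite {s \<in> S. f s \<noteq> \<zero>}" "f \<in> extensional S"
  using assms unfolding free_module_simps by (auto simp: PiE_def)

lemma free_moduleI:
  assumes "\<And>s. s \<in> S \<Longrightarrow> f s \<in> carrier R" "finite T" "\<And>s. s \<in> S \<Longrightarrow> s \<notin> T \<Longrightarrow> f s = \<zero>"
  shows "(\<lambda>s\<in>S. f s) \<in> carrier (free_module R S)"
proof -
  have "{s \<in> S. (\<lambda>s\<in>S. f s) s \<noteq> \<zero>} \<subseteq> T" using assms(3) by auto
  then have "finite {s \<in> S. (\<lambda>s\<in>S. f s) s \<noteq> \<zero>}" using assms(2) finite_subset by blast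
  moreover have "(\<lambda>s\<in>S. f s) \<in> S \<rightarrow>\<^sub>E carrier R" using assms(1) by (simp add: restrict_PiE_iff)
  ultimately show ?thesis unfolding free_module_simps by blast
qed

lemma free_module_is_module: "module R (free_module R S)"
proof (rule moduleI)
  let ?F = "free_module R S"
  let ?T = "\<lambda>f. {s \<in> S. f s \<noteq> \<zero>}"
  have zero: "\<zero>\<^bsub>?F\<^esub> \<in> carrier ?F" by (auto simp: free_module_simps)
  have val [simp]: "f s \<in> carrier R" if "f \<in> carrier ?F" "s \<in> S" for f s
    by (rule free_moduleD(1)[OF that])
  have fin [simp]: "finite (?T f)" if "f \<in> carrier ?F" for f
    by (rule free_moduleD(2)[OF that])
  have add: "f \<oplus>\<^bsub>?F\<^esub> g \<in> carrier ?F" if "f \<in> carrier ?F" "g \<in> carrier ?F" for f g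
    unfolding free_module_simps(3)
    by (rule free_moduleI[where T = "?T f \<union> ?T g"]) (use that in auto)
  have smult: "a \<odot>\<^bsub>?F\<^esub> f \<in> carrier ?F" if "a \<in> carrier R" "f \<in> carrier ?F" for a f
    unfolding free_module_simps(4)
    by (rule free_moduleI[where T = "?T f"]) (use that in auto)
  have ext: "f = g" if "f \<in> carrier ?F" "g \<in> carrier ?F" "\<And>s. s \<in> S \<Longrightarrow> f s = g s" for f g
    by (rule extensionalityI[OF free_moduleD(3)[OF that(1)] free_moduleD(3)[OF that(2)] that(3)])
  show "cring R" by (rule is_cring)
  show "abelian_group ?F"
  proof (rule abelian_groupI)
    fix f assume f: "f \<in> carrier ?F"
    have neg: "(\<lambda>s\<in>S. \<ominus> f s) \<in> carrier ?F"
      by (rule free_moduleI[where T = "?T f"]) (use f in auto)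
    moreover have "(\<lambda>s\<in>S. \<ominus> f s) \<oplus>\<^bsub>?F\<^esub> f = \<zero>\<^bsub>?F\<^esub>"
      by (rule ext[OF add[OF neg f] zero]) (use f in \<open>auto simp: free_module_simps(2,3) l_neg\<close>)
    ultimately show "\<exists>g\<in>carrier ?F. g \<oplus>\<^bsub>?F\<^esub> f = \<zero>\<^bsub>?F\<^esub>" by blast
    show "\<zero>\<^bsub>?F\<^esub> \<oplus>\<^bsub>?F\<^esub> f = f"
      by (rule ext[OF add[OF zero f] f]) (use f in \<open>auto simp: free_module_simps(2,3)\<close>)
    fix g assume g: "g \<in> carrier ?F"
    show "f \<oplus>\<^bsub>?F\<^esub> g = g \<oplus>\<^bsub>?F\<^esub> f"
      by (rule ext[OF add[OF f g] add[OF g f]])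
        (use f g in \<open>auto simp: free_module_simps(3) a_comm\<close>)
    fix h assume h: "h \<in> carrier ?F"
    show "(f \<oplus>\<^bsub>?F\<^esub> g) \<oplus>\<^bsub>?F\<^esub> h = f \<oplus>\<^bsub>?F\<^esub> (g \<oplus>\<^bsub>?F\<^esub> h)"
      by (rule ext[OF add[OF add[OF f g] h] add[OF f add[OF g h]]])
        (use f g h in \<open>auto simp: free_module_simps(3) a_assoc\<close>)
  qed (use zero add in auto)
  show "\<one> \<odot>\<^bsub>?F\<^esub> f = f" if f: "f \<in> carrier ?F" for f
    by (rule ext[OF smult[OF one_closed f] f]) (use f in \<open>auto simp: free_module_simps(4)\<close>)
  fix a f assume a: "a \<in> carrier R" and f: "f \<in> carrier ?F"
  show "a \<odot>\<^bsub>?F\<^esub> f \<in> carrier ?F" by (rule smult[OF a f])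
  show "(a \<oplus> b) \<odot>\<^bsub>?F\<^esub> f = a \<odot>\<^bsub>?F\<^esub> f \<oplus>\<^bsub>?F\<^esub> b \<odot>\<^bsub>?F\<^esub> f" if b: "b \<in> carrier R" for b
    by (rule ext[OF smult[OF a_closed[OF a b] f] add[OF smult[OF a f] smult[OF b f]]])
      (use a b f in \<open>auto simp: free_module_simps(3,4) l_distr\<close>)
  show "(a \<otimes> b) \<odot>\<^bsub>?F\<^esub> f = a \<odot>\<^bsub>?F\<^esub> (b \<odot>\<^bsub>?F\<^esub> f)" if b: "b \<in> carrier R" for b
    by (rule ext[OF smult[OF m_closed[OF a b] f] smult[OF a smult[OF b f]]])
      (use a b f in \<open>auto simp: free_module_simps(4) m_assoc\<close>)
  show "a \<odot>\<^bsub>?F\<^esub> (f \<oplus>\<^bsub>?F\<^esub> g) = a \<odot>\<^bsub>?F\<^esub> f \<oplus>\<^bsub>?F\<^esub> a \<odot>\<^bsub>?F\<^esub> g" if g: "g \<in> carrier ?F" for g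
    by (rule ext[OF smult[OF a add[OF f g]] add[OF smult[OF a f] smult[OF a g]]])
      (use a f g in \<open>auto simp: free_module_simps(3,4) r_distr\<close>)
qed

lemma free_gen_closed: "s \<in> S \<Longrightarrow> free_gen R S s \<in> carrier (free_module R S)"
  unfolding free_gen_def by (rule free_moduleI[where T = "{s}"]) auto

text \<open>Induction on a finite set containing the support: split off the coefficient of one symbol and clear it.\<close>

lemma free_module_generated:
  assumes N: "submodule N R (free_module R S)"
    and gens: "\<And>s. s \<in> S \<Longrightarrow> free_gen R S s \<in> N"
    and f: "f \<in> carrier (free_module R S)"
  shows "f \<in> N"
proof -
  let ?F = "free_module R S"
  interpret F: module R ?F by (rule free_module_is_module)
  note sub = F.submoduleE[OF N]
  have zero: "\<zero>\<^bsub>?F\<^esub> \<in> N" using subgroup.one_closed[OF submodule.axioms(1)[OF N]] by simp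
  have "f \<in> N" if "finite T" "f \<in> carrier ?F" "{s \<in> S. f s \<noteq> \<zero>} \<subseteq> T" for T f
    using that
  proof (induction T arbitrary: f)
    case empty
    then have "f = \<zero>\<^bsub>?F\<^esub>"
      unfolding free_module_simps(2)
      using free_moduleD(3) by (intro extensionalityI[of _ S]) (auto simp: extensional_def)
    then show ?case using zero by simp
  next
    case (insert t T)
    show ?case
    proof (cases "t \<in> S")
      case False
      then show ?thesis using insert by auto
    next
      case True
      define h where "h = (\<lambda>s\<in>S. if s = t then \<zero> else f s)"
      have h: "h \<in> carrier ?F"
        unfolding h_def using insert.prems free_moduleD
        by (intro free_moduleI[where T = "{s \<in> S. f s \<noteq> \<zero>}"]) auto
      have "h \<in> N" using insert.prems by (intro insert.IH h) (auto simp: h_def)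
      moreover have ft: "f t \<in> carrier R" using True free_moduleD(1)[OF insert.prems(1)] by simp
      then have "f t \<odot>\<^bsub>?F\<^esub> free_gen R S t \<in> N" using sub(4) gens True by simp
      moreover have "f = f t \<odot>\<^bsub>?F\<^esub> free_gen R S t \<oplus>\<^bsub>?F\<^esub> h"
        using True ft free_moduleD(1)[OF insert.prems(1)] free_moduleD(3)[OF insert.prems(1)]
        by (intro extensionalityI[of _ S]) (auto simp: free_module_simps(3,4) free_gen_def h_def)
      ultimately show ?thesis using sub(5) by metis
    qed
  qed
  then show ?thesis using f free_moduleD(2)[OF f] by blast
qed

text \<open>The linear extension of \<open>\<delta>\<close> from the symbols to all of the free module.\<close>

definition free_lift :: "'s set \<Rightarrow> ('s \<Rightarrow> 'a) \<Rightarrow> ('s \<Rightarrow> 'a) \<Rightarrow> 'a" where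
  "free_lift S \<delta> = (\<lambda>f\<in>carrier (free_module R S). \<Oplus>s\<in>{s \<in> S. f s \<noteq> \<zero>}. f s \<otimes> \<delta> s)"

text \<open>Allowing any finite set that contains the support makes it possible to add two elements with different supports
  over a common index set.\<close>

lemma free_lift_eq:
  assumes \<delta>: "\<delta> \<in> S \<rightarrow> carrier R" and f: "f \<in> carrier (free_module R S)"
    and T: "finite T" "T \<subseteq> S" "{s \<in> S. f s \<noteq> \<zero>} \<subseteq> T"
  shows "free_lift S \<delta> f = (\<Oplus>s\<in>T. f s \<otimes> \<delta> s)"
proof -
  have "(\<Oplus>s\<in>{s \<in> S. f s \<noteq> \<zero>}. f s \<otimes> \<delta> s) = (\<Oplus>s\<in>T. f s \<otimes> \<delta> s)"
    using T \<delta> free_moduleD[OF f] by (intro add.finprod_mono_neutral_cong_left) (auto simp: Pi_def)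
  then show ?thesis using f by (simp add: free_lift_def)
qed

lemma free_lift_functional:
  assumes \<delta>: "\<delta> \<in> S \<rightarrow> carrier R"
  shows "free_lift S \<delta> \<in> lin_functionals R (free_module R S)"
proof -
  let ?F = "free_module R S"
  let ?T = "\<lambda>f. {s \<in> S. f s \<noteq> \<zero>}"
  interpret F: module R ?F by (rule free_module_is_module)
  have \<delta>' [simp]: "s \<in> S \<Longrightarrow> \<delta> s \<in> carrier R" for s using \<delta> by auto
  have "free_lift S \<delta> f \<in> carrier R" if "f \<in> carrier ?F" for f
    using that free_moduleD(1)[OF that] by (auto simp: free_lift_def intro!: finsum_closed)
  moreover have "free_lift S \<delta> (f \<oplus>\<^bsub>?F\<^esub> g) = free_lift S \<delta> f \<oplus> free_lift S \<delta> g"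
    if f: "f \<in> carrier ?F" and g: "g \<in> carrier ?F" for f g
  proof -
    let ?U = "?T f \<union> ?T g"
    note D = free_moduleD[OF f] free_moduleD[OF g]
    have U: "finite ?U" "?U \<subseteq> S" using D by auto
    have "f \<oplus>\<^bsub>?F\<^esub> g \<in> carrier ?F" using f g by simp
    then have "free_lift S \<delta> (f \<oplus>\<^bsub>?F\<^esub> g) = (\<Oplus>s\<in>?U. (f \<oplus>\<^bsub>?F\<^esub> g) s \<otimes> \<delta> s)"
      using U by (intro free_lift_eq[OF \<delta>]) (auto simp: free_module_simps(3))
    also have "\<dots> = (\<Oplus>s\<in>?U. f s \<otimes> \<delta> s \<oplus> g s \<otimes> \<delta> s)"
      using D by (intro finsum_cong' refl) (auto simp: free_module_simps(3) l_distr)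
    also have "\<dots> = (\<Oplus>s\<in>?U. f s \<otimes> \<delta> s) \<oplus> (\<Oplus>s\<in>?U. g s \<otimes> \<delta> s)"
      using D by (intro finsum_addf) auto
    also have "(\<Oplus>s\<in>?U. f s \<otimes> \<delta> s) = free_lift S \<delta> f"
      using U by (intro free_lift_eq[OF \<delta> f, symmetric]) auto
    also have "(\<Oplus>s\<in>?U. g s \<otimes> \<delta> s) = free_lift S \<delta> g"
      using U by (intro free_lift_eq[OF \<delta> g, symmetric]) auto
    finally show ?thesis .
  qed
  moreover have "free_lift S \<delta> (a \<odot>\<^bsub>?F\<^esub> f) = a \<otimes> free_lift S \<delta> f"
    if a: "a \<in> carrier R" and f: "f \<in> carrier ?F" for a f
  proof -
    note D = free_moduleD[OF f]
    have "a \<odot>\<^bsub>?F\<^esub> f \<in> carrier ?F" using a f by simp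
    then have "free_lift S \<delta> (a \<odot>\<^bsub>?F\<^esub> f) = (\<Oplus>s\<in>?T f. (a \<odot>\<^bsub>?F\<^esub> f) s \<otimes> \<delta> s)"
      using a f D by (intro free_lift_eq[OF \<delta>]) (auto simp: free_module_simps(4))
    also have "\<dots> = (\<Oplus>s\<in>?T f. a \<otimes> (f s \<otimes> \<delta> s))"
      using a D by (intro finsum_cong' refl) (auto simp: free_module_simps(4) m_assoc)
    also have "\<dots> = a \<otimes> (\<Oplus>s\<in>?T f. f s \<otimes> \<delta> s)"
      using a D by (intro finsum_rdistr[symmetric]) auto
    finally show ?thesis using f by (simp add: free_lift_def)
  qed
  ultimately show ?thesis
    unfolding lin_functionals_def by (auto simp: free_lift_def)
qed

lemma free_lift_gen:
  assumes \<delta>: "\<delta> \<in> S \<rightarrow> carrier R" and s: "s \<in> S"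
  shows "free_lift S \<delta> (free_gen R S s) = \<delta> s"
proof -
  have "free_lift S \<delta> (free_gen R S s) = (\<Oplus>t\<in>{s}. free_gen R S s t \<otimes> \<delta> t)"
    using s by (intro free_lift_eq[OF \<delta> free_gen_closed]) (auto simp: free_gen_def)
  then show ?thesis using s \<delta> by (simp add: free_gen_def Pi_def)
qed

end

context module
begin

lemma gen_submodule_least: "submodule N R M \<Longrightarrow> S \<subseteq> N \<Longrightarrow> gen_submodule R M S \<subseteq> N"
  unfolding gen_submodule_def by blast

lemma gen_submodule_incl: "S \<subseteq> gen_submodule R M S"
  unfolding gen_submodule_def by blast

lemma gen_submodule_is_submodule:
  assumes "S \<subseteq> carrier M"
  shows "submodule (gen_submodule R M S) R M"
proof (rule submoduleI)
  show "gen_submodule R M S \<subseteq> carrier M"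
    by (rule gen_submodule_least[OF carrier_is_submodule assms])
  have zero: "\<zero>\<^bsub>M\<^esub> \<in> N" if "submodule N R M" for N
    using subgroup.one_closed[OF submodule.axioms(1)[OF that]] by simp
  show "\<zero>\<^bsub>M\<^esub> \<in> gen_submodule R M S" unfolding gen_submodule_def using zero by blast
qed (use submoduleE in \<open>auto simp: gen_submodule_def\<close>)

context
  fixes N assumes N: "submodule N R M"
begin

lemma quotient_subgroup: "abelian_subgroup N M"
  by (rule abelian_subgroupI3[OF additive_subgroupI[OF submodule.axioms(1)[OF N]] M.abelian_group_axioms])

lemma quotient_carrier: "carrier (quot_module M N) = {N +>\<^bsub>M\<^esub> x | x. x \<in> carrier M}"
  by (auto simp: quot_module_def A_RCOSETS_def')

lemma quotient_zero: "\<zero>\<^bsub>quot_module M N\<^esub> = N +>\<^bsub>M\<^esub> \<zero>\<^bsub>M\<^esub>"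
  using submoduleE(1)[OF N] by (simp add: quot_module_def M.a_coset_add_zero)

lemma quotient_add:
  "x \<in> carrier M \<Longrightarrow> y \<in> carrier M \<Longrightarrow>
   (N +>\<^bsub>M\<^esub> x) \<oplus>\<^bsub>quot_module M N\<^esub> (N +>\<^bsub>M\<^esub> y) = N +>\<^bsub>M\<^esub> (x \<oplus>\<^bsub>M\<^esub> y)"
  using abelian_subgroup.a_rcos_sum[OF quotient_subgroup] by (simp add: quot_module_def)

lemma coset_eqI:
  assumes "h \<in> N" "x \<in> carrier M"
  shows "N +>\<^bsub>M\<^esub> (h \<oplus>\<^bsub>M\<^esub> x) = N +>\<^bsub>M\<^esub> x"
  by (rule M.a_repr_independence[symmetric, OF M.a_rcosI[OF assms(1) submoduleE(1)[OF N] assms(2)]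
        assms(2) submodule.axioms(1)[OF N]])

text \<open>The union in the definition of the scalar action runs over equal cosets, since \<open>N\<close> is a submodule.\<close>

lemma quotient_smult:
  assumes a: "a \<in> carrier R" and x: "x \<in> carrier M"
  shows "a \<odot>\<^bsub>quot_module M N\<^esub> (N +>\<^bsub>M\<^esub> x) = N +>\<^bsub>M\<^esub> (a \<odot>\<^bsub>M\<^esub> x)"
proof -
  have "N +>\<^bsub>M\<^esub> (a \<odot>\<^bsub>M\<^esub> y) = N +>\<^bsub>M\<^esub> (a \<odot>\<^bsub>M\<^esub> x)" if y: "y \<in> N +>\<^bsub>M\<^esub> x" for y
  proof -
    obtain h where h: "h \<in> N" "y = h \<oplus>\<^bsub>M\<^esub> x" using y by (auto simp: a_r_coset_def')
    then have "a \<odot>\<^bsub>M\<^esub> y = a \<odot>\<^bsub>M\<^esub> h \<oplus>\<^bsub>M\<^esub> a \<odot>\<^bsub>M\<^esub> x"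
      using a x submoduleE(1)[OF N] by (auto simp: smult_r_distr)
    then show ?thesis using coset_eqI submoduleE(4)[OF N a h(1)] a x by simp
  qed
  moreover have "N +>\<^bsub>M\<^esub> x \<noteq> {}"
    using abelian_subgroup.a_rcos_self[OF quotient_subgroup x] by blast
  ultimately have "(\<Union>y\<in>N +>\<^bsub>M\<^esub> x. N +>\<^bsub>M\<^esub> (a \<odot>\<^bsub>M\<^esub> y)) = N +>\<^bsub>M\<^esub> (a \<odot>\<^bsub>M\<^esub> x)"
    by (intro SUP_eq_const)
  then show ?thesis by (simp add: quot_module_def)
qed

lemma quotient_is_module: "module R (quot_module M N)"
proof (rule moduleI)
  let ?Q = "quot_module M N"
  have closed: "N +>\<^bsub>M\<^esub> x \<in> carrier ?Q" if "x \<in> carrier M" for x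
    using that unfolding quotient_carrier by blast
  have rep: "\<exists>x. x \<in> carrier M \<and> C = N +>\<^bsub>M\<^esub> x" if "C \<in> carrier ?Q" for C
    using that unfolding quotient_carrier by blast
  note ops = quotient_add quotient_smult closed
  show "cring R" by (rule R.is_cring)
  show "abelian_group ?Q"
  proof (rule abelian_groupI)
    show zero: "\<zero>\<^bsub>?Q\<^esub> \<in> carrier ?Q" unfolding quotient_zero by (rule closed) simp
    fix C assume "C \<in> carrier ?Q"
    then obtain x where x: "x \<in> carrier M" "C = N +>\<^bsub>M\<^esub> x" using rep by blast
    show "\<zero>\<^bsub>?Q\<^esub> \<oplus>\<^bsub>?Q\<^esub> C = C"
      unfolding quotient_zero x(2) using quotient_add[OF M.zero_closed x(1)] x(1) by simp
    have "(N +>\<^bsub>M\<^esub> (\<ominus>\<^bsub>M\<^esub> x)) \<oplus>\<^bsub>?Q\<^esub> C = \<zero>\<^bsub>?Q\<^esub>"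
      unfolding quotient_zero x(2) using quotient_add[of "\<ominus>\<^bsub>M\<^esub> x" x] x(1) by (simp add: M.l_neg)
    moreover have "N +>\<^bsub>M\<^esub> (\<ominus>\<^bsub>M\<^esub> x) \<in> carrier ?Q" using x by (simp add: closed)
    ultimately show "\<exists>C'\<in>carrier ?Q. C' \<oplus>\<^bsub>?Q\<^esub> C = \<zero>\<^bsub>?Q\<^esub>" by blast
    fix D assume "D \<in> carrier ?Q"
    then obtain y where y: "y \<in> carrier M" "D = N +>\<^bsub>M\<^esub> y" using rep by blast
    show "C \<oplus>\<^bsub>?Q\<^esub> D \<in> carrier ?Q" using x y by (simp add: ops)
    show "C \<oplus>\<^bsub>?Q\<^esub> D = D \<oplus>\<^bsub>?Q\<^esub> C" using x y by (simp add: ops M.a_comm)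
    fix E assume "E \<in> carrier ?Q"
    then obtain z where z: "z \<in> carrier M" "E = N +>\<^bsub>M\<^esub> z" using rep by blast
    show "C \<oplus>\<^bsub>?Q\<^esub> D \<oplus>\<^bsub>?Q\<^esub> E = C \<oplus>\<^bsub>?Q\<^esub> (D \<oplus>\<^bsub>?Q\<^esub> E)"
      using x y z by (simp add: ops M.a_assoc)
  qed
  fix C assume "C \<in> carrier ?Q"
  then obtain x where x: "x \<in> carrier M" "C = N +>\<^bsub>M\<^esub> x" using rep by blast
  show "\<one>\<^bsub>R\<^esub> \<odot>\<^bsub>?Q\<^esub> C = C" using x by (simp add: ops)
  fix a assume a: "a \<in> carrier R"
  show "a \<odot>\<^bsub>?Q\<^esub> C \<in> carrier ?Q" using a x by (simp add: ops)
  show "a \<odot>\<^bsub>?Q\<^esub> (C \<oplus>\<^bsub>?Q\<^esub> D) = a \<odot>\<^bsub>?Q\<^esub> C \<oplus>\<^bsub>?Q\<^esub> a \<odot>\<^bsub>?Q\<^esub> D" if D: "D \<in> carrier ?Q" for D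
  proof -
    obtain y where "y \<in> carrier M" "D = N +>\<^bsub>M\<^esub> y" using rep[OF D] by blast
    then show ?thesis using a x by (simp add: ops smult_r_distr)
  qed
  fix b assume b: "b \<in> carrier R"
  show "(a \<oplus>\<^bsub>R\<^esub> b) \<odot>\<^bsub>?Q\<^esub> C = a \<odot>\<^bsub>?Q\<^esub> C \<oplus>\<^bsub>?Q\<^esub> b \<odot>\<^bsub>?Q\<^esub> C"
    using a b x by (simp add: ops smult_l_distr)
  show "a \<otimes>\<^bsub>R\<^esub> b \<odot>\<^bsub>?Q\<^esub> C = a \<odot>\<^bsub>?Q\<^esub> (b \<odot>\<^bsub>?Q\<^esub> C)"
    using a b x by (simp add: ops smult_assoc1)
qed

end

end

section \<open>Kaehler differentials\<close>

context module_over_algebra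
begin

lemma functional_kernel_submodule:
  assumes \<phi>: "\<phi> \<in> lin_functionals A E"
  shows "submodule {x \<in> carrier E. \<phi> x = \<zero>\<^bsub>A\<^esub>} A E"
  by (rule E.submoduleI)
    (auto simp: functional_zero[OF \<phi>] functional_minus[OF \<phi>] functional_add[OF \<phi>] functional_smult[OF \<phi>] A.minus_equality)

lemma fixed_points_submodule:
  assumes \<phi>: "linear_endo \<phi>"
  shows "submodule {x \<in> carrier E. \<phi> x = x} A E"
proof -
  have smult: "\<phi> (a \<odot>\<^bsub>E\<^esub> x) = a \<odot>\<^bsub>E\<^esub> \<phi> x" if "a \<in> carrier A" "x \<in> carrier E" for a x
    using \<phi> that unfolding linear_endo_def by blast
  have add: "\<phi> (x \<oplus>\<^bsub>E\<^esub> y) = \<phi> x \<oplus>\<^bsub>E\<^esub> \<phi> y" if "x \<in> carrier E" "y \<in> carrier E" for x y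
    using \<phi> that unfolding linear_endo_def by blast
  have minus_smult: "\<ominus>\<^bsub>E\<^esub> x = (\<ominus>\<^bsub>A\<^esub> \<one>\<^bsub>A\<^esub>) \<odot>\<^bsub>E\<^esub> x" if "x \<in> carrier E" for x
    using that E.smult_l_minus[of "\<one>\<^bsub>A\<^esub>" x] by simp
  have "\<phi> \<zero>\<^bsub>E\<^esub> \<in> carrier E" using \<phi> unfolding linear_endo_def by simp
  then have zero: "\<phi> \<zero>\<^bsub>E\<^esub> = \<zero>\<^bsub>E\<^esub>" using smult[of "\<zero>\<^bsub>A\<^esub>" "\<zero>\<^bsub>E\<^esub>"] by simp
  have minus: "\<phi> (\<ominus>\<^bsub>E\<^esub> x) = \<ominus>\<^bsub>E\<^esub> x" if "x \<in> carrier E" "\<phi> x = x" for x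
    using that by (simp add: minus_smult smult)
  show ?thesis by (rule E.submoduleI) (simp_all add: zero minus smult add subset_iff)
qed

lemma dual_basis_combination_linear:
  fixes n :: nat
  assumes e: "\<And>i. i < n \<Longrightarrow> e i \<in> carrier E" "\<And>i. i < n \<Longrightarrow> \<theta> i \<in> lin_functionals A E"
  shows "linear_endo (\<lambda>x. \<Oplus>\<^bsub>E\<^esub>i\<in>{..<n}. \<theta> i x \<odot>\<^bsub>E\<^esub> e i)"
  unfolding linear_endo_def
proof (intro conjI ballI)
  let ?\<pi> = "\<lambda>x. \<Oplus>\<^bsub>E\<^esub>i\<in>{..<n}. \<theta> i x \<odot>\<^bsub>E\<^esub> e i"
  note [simp] = e
  fix x assume x: "x \<in> carrier E"
  show "?\<pi> x \<in> carrier E" using x by (simp add: Pi_def)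
  show "?\<pi> (x \<oplus>\<^bsub>E\<^esub> y) = ?\<pi> x \<oplus>\<^bsub>E\<^esub> ?\<pi> y" if y: "y \<in> carrier E" for y
  proof -
    have "?\<pi> (x \<oplus>\<^bsub>E\<^esub> y) = (\<Oplus>\<^bsub>E\<^esub>i\<in>{..<n}. \<theta> i x \<odot>\<^bsub>E\<^esub> e i \<oplus>\<^bsub>E\<^esub> \<theta> i y \<odot>\<^bsub>E\<^esub> e i)"
      using x y by (intro E.M.finsum_cong' refl)
        (simp_all add: Pi_def functional_add[OF e(2)] E.smult_l_distr)
    then show ?thesis using x y by (simp add: E.M.finsum_addf Pi_def)
  qed
  show "?\<pi> (a \<odot>\<^bsub>E\<^esub> x) = a \<odot>\<^bsub>E\<^esub> ?\<pi> x" if a: "a \<in> carrier A" for a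
  proof -
    have "?\<pi> (a \<odot>\<^bsub>E\<^esub> x) = (\<Oplus>\<^bsub>E\<^esub>i\<in>{..<n}. a \<odot>\<^bsub>E\<^esub> (\<theta> i x \<odot>\<^bsub>E\<^esub> e i))"
      using x a by (intro E.M.finsum_cong' refl)
        (simp_all add: Pi_def functional_smult[OF e(2)] E.smult_assoc1)
    then show ?thesis using x a by (simp add: E.finsum_smult_ldistr Pi_def)
  qed
qed

end

context comm_algebra
begin

definition kaehler_submodule :: "('a \<Rightarrow> 'a) set" where
  "kaehler_submodule = gen_submodule A (free_module A (carrier A)) (kaehler_relations K A)"

definition kaehler_d :: "'a \<Rightarrow> ('a \<Rightarrow> 'a) set" where
  "kaehler_d a = kaehler_submodule +>\<^bsub>free_module A (carrier A)\<^esub> free_gen A (carrier A) a"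

lemma kaehler_eq: "kaehler K A = quot_module (free_module A (carrier A)) kaehler_submodule"
  by (simp add: kaehler_def kaehler_submodule_def Let_def)

context
  fixes F d
  defines "F \<equiv> free_module A (carrier A)" and "d \<equiv> free_gen A (carrier A)"
begin

interpretation F: module A F
  unfolding F_def by (rule A.free_module_is_module)

lemma d_closed: "a \<in> carrier A \<Longrightarrow> d a \<in> carrier F"
  unfolding F_def d_def by (rule A.free_gen_closed)

lemma relations:
  shows "a \<in> carrier A \<Longrightarrow> b \<in> carrier A \<Longrightarrow>
      d (a \<oplus>\<^bsub>A\<^esub> b) \<ominus>\<^bsub>F\<^esub> (d a \<oplus>\<^bsub>F\<^esub> d b) \<in> kaehler_relations K A"
    and "c \<in> carrier K \<Longrightarrow> a \<in> carrier A \<Longrightarrow>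
      d (c \<odot>\<^bsub>A\<^esub> a) \<ominus>\<^bsub>F\<^esub> (c \<odot>\<^bsub>A\<^esub> \<one>\<^bsub>A\<^esub>) \<odot>\<^bsub>F\<^esub> d a \<in> kaehler_relations K A"
    and "a \<in> carrier A \<Longrightarrow> b \<in> carrier A \<Longrightarrow>
      d (a \<otimes>\<^bsub>A\<^esub> b) \<ominus>\<^bsub>F\<^esub> (a \<odot>\<^bsub>F\<^esub> d b \<oplus>\<^bsub>F\<^esub> b \<odot>\<^bsub>F\<^esub> d a) \<in> kaehler_relations K A"
  unfolding kaehler_relations_def Let_def F_def d_def by blast+

lemma relations_cases:
  assumes "r \<in> kaehler_relations K A"
  obtains (add) a b where "a \<in> carrier A" "b \<in> carrier A"
      "r = d (a \<oplus>\<^bsub>A\<^esub> b) \<ominus>\<^bsub>F\<^esub> (d a \<oplus>\<^bsub>F\<^esub> d b)"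
    | (scalar) c a where "c \<in> carrier K" "a \<in> carrier A"
      "r = d (c \<odot>\<^bsub>A\<^esub> a) \<ominus>\<^bsub>F\<^esub> (c \<odot>\<^bsub>A\<^esub> \<one>\<^bsub>A\<^esub>) \<odot>\<^bsub>F\<^esub> d a"
    | (mult) a b where "a \<in> carrier A" "b \<in> carrier A"
      "r = d (a \<otimes>\<^bsub>A\<^esub> b) \<ominus>\<^bsub>F\<^esub> (a \<odot>\<^bsub>F\<^esub> d b \<oplus>\<^bsub>F\<^esub> b \<odot>\<^bsub>F\<^esub> d a)"
  using assms unfolding kaehler_relations_def Let_def F_def[symmetric] d_def[symmetric] by blast

lemma relations_subset: "kaehler_relations K A \<subseteq> carrier F"
proof
  fix r assume "r \<in> kaehler_relations K A"
  then show "r \<in> carrier F" by (cases rule: relations_cases) (simp_all add: d_closed)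
qed

lemma kaehler_submodule: "submodule kaehler_submodule A F"
  unfolding kaehler_submodule_def F_def[symmetric]
  by (rule F.gen_submodule_is_submodule[OF relations_subset])

lemma kaehler_is_module: "module A (kaehler K A)"
  unfolding kaehler_eq F_def[symmetric] by (rule F.quotient_is_module[OF kaehler_submodule])

lemma kaehler_ops:
  shows "carrier (kaehler K A) = {kaehler_submodule +>\<^bsub>F\<^esub> f | f. f \<in> carrier F}"
    and "\<And>f h. f \<in> carrier F \<Longrightarrow> h \<in> carrier F \<Longrightarrow>
      (kaehler_submodule +>\<^bsub>F\<^esub> f) \<oplus>\<^bsub>kaehler K A\<^esub> (kaehler_submodule +>\<^bsub>F\<^esub> h) =
      kaehler_submodule +>\<^bsub>F\<^esub> (f \<oplus>\<^bsub>F\<^esub> h)"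
    and "\<And>a f. a \<in> carrier A \<Longrightarrow> f \<in> carrier F \<Longrightarrow>
      a \<odot>\<^bsub>kaehler K A\<^esub> (kaehler_submodule +>\<^bsub>F\<^esub> f) = kaehler_submodule +>\<^bsub>F\<^esub> (a \<odot>\<^bsub>F\<^esub> f)"
    and "\<zero>\<^bsub>kaehler K A\<^esub> = kaehler_submodule +>\<^bsub>F\<^esub> \<zero>\<^bsub>F\<^esub>"
    and "\<And>a. kaehler_d a = kaehler_submodule +>\<^bsub>F\<^esub> d a"
  unfolding kaehler_eq F_def[symmetric] kaehler_d_def d_def[symmetric]
  using F.quotient_carrier[OF kaehler_submodule] F.quotient_add[OF kaehler_submodule]
    F.quotient_smult[OF kaehler_submodule] F.quotient_zero[OF kaehler_submodule]
  by simp_all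

text \<open>Each relation is a difference, and the two sides of it become equal in the quotient.\<close>

lemma relation_coset:
  assumes "f \<ominus>\<^bsub>F\<^esub> h \<in> kaehler_relations K A" "f \<in> carrier F" "h \<in> carrier F"
  shows "kaehler_submodule +>\<^bsub>F\<^esub> f = kaehler_submodule +>\<^bsub>F\<^esub> h"
proof -
  have "f \<ominus>\<^bsub>F\<^esub> h \<in> kaehler_submodule"
    using assms(1) F.gen_submodule_incl unfolding kaehler_submodule_def F_def by blast
  then have "kaehler_submodule +>\<^bsub>F\<^esub> ((f \<ominus>\<^bsub>F\<^esub> h) \<oplus>\<^bsub>F\<^esub> h) = kaehler_submodule +>\<^bsub>F\<^esub> h"
    using F.coset_eqI[OF kaehler_submodule] assms(3) by blast
  moreover have "(f \<ominus>\<^bsub>F\<^esub> h) \<oplus>\<^bsub>F\<^esub> h = f"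
    using assms(2,3) by (simp add: F.M.minus_eq F.M.a_assoc F.M.l_neg)
  ultimately show ?thesis by simp
qed

lemma kaehler_d_closed: "a \<in> carrier A \<Longrightarrow> kaehler_d a \<in> carrier (kaehler K A)"
  unfolding kaehler_ops using d_closed by blast

lemma kaehler_d_add:
  assumes "a \<in> carrier A" "b \<in> carrier A"
  shows "kaehler_d (a \<oplus>\<^bsub>A\<^esub> b) = kaehler_d a \<oplus>\<^bsub>kaehler K A\<^esub> kaehler_d b"
  using relation_coset[OF relations(1)[OF assms]] assms d_closed by (simp add: kaehler_ops(2,5))

lemma kaehler_d_mult:
  assumes "a \<in> carrier A" "b \<in> carrier A"
  shows "kaehler_d (a \<otimes>\<^bsub>A\<^esub> b) =
    a \<odot>\<^bsub>kaehler K A\<^esub> kaehler_d b \<oplus>\<^bsub>kaehler K A\<^esub> b \<odot>\<^bsub>kaehler K A\<^esub> kaehler_d a"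
  using relation_coset[OF relations(3)[OF assms]] assms d_closed by (simp add: kaehler_ops(2,3,5))

lemma kaehler_d_scalar:
  assumes "c \<in> carrier K" "a \<in> carrier A"
  shows "kaehler_d (c \<odot>\<^bsub>A\<^esub> a) = (c \<odot>\<^bsub>A\<^esub> \<one>\<^bsub>A\<^esub>) \<odot>\<^bsub>kaehler K A\<^esub> kaehler_d a"
  using relation_coset[OF relations(2)[OF assms]] assms d_closed by (simp add: kaehler_ops(3,5))

text \<open>The preimage of \<open>N\<close> in the free module is a submodule that contains all the symbols.\<close>

lemma kaehler_generated:
  assumes N: "submodule N A (kaehler K A)"
    and gens: "\<And>a. a \<in> carrier A \<Longrightarrow> kaehler_d a \<in> N"
    and x: "x \<in> carrier (kaehler K A)"
  shows "x \<in> N"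
proof -
  interpret \<Omega>: module A "kaehler K A" by (rule kaehler_is_module)
  note sub = \<Omega>.submoduleE[OF N]
  let ?P = "{f \<in> carrier F. kaehler_submodule +>\<^bsub>F\<^esub> f \<in> N}"
  have P: "submodule ?P A F"
  proof (rule F.submoduleI)
    have zero: "\<zero>\<^bsub>kaehler K A\<^esub> \<in> N"
      using subgroup.one_closed[OF submodule.axioms(1)[OF N]] by simp
    then show "\<zero>\<^bsub>F\<^esub> \<in> ?P" by (simp add: kaehler_ops(4))
    show add: "f \<oplus>\<^bsub>F\<^esub> h \<in> ?P" if "f \<in> ?P" "h \<in> ?P" for f h
      using that by (simp add: sub(5) kaehler_ops(2)[symmetric])
    show smult: "a \<odot>\<^bsub>F\<^esub> f \<in> ?P" if "a \<in> carrier A" "f \<in> ?P" for a f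
      using that by (simp add: sub(4) kaehler_ops(3)[symmetric])
    show "\<ominus>\<^bsub>F\<^esub> f \<in> ?P" if "f \<in> ?P" for f
    proof -
      have "\<ominus>\<^bsub>F\<^esub> f = (\<ominus>\<^bsub>A\<^esub> \<one>\<^bsub>A\<^esub>) \<odot>\<^bsub>F\<^esub> f"
        using that F.smult_l_minus[of "\<one>\<^bsub>A\<^esub>" f] by simp
      then show ?thesis using smult[OF _ that] by simp
    qed
  qed auto
  obtain f where f: "f \<in> carrier F" "x = kaehler_submodule +>\<^bsub>F\<^esub> f"
    using x unfolding kaehler_ops(1) by blast
  have "f \<in> ?P"
    using A.free_module_generated[OF P[unfolded F_def], of f] gens d_closed f(1)
    unfolding F_def d_def by (simp add: kaehler_d_def)
  then show ?thesis using f(2) by simp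
qed

text \<open>Existence in the universal property: the linear extension of \<open>D\<close> to the free module vanishes on the
  relations because \<open>D\<close> is a derivation, hence is constant on cosets.\<close>

lemma kaehler_universal:
  assumes D: "D \<in> derivations K A"
  obtains \<phi> where "\<phi> \<in> lin_functionals A (kaehler K A)"
    and "\<And>a. a \<in> carrier A \<Longrightarrow> \<phi> (kaehler_d a) = D a"
proof -
  interpret FA: module_over_algebra K A F by unfold_locales
  note [simp] = der_closed[OF D]
  define l where "l = A.free_lift (carrier A) D"
  have l: "l \<in> lin_functionals A F"
    unfolding l_def F_def by (rule A.free_lift_functional) auto
  have l_d: "l (d a) = D a" if "a \<in> carrier A" for a
    unfolding l_def d_def by (rule A.free_lift_gen) (use that in auto)
  have "r \<in> {f \<in> carrier F. l f = \<zero>\<^bsub>A\<^esub>}" if r: "r \<in> kaehler_relations K A" for r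
  proof -
    have "l r = \<zero>\<^bsub>A\<^esub>" using r
    proof (cases rule: relations_cases)
      case (add a b)
      then show ?thesis
        by (simp add: d_closed FA.functional_diff[OF l] FA.functional_add[OF l] l_d
            der_add[OF D] A.minus_eq A.r_neg)
    next
      case (scalar c a)
      then show ?thesis
        using scalar_eq_mult[of c a] der_mult[OF D, of "c \<odot>\<^bsub>A\<^esub> \<one>\<^bsub>A\<^esub>" a] D
        by (simp add: d_closed FA.functional_diff[OF l] FA.functional_smult[OF l] l_d A.minus_eq A.r_neg)
    next
      case (mult a b)
      then show ?thesis
        by (simp add: d_closed FA.functional_diff[OF l] FA.functional_add[OF l]
            FA.functional_smult[OF l] l_d der_mult[OF D] A.minus_eq A.r_neg)
    qed
    then show ?thesis using r relations_subset by blast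
  qed
  then have l_N: "l h = \<zero>\<^bsub>A\<^esub>" "h \<in> carrier F" if "h \<in> kaehler_submodule" for h
    using that F.gen_submodule_least[OF FA.functional_kernel_submodule[OF l]]
    unfolding kaehler_submodule_def F_def[symmetric] by blast+
  define \<phi> where "\<phi> = (\<lambda>C\<in>carrier (kaehler K A). l (SOME f. f \<in> C))"
  have \<phi>: "\<phi> (kaehler_submodule +>\<^bsub>F\<^esub> f) = l f" if f: "f \<in> carrier F" for f
  proof -
    have "l h = l f" if h: "h \<in> kaehler_submodule +>\<^bsub>F\<^esub> f" for h
    proof -
      obtain k where k: "k \<in> kaehler_submodule" "h = k \<oplus>\<^bsub>F\<^esub> f"
        using h by (auto simp: a_r_coset_def')
      show ?thesis
        using l_N[OF k(1)] f FA.functional_closed[OF l] by (simp add: k(2) FA.functional_add[OF l])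
    qed
    moreover have "f \<in> kaehler_submodule +>\<^bsub>F\<^esub> f"
      by (rule abelian_subgroup.a_rcos_self[OF F.quotient_subgroup[OF kaehler_submodule] f])
    ultimately have "l (SOME h. h \<in> kaehler_submodule +>\<^bsub>F\<^esub> f) = l f" by (metis someI)
    then show ?thesis using f unfolding \<phi>_def kaehler_ops(1) by auto
  qed
  have "\<phi> \<in> lin_functionals A (kaehler K A)"
    unfolding lin_functionals_def
  proof (intro CollectI conjI ballI)
    have rep: "\<exists>f. f \<in> carrier F \<and> x = kaehler_submodule +>\<^bsub>F\<^esub> f"
      if "x \<in> carrier (kaehler K A)" for x
      using that unfolding kaehler_ops(1) by blast
    show "\<phi> \<in> carrier (kaehler K A) \<rightarrow>\<^sub>E carrier A"
    proof
      fix x assume "x \<in> carrier (kaehler K A)"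
      then obtain f where "f \<in> carrier F" "x = kaehler_submodule +>\<^bsub>F\<^esub> f" using rep by blast
      then show "\<phi> x \<in> carrier A" using FA.functional_closed[OF l] by (simp add: \<phi>)
    qed (simp add: \<phi>_def)
    fix x assume "x \<in> carrier (kaehler K A)"
    then obtain f where f: "f \<in> carrier F" "x = kaehler_submodule +>\<^bsub>F\<^esub> f" using rep by blast
    show "\<phi> (a \<odot>\<^bsub>kaehler K A\<^esub> x) = a \<otimes>\<^bsub>A\<^esub> \<phi> x" if "a \<in> carrier A" for a
      using f that by (simp add: kaehler_ops(3) \<phi> FA.functional_smult[OF l])
    fix y assume "y \<in> carrier (kaehler K A)"
    then obtain h where h: "h \<in> carrier F" "y = kaehler_submodule +>\<^bsub>F\<^esub> h" using rep by blast
    show "\<phi> (x \<oplus>\<^bsub>kaehler K A\<^esub> y) = \<phi> x \<oplus>\<^bsub>A\<^esub> \<phi> y"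
      using f h by (simp add: kaehler_ops(2) \<phi> FA.functional_add[OF l])
  qed
  moreover have "\<phi> (kaehler_d a) = D a" if "a \<in> carrier A" for a
    using that by (simp add: kaehler_ops(5) \<phi> d_closed l_d)
  ultimately show ?thesis using that by blast
qed

end

interpretation \<Omega>: module_over_algebra K A "kaehler K A"
  by (intro module_over_algebra.intro comm_algebra_axioms kaehler_is_module)

lemma kaehler_d_scalar_one:
  assumes "c \<in> carrier K" shows "kaehler_d (c \<odot>\<^bsub>A\<^esub> \<one>\<^bsub>A\<^esub>) = \<zero>\<^bsub>kaehler K A\<^esub>"
proof -
  have d1: "kaehler_d \<one>\<^bsub>A\<^esub> \<in> carrier (kaehler K A)" by (simp add: kaehler_d_closed)
  then have "kaehler_d \<one>\<^bsub>A\<^esub> = \<zero>\<^bsub>kaehler K A\<^esub>"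
    using kaehler_d_mult[of "\<one>\<^bsub>A\<^esub>" "\<one>\<^bsub>A\<^esub>"] by (simp add: \<Omega>.E.M.add.l_cancel_one')
  then show ?thesis using kaehler_d_scalar[OF assms A.one_closed] assms by simp
qed

text \<open>The functionals that belong to the \<open>D\<^sub>i\<close> have the coordinates required of a module with the one unimodular relation
  \<open>\<Sum>\<^sub>i g\<^sub>i dx\<^sub>i = 0\<close>. It remains to see that they form a dual basis with the \<open>dx\<^sub>i\<close>, that is, that
  \<open>\<pi> v = \<Sum>\<^sub>i \<theta>\<^sub>i(v) dx\<^sub>i\<close> is the identity. By the relation \<open>\<pi>\<close> fixes each \<open>dx\<^sub>j\<close>; the fixed points form
  a submodule, so the elements \<open>a\<close> whose differential is fixed form a subalgebra, and that is all of \<open>A\<close>.\<close>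

theorem chern1_kaehler_trivial:
  fixes n :: nat
  assumes x: "\<And>i. i < n \<Longrightarrow> x i \<in> carrier A"
    and g: "\<And>i. i < n \<Longrightarrow> g i \<in> carrier A" and u: "\<And>i. i < n \<Longrightarrow> u i \<in> carrier A"
    and generated: "\<And>S. S \<subseteq> carrier A \<Longrightarrow> (\<And>c. c \<in> carrier K \<Longrightarrow> c \<odot>\<^bsub>A\<^esub> \<one>\<^bsub>A\<^esub> \<in> S) \<Longrightarrow>
      (\<And>i. i < n \<Longrightarrow> x i \<in> S) \<Longrightarrow> (\<And>a b. a \<in> S \<Longrightarrow> b \<in> S \<Longrightarrow> a \<oplus>\<^bsub>A\<^esub> b \<in> S) \<Longrightarrow>
      (\<And>a b. a \<in> S \<Longrightarrow> b \<in> S \<Longrightarrow> a \<otimes>\<^bsub>A\<^esub> b \<in> S) \<Longrightarrow> carrier A \<subseteq> S"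
    and D: "\<And>i. i < n \<Longrightarrow> D i \<in> derivations K A"
    and D_x: "\<And>i j. i < n \<Longrightarrow> j < n \<Longrightarrow>
      D i (x j) = (if i = j then \<one>\<^bsub>A\<^esub> else \<zero>\<^bsub>A\<^esub>) \<ominus>\<^bsub>A\<^esub> g i \<otimes>\<^bsub>A\<^esub> u j"
    and unimodular: "(\<Oplus>\<^bsub>A\<^esub>i\<in>{..<n}. g i \<otimes>\<^bsub>A\<^esub> u i) = \<one>\<^bsub>A\<^esub>"
    and relation: "(\<Oplus>\<^bsub>kaehler K A\<^esub>i\<in>{..<n}. g i \<odot>\<^bsub>kaehler K A\<^esub> kaehler_d (x i)) = \<zero>\<^bsub>kaehler K A\<^esub>"
  shows "chern1 K A (kaehler K A) = \<one>\<^bsub>lr_cohomology K A 2\<^esub>"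
proof -
  let ?\<Omega> = "kaehler K A"
  let ?e = "\<lambda>i. kaehler_d (x i)"
  have e [simp]: "?e i \<in> carrier ?\<Omega>" if "i < n" for i using x that by (simp add: kaehler_d_closed)
  have "\<exists>\<phi>. \<phi> \<in> lin_functionals A ?\<Omega> \<and> (\<forall>a\<in>carrier A. \<phi> (kaehler_d a) = D i a)" if "i < n" for i
    using kaehler_universal[OF D[OF that]] by metis
  then obtain \<theta> where \<theta> [simp]: "\<And>i. i < n \<Longrightarrow> \<theta> i \<in> lin_functionals A ?\<Omega>"
    and \<theta>_d: "\<And>i a. i < n \<Longrightarrow> a \<in> carrier A \<Longrightarrow> \<theta> i (kaehler_d a) = D i a"
    by metis
  define \<pi> where "\<pi> = (\<lambda>v. \<Oplus>\<^bsub>?\<Omega>\<^esub>i\<in>{..<n}. \<theta> i v \<odot>\<^bsub>?\<Omega>\<^esub> ?e i)"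
  have \<pi>_linear: "\<Omega>.linear_endo \<pi>"
    unfolding \<pi>_def by (rule \<Omega>.dual_basis_combination_linear) simp_all
  have \<pi>_x: "\<pi> (?e j) = ?e j" if j: "j < n" for j
  proof -
    have uj: "u j \<in> carrier A" using u j .
    have "\<pi> (?e j) = (\<Oplus>\<^bsub>?\<Omega>\<^esub>i\<in>{..<n}. (if j = i then ?e i else \<zero>\<^bsub>?\<Omega>\<^esub>) \<ominus>\<^bsub>?\<Omega>\<^esub> u j \<odot>\<^bsub>?\<Omega>\<^esub> (g i \<odot>\<^bsub>?\<Omega>\<^esub> ?e i))"
      unfolding \<pi>_def using j x g uj
      by (intro \<Omega>.E.M.finsum_cong' refl)
        (auto simp: Pi_def \<theta>_d D_x A.minus_eq \<Omega>.E.M.minus_eq \<Omega>.E.smult_l_distr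
          \<Omega>.E.smult_l_minus \<Omega>.E.smult_assoc1[symmetric] A.m_comm)
    also have "\<dots> = (\<Oplus>\<^bsub>?\<Omega>\<^esub>i\<in>{..<n}. if j = i then ?e i else \<zero>\<^bsub>?\<Omega>\<^esub>) \<ominus>\<^bsub>?\<Omega>\<^esub>
        (\<Oplus>\<^bsub>?\<Omega>\<^esub>i\<in>{..<n}. u j \<odot>\<^bsub>?\<Omega>\<^esub> (g i \<odot>\<^bsub>?\<Omega>\<^esub> ?e i))"
      using g uj by (intro \<Omega>.E.M.finsum_diff) (auto simp: Pi_def)
    also have "(\<Oplus>\<^bsub>?\<Omega>\<^esub>i\<in>{..<n}. if j = i then ?e i else \<zero>\<^bsub>?\<Omega>\<^esub>) = ?e j"
      using j by (intro \<Omega>.E.M.finsum_singleton) (auto simp: Pi_def)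
    also have "(\<Oplus>\<^bsub>?\<Omega>\<^esub>i\<in>{..<n}. u j \<odot>\<^bsub>?\<Omega>\<^esub> (g i \<odot>\<^bsub>?\<Omega>\<^esub> ?e i)) = u j \<odot>\<^bsub>?\<Omega>\<^esub> \<zero>\<^bsub>?\<Omega>\<^esub>"
      using g uj unfolding relation[symmetric]
      by (intro \<Omega>.E.finsum_smult_ldistr[symmetric]) (auto simp: Pi_def)
    finally show ?thesis using j uj by (simp add: \<Omega>.E.M.minus_eq \<Omega>.E.M.minus_equality)
  qed
  let ?Fix = "{v \<in> carrier ?\<Omega>. \<pi> v = v}"
  have Fix: "submodule ?Fix A ?\<Omega>" by (rule \<Omega>.fixed_points_submodule[OF \<pi>_linear])
  note sub = \<Omega>.E.submoduleE[OF Fix]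
  have "carrier A \<subseteq> {a \<in> carrier A. kaehler_d a \<in> ?Fix}"
  proof (rule generated)
    show "c \<odot>\<^bsub>A\<^esub> \<one>\<^bsub>A\<^esub> \<in> {a \<in> carrier A. kaehler_d a \<in> ?Fix}" if c: "c \<in> carrier K" for c
      using subgroup.one_closed[OF submodule.axioms(1)[OF Fix]] c
      by (simp add: kaehler_d_scalar_one)
    show "x i \<in> {a \<in> carrier A. kaehler_d a \<in> ?Fix}" if "i < n" for i
      using that x \<pi>_x by simp
    fix a b assume a: "a \<in> {a \<in> carrier A. kaehler_d a \<in> ?Fix}"
      and b: "b \<in> {a \<in> carrier A. kaehler_d a \<in> ?Fix}"
    show "a \<oplus>\<^bsub>A\<^esub> b \<in> {a \<in> carrier A. kaehler_d a \<in> ?Fix}"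
      using a b sub(5)[of "kaehler_d a" "kaehler_d b"] by (simp add: kaehler_d_add)
    show "a \<otimes>\<^bsub>A\<^esub> b \<in> {a \<in> carrier A. kaehler_d a \<in> ?Fix}"
      using a b sub(5)[OF sub(4)[of a "kaehler_d b"] sub(4)[of b "kaehler_d a"]]
      by (simp add: kaehler_d_mult)
  qed blast
  then have "v \<in> ?Fix" if "v \<in> carrier ?\<Omega>" for v
    using kaehler_generated[OF Fix _ that] by blast
  then have "dual_basis A ?\<Omega> n ?e \<theta>"
    unfolding dual_basis_def \<pi>_def by auto
  then interpret unimodular_quotient K A ?\<Omega> n ?e \<theta> g u
    by unfold_locales (simp_all add: g u x \<theta>_d D_x unimodular)
  show ?thesis by (rule chern1_trivial)
qed

end

section \<open>Derivations of polynomial rings\<close>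

text \<open>The counterpart of \<^const>\<open>derivations\<close> for a ring given as a type, without a field of scalars: which constants are killed
  depends on the level of the iterated polynomial ring.\<close>

definition type_derivation :: "('b::comm_ring_1 \<Rightarrow> 'b) \<Rightarrow> bool" where
  "type_derivation \<delta> \<longleftrightarrow>
     (\<forall>a b. \<delta> (a + b) = \<delta> a + \<delta> b) \<and> (\<forall>a b. \<delta> (a * b) = a * \<delta> b + b * \<delta> a)"

lemma type_derivation_zero [simp]: "type_derivation \<delta> \<Longrightarrow> \<delta> 0 = 0"
  unfolding type_derivation_def by (metis add_cancel_right_right)

lemma type_derivation_one: 
  assumes "type_derivation \<delta>" shows "\<delta> 1 = 0"
proof -
  have "\<delta> (1 * 1) = 1 * \<delta> 1 + 1 * \<delta> 1" using assms unfolding type_derivation_def by blast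
  then show ?thesis by simp
qed

lemma type_derivation_diff: "type_derivation \<delta> \<Longrightarrow> \<delta> (a - b) = \<delta> a - \<delta> b"
  unfolding type_derivation_def by (metis add_diff_cancel_right' diff_add_cancel)

lemma type_derivation_sum:
  assumes "type_derivation \<delta>" "finite I" shows "\<delta> (\<Sum>i\<in>I. f i) = (\<Sum>i\<in>I. \<delta> (f i))"
  using assms(2)
proof (induction I)
  case (insert i I)
  then show ?case using assms(1) by (simp add: type_derivation_def)
qed (use assms(1) in simp)

lemma type_derivation_power:
  assumes "type_derivation \<delta>"
  shows "\<delta> (a ^ n) = of_nat n * a ^ (n - 1) * \<delta> a"
proof (induction n)
  case (Suc n)
  have "\<delta> (a ^ Suc n) = a * \<delta> (a ^ n) + a ^ n * \<delta> a"
    using assms unfolding type_derivation_def by simp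
  then show ?case unfolding Suc.IH by (cases n) (simp_all add: algebra_simps)
qed (use type_derivation_one[OF assms] in simp)

lemma type_derivation_pderiv:
  "type_derivation (pderiv :: 'b::idom poly \<Rightarrow> 'b poly)"
  unfolding type_derivation_def by (simp add: pderiv_add pderiv_mult)

text \<open>A derivation of the coefficients extends coefficientwise. In an iterated polynomial ring this turns the
  derivative of an inner ring into a partial derivative of the whole ring.\<close>

lemma type_derivation_map_poly:
  assumes \<delta>: "type_derivation \<delta>"
  shows "type_derivation (map_poly \<delta>)"
  unfolding type_derivation_def
proof (intro conjI allI)
  have add: "\<delta> (a + b) = \<delta> a + \<delta> b" and mult: "\<delta> (a * b) = a * \<delta> b + \<delta> a * b" for a b
    using \<delta> unfolding type_derivation_def by (metis, metis mult.commute)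
  fix a b
  show "map_poly \<delta> (a + b) = map_poly \<delta> a + map_poly \<delta> b"
    by (rule poly_eqI) (simp add: coeff_map_poly \<delta> add)
  have "coeff (map_poly \<delta> (a * b)) n = coeff (a * map_poly \<delta> b + map_poly \<delta> a * b) n" for n
    by (simp add: coeff_map_poly \<delta> coeff_mult type_derivation_sum[OF \<delta>] mult sum.distrib)
  then show "map_poly \<delta> (a * b) = a * map_poly \<delta> b + b * map_poly \<delta> a"
    by (metis poly_eqI mult.commute)
qed

lemma type_derivation_lincomb:
  assumes "type_derivation \<delta>" "type_derivation \<epsilon>"
  shows "type_derivation (\<lambda>h. a * \<delta> h + b * \<epsilon> h)"
  using assms unfolding type_derivation_def by (simp add: algebra_simps)

text \<open>The three variables, indexed so that sums over them can be formed; only the indices below \<open>3\<close> are meaningful.\<close>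

definition xyz :: "nat \<Rightarrow> 'k::field_char_0 poly poly poly" where
  "xyz i = [[:[:[:0, 1:]:]:], [:[:0, 1:]:], [:0, 1:]] ! i"

lemma lessThan_3: "{..<3::nat} = {0, 1, 2}" by auto

text \<open>Over the constants, the derivations of a polynomial ring are the combinations of the partial derivatives, and the
  coefficients are the values on the variables.\<close>

lemma derivation_prescribed:
  fixes a :: "nat \<Rightarrow> 'k::field_char_0 poly poly poly"
  obtains \<delta> where "type_derivation \<delta>" "\<And>c. \<delta> [:[:[:c:]:]:] = 0" "\<And>j. j < 3 \<Longrightarrow> \<delta> (xyz j) = a j"
proof -
  let ?dx = "map_poly (map_poly pderiv) :: 'k poly poly poly \<Rightarrow> _"
    and ?dy = "map_poly pderiv :: 'k poly poly poly \<Rightarrow> _" and ?dz = "pderiv :: 'k poly poly poly \<Rightarrow> _"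
  \<comment> \<open>The factor \<open>1\<close> brings the sum into the form of two nested binary combinations.\<close>
  define \<delta> where "\<delta> = (\<lambda>h. 1 * (a 0 * ?dx h + a 1 * ?dy h) + a 2 * ?dz h)"
  have "type_derivation \<delta>"
    unfolding \<delta>_def
    by (intro type_derivation_lincomb type_derivation_map_poly type_derivation_pderiv)
  moreover have "\<delta> [:[:[:c:]:]:] = 0" for c
    by (simp add: \<delta>_def map_poly_pCons pderiv_pCons)
  moreover have "\<delta> (xyz j) = a j" if "j < 3" for j
  proof -
    have "j \<in> {0, 1, 2}" using that lessThan_3 by blast
    then show ?thesis
      by (auto simp: \<delta>_def xyz_def map_poly_pCons pderiv_pCons one_pCons numeral_2_eq_2)
        (simp_all add: one_pCons[symmetric])
  qed
  ultimately show ?thesis using that by blast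
qed

lemma polynomials_generated:
  fixes S :: "'k::field_char_0 poly poly poly set"
  assumes const: "\<And>c. [:[:[:c:]:]:] \<in> S" and gen: "\<And>j. j < 3 \<Longrightarrow> xyz j \<in> S"
    and add: "\<And>a b. a \<in> S \<Longrightarrow> b \<in> S \<Longrightarrow> a + b \<in> S" and mult: "\<And>a b. a \<in> S \<Longrightarrow> b \<in> S \<Longrightarrow> a * b \<in> S"
  shows "h \<in> S"
proof -
  have x: "[:[:[:0, 1:]:]:] \<in> S" and y: "[:[:0, 1:]:] \<in> S" and z: "[:0, 1:] \<in> S"
    using gen[of 0] gen[of 1] gen[of 2] by (simp_all add: xyz_def numeral_2_eq_2)
  have 1: "[:[:a:]:] \<in> S" for a
  proof (induction a)
    case (pCons c a)
    have "[:[:pCons c a:]:] = [:[:[:c:]:]:] + [:[:[:0, 1:]:]:] * [:[:a:]:]" by simp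
    then show ?case using add[OF const mult[OF x pCons.IH]] by metis
  qed (use const[of 0] in simp)
  have 2: "[:a:] \<in> S" for a
  proof (induction a)
    case (pCons c a)
    have "[:pCons c a:] = [:[:c:]:] + [:[:0, 1:]:] * [:a:]" by simp
    then show ?case using add[OF 1 mult[OF y pCons.IH]] by metis
  qed (use const[of 0] in simp)
  show ?thesis
  proof (induction h)
    case (pCons c a)
    have "pCons c a = [:c:] + [:0, 1:] * a" by simp
    then show ?case using add[OF 2 mult[OF z pCons.IH]] by metis
  qed (use const[of 0] in simp)
qed

section \<open>Coordinate rings of affine surfaces\<close>

text \<open>The construction of \<^const>\<open>surface_algebra\<close> with the equation as a parameter, since the ring operations and the
  derivations depend on it only through divisibility by \<open>f\<close>.\<close>

definition hypersurface_algebra ::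
  "'k::field_char_0 poly poly poly \<Rightarrow> ('k, 'k poly poly poly set) module" where
  "hypersurface_algebra f =
     (let P = ring_of_type_algebra; I = PIdl\<^bsub>P\<^esub> f; Q = P Quot I in
       \<lparr>carrier = carrier Q, monoid.mult = monoid.mult Q, monoid.one = \<one>\<^bsub>Q\<^esub>,
        ring.zero = \<zero>\<^bsub>Q\<^esub>, ring.add = ring.add Q,
        module.smult = (\<lambda>c C. (I +>\<^bsub>P\<^esub> [:[:[:c:]:]:]) \<otimes>\<^bsub>Q\<^esub> C)\<rparr>)"

lemma surface_algebra_eq: "surface_algebra p q r = hypersurface_algebra (surface_poly p q r)"
  by (simp add: surface_algebra_def hypersurface_algebra_def)

locale affine_hypersurface =
  fixes f :: "'k::field_char_0 poly poly poly"
begin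

definition A :: "('k, 'k poly poly poly set) module" where "A = hypersurface_algebra f"
definition K :: "'k ring" where "K = ring_of_type_algebra"
definition P :: "'k poly poly poly ring" where "P = ring_of_type_algebra"
definition cl :: "'k poly poly poly \<Rightarrow> 'k poly poly poly set" where
  "cl h = PIdl\<^bsub>P\<^esub> f +>\<^bsub>P\<^esub> h"

lemma P_simps [simp]:
  "carrier P = UNIV" "a \<oplus>\<^bsub>P\<^esub> b = a + b" "a \<otimes>\<^bsub>P\<^esub> b = a * b" "\<one>\<^bsub>P\<^esub> = 1" "\<zero>\<^bsub>P\<^esub> = 0"
  by (simp_all add: P_def ring_of_type_algebra_def)

lemma K_simps [simp]:
  "carrier K = UNIV" "c \<oplus>\<^bsub>K\<^esub> d = c + d" "c \<otimes>\<^bsub>K\<^esub> d = c * d" "\<one>\<^bsub>K\<^esub> = 1" "\<zero>\<^bsub>K\<^esub> = 0"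
  by (simp_all add: K_def ring_of_type_algebra_def)

lemma P_cring: "cring P" unfolding P_def by (rule cring_from_type_algebra)
lemma K_cring: "cring K" unfolding K_def by (rule cring_from_type_algebra)

lemma ideal: "ideal (PIdl\<^bsub>P\<^esub> f) P"
  by (rule cring.cgenideal_ideal[OF P_cring]) simp

lemma A_simps:
  shows "carrier A = range cl"
    and "cl a \<oplus>\<^bsub>A\<^esub> cl b = cl (a + b)" "cl a \<otimes>\<^bsub>A\<^esub> cl b = cl (a * b)"
    and "\<one>\<^bsub>A\<^esub> = cl 1" "\<zero>\<^bsub>A\<^esub> = cl 0" "c \<odot>\<^bsub>A\<^esub> cl a = cl ([:[:[:c:]:]:] * a)"
proof -
  interpret I: ideal "PIdl\<^bsub>P\<^esub> f" P by (rule ideal)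
  have mult: "monoid.mult (P Quot PIdl\<^bsub>P\<^esub> f) (cl a) (cl b) = cl (a * b)" for a b
    using I.rcoset_mult_add[of a b] by (simp add: cl_def FactRing_def)
  have A: "A = \<lparr>carrier = carrier (P Quot PIdl\<^bsub>P\<^esub> f), monoid.mult = monoid.mult (P Quot PIdl\<^bsub>P\<^esub> f),
      monoid.one = \<one>\<^bsub>P Quot PIdl\<^bsub>P\<^esub> f\<^esub>, ring.zero = \<zero>\<^bsub>P Quot PIdl\<^bsub>P\<^esub> f\<^esub>, ring.add = ring.add (P Quot PIdl\<^bsub>P\<^esub> f),
      module.smult = (\<lambda>c C. cl [:[:[:c:]:]:] \<otimes>\<^bsub>P Quot PIdl\<^bsub>P\<^esub> f\<^esub> C)\<rparr>"
    unfolding A_def hypersurface_algebra_def Let_def cl_def P_def ..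
  show "carrier A = range cl" by (auto simp: A FactRing_def A_RCOSETS_def' cl_def)
  show "cl a \<oplus>\<^bsub>A\<^esub> cl b = cl (a + b)"
    using I.a_rcos_sum[of a b] by (simp add: A FactRing_def cl_def)
  show "cl a \<otimes>\<^bsub>A\<^esub> cl b = cl (a * b)" by (simp add: A mult)
  show "\<one>\<^bsub>A\<^esub> = cl 1" by (simp add: A FactRing_def cl_def)
  show "\<zero>\<^bsub>A\<^esub> = cl 0"
    using I.a_coset_add_zero[OF I.a_subset] by (simp add: A FactRing_def cl_def)
  show "c \<odot>\<^bsub>A\<^esub> cl a = cl ([:[:[:c:]:]:] * a)" by (simp add: A mult)
qed

lemma cl_closed [simp]: "cl h \<in> carrier A" by (simp add: A_simps)

lemma cl_eq_iff: "cl a = cl b \<longleftrightarrow> f dvd a - b"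
proof -
  interpret P: cring P by (rule P_cring)
  have "\<ominus>\<^bsub>P\<^esub> b = - b" using P.minus_equality[of "- b" b] by simp
  then have "a - b \<in> PIdl\<^bsub>P\<^esub> f \<longleftrightarrow> cl a = cl b"
    using P.quotient_eq_iff_same_a_r_cos[OF ideal, of a b] by (simp add: cl_def P.minus_eq)
  then show ?thesis by (auto simp: cgenideal_def dvd_def mult.commute)
qed

lemma A_cring: "cring A"
proof (rule cringI)
  show "abelian_group A"
  proof (rule abelian_groupI)
    fix C assume "C \<in> carrier A"
    then obtain h where h: "C = cl h" by (auto simp: A_simps)
    show "\<exists>D\<in>carrier A. D \<oplus>\<^bsub>A\<^esub> C = \<zero>\<^bsub>A\<^esub>"
      by (rule bexI[of _ "cl (- h)"]) (simp_all add: h A_simps)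
  qed (auto simp: A_simps algebra_simps)
  show "comm_monoid A" by (rule comm_monoidI) (auto simp: A_simps algebra_simps)
qed (auto simp: A_simps algebra_simps)

lemma comm_algebra: "comm_algebra K A"
proof (intro comm_algebra.intro comm_algebra_axioms.intro algebraI K_cring A_cring)
  \<comment> \<open>A name for the constants that the simplifier does not open: it would rewrite products with them to
      scalar multiples, and the ring laws below would no longer apply.\<close>
  define \<kappa> where "\<kappa> = (\<lambda>c :: 'k. [:[:[:c:]:]:])"
  have \<kappa>: "\<kappa> (a * b) = \<kappa> a * \<kappa> b" "\<kappa> (a + b) = \<kappa> a + \<kappa> b" "\<kappa> 1 = 1" for a b
    by (simp_all add: \<kappa>_def one_pCons)
  have smult: "c \<odot>\<^bsub>A\<^esub> cl a = cl (\<kappa> c * a)" for c a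
    by (simp only: A_simps(6) \<kappa>_def)
  note ops = A_simps(2,3) smult \<kappa>
  fix a b :: 'k and C D
  assume "C \<in> carrier A"
  then obtain h where h: "C = cl h" by (auto simp: A_simps(1))
  show "a \<odot>\<^bsub>A\<^esub> C \<in> carrier A" by (simp add: h ops)
  show "\<one>\<^bsub>K\<^esub> \<odot>\<^bsub>A\<^esub> C = C" by (simp add: h ops)
  show "(a \<oplus>\<^bsub>K\<^esub> b) \<odot>\<^bsub>A\<^esub> C = a \<odot>\<^bsub>A\<^esub> C \<oplus>\<^bsub>A\<^esub> b \<odot>\<^bsub>A\<^esub> C"
    by (simp add: h ops distrib_right)
  show "(a \<otimes>\<^bsub>K\<^esub> b) \<odot>\<^bsub>A\<^esub> C = a \<odot>\<^bsub>A\<^esub> (b \<odot>\<^bsub>A\<^esub> C)"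
    by (simp add: h ops mult.assoc)
  assume "D \<in> carrier A"
  then obtain k where k: "D = cl k" by (auto simp: A_simps(1))
  show "a \<odot>\<^bsub>A\<^esub> (C \<oplus>\<^bsub>A\<^esub> D) = a \<odot>\<^bsub>A\<^esub> C \<oplus>\<^bsub>A\<^esub> a \<odot>\<^bsub>A\<^esub> D"
    by (simp add: h k ops distrib_left)
  show "(a \<odot>\<^bsub>A\<^esub> C) \<otimes>\<^bsub>A\<^esub> D = a \<odot>\<^bsub>A\<^esub> (C \<otimes>\<^bsub>A\<^esub> D)"
    by (simp add: h k ops mult.assoc)
qed

end

sublocale affine_hypersurface \<subseteq> comm_algebra K A by (rule comm_algebra)

context affine_hypersurface
begin

lemma cl_minus: "\<ominus>\<^bsub>A\<^esub> cl a = cl (- a)"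
  using A.minus_equality[of "cl (- a)" "cl a"] by (simp add: A_simps)

lemma cl_diff: "cl a \<ominus>\<^bsub>A\<^esub> cl b = cl (a - b)"
  by (simp add: A.minus_eq cl_minus A_simps)

lemma cl_sum: "finite I \<Longrightarrow> (\<Oplus>\<^bsub>A\<^esub>i\<in>I. cl (h i)) = cl (\<Sum>i\<in>I. h i)"
  by (induction I rule: finite_induct) (simp_all add: A_simps)

lemma scalar_one: "c \<odot>\<^bsub>A\<^esub> \<one>\<^bsub>A\<^esub> = cl [:[:[:c:]:]:]"
  by (simp add: A_simps)

text \<open>If \<open>f\<close> divides \<open>\<delta> f\<close>, then \<open>\<delta> (f m) = f (\<delta> m) + m (\<delta> f)\<close> shows that \<open>\<delta>\<close> preserves the ideal of \<open>f\<close> and so acts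
  on residue classes.\<close>

lemma induced_derivation:
  assumes \<delta>: "type_derivation \<delta>" and const: "\<And>c. \<delta> [:[:[:c:]:]:] = 0" and f: "f dvd \<delta> f"
  obtains D where "D \<in> derivations K A" "\<And>h. D (cl h) = cl (\<delta> h)"
proof -
  have add: "\<delta> (a + b) = \<delta> a + \<delta> b" and mult: "\<delta> (a * b) = a * \<delta> b + b * \<delta> a" for a b
    using \<delta> unfolding type_derivation_def by blast+
  define D where "D = (\<lambda>C\<in>carrier A. cl (\<delta> (SOME h. cl h = C)))"
  have D: "D (cl h) = cl (\<delta> h)" for h
  proof -
    define k where "k = (SOME k. cl k = cl h)"
    have "cl k = cl h" unfolding k_def by (rule someI) (rule refl)
    then obtain m where "k - h = f * m" unfolding cl_eq_iff dvd_def by blast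
    then have "\<delta> k - \<delta> h = f * \<delta> m + m * \<delta> f"
      using type_derivation_diff[OF \<delta>, of k h] mult by metis
    then have "cl (\<delta> k) = cl (\<delta> h)" unfolding cl_eq_iff using f by simp
    then show ?thesis by (simp add: D_def k_def)
  qed
  have "D \<in> derivations K A"
  proof (rule derivationI)
    show "D \<in> carrier A \<rightarrow>\<^sub>E carrier A" by (auto simp: D_def)
    show "D (c \<odot>\<^bsub>A\<^esub> \<one>\<^bsub>A\<^esub>) = \<zero>\<^bsub>A\<^esub>" for c by (simp add: scalar_one D const A_simps(5))
    fix C C' assume "C \<in> carrier A" "C' \<in> carrier A"
    then obtain h h' where h: "C = cl h" "C' = cl h'" by (auto simp: A_simps(1))
    show "D (C \<oplus>\<^bsub>A\<^esub> C') = D C \<oplus>\<^bsub>A\<^esub> D C'" by (simp add: h A_simps(2) D add)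
    show "D (C \<otimes>\<^bsub>A\<^esub> C') = C \<otimes>\<^bsub>A\<^esub> D C' \<oplus>\<^bsub>A\<^esub> C' \<otimes>\<^bsub>A\<^esub> D C"
      by (simp add: h A_simps(2,3) D mult)
  qed
  then show ?thesis using that D by blast
qed

lemma generated_by_coordinates:
  assumes "S \<subseteq> carrier A" and const: "\<And>c. c \<in> carrier K \<Longrightarrow> c \<odot>\<^bsub>A\<^esub> \<one>\<^bsub>A\<^esub> \<in> S"
    and gen: "\<And>i. i < 3 \<Longrightarrow> cl (xyz i) \<in> S"
    and add: "\<And>a b. a \<in> S \<Longrightarrow> b \<in> S \<Longrightarrow> a \<oplus>\<^bsub>A\<^esub> b \<in> S"
    and mult: "\<And>a b. a \<in> S \<Longrightarrow> b \<in> S \<Longrightarrow> a \<otimes>\<^bsub>A\<^esub> b \<in> S"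
  shows "carrier A \<subseteq> S"
proof -
  have "h \<in> {h. cl h \<in> S}" for h
  proof (rule polynomials_generated)
    show "[:[:[:c:]:]:] \<in> {h. cl h \<in> S}" for c using const[of c] by (simp add: scalar_one)
    show "a + b \<in> {h. cl h \<in> S}" if "a \<in> {h. cl h \<in> S}" "b \<in> {h. cl h \<in> S}" for a b
      using add[of "cl a" "cl b"] that by (simp add: A_simps(2))
    show "a * b \<in> {h. cl h \<in> S}" if "a \<in> {h. cl h \<in> S}" "b \<in> {h. cl h \<in> S}" for a b
      using mult[of "cl a" "cl b"] that by (simp add: A_simps(3))
  qed (use gen in simp)
  then show ?thesis by (auto simp: A_simps(1))
qed

interpretation \<Omega>: module_over_algebra K A "kaehler K A"
  by (intro module_over_algebra.intro comm_algebra_axioms kaehler_is_module)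

text \<open>In \<open>\<Omega>\<close> only sums and products can be differentiated a priori; this gives the differentials of the monomials of
  the equation.\<close>

lemma kaehler_d_power:
  "kaehler_d (cl (h ^ n)) = cl (of_nat n * h ^ (n - 1)) \<odot>\<^bsub>kaehler K A\<^esub> kaehler_d (cl h)"
proof (induction n)
  case 0
  have "kaehler_d (cl 1) = \<zero>\<^bsub>kaehler K A\<^esub>"
    using kaehler_d_scalar_one[of 1] by (simp add: scalar_one one_pCons)
  then show ?case using \<Omega>.E.smult_l_null[OF kaehler_d_closed[OF cl_closed]] by (simp add: A_simps(5))
next
  case (Suc n)
  note d = kaehler_d_closed[OF cl_closed[of h]]
  have "kaehler_d (cl (h ^ Suc n)) =
      cl h \<odot>\<^bsub>kaehler K A\<^esub> (cl (of_nat n * h ^ (n - 1)) \<odot>\<^bsub>kaehler K A\<^esub> kaehler_d (cl h))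
      \<oplus>\<^bsub>kaehler K A\<^esub> cl (h ^ n) \<odot>\<^bsub>kaehler K A\<^esub> kaehler_d (cl h)"
    using kaehler_d_mult[of "cl h" "cl (h ^ n)"] by (simp add: A_simps(3) Suc.IH)
  also have "\<dots> = (cl h \<otimes>\<^bsub>A\<^esub> cl (of_nat n * h ^ (n - 1)) \<oplus>\<^bsub>A\<^esub> cl (h ^ n)) \<odot>\<^bsub>kaehler K A\<^esub> kaehler_d (cl h)"
    using d by (simp add: \<Omega>.E.smult_l_distr \<Omega>.E.smult_assoc1)
  also have "cl h \<otimes>\<^bsub>A\<^esub> cl (of_nat n * h ^ (n - 1)) \<oplus>\<^bsub>A\<^esub> cl (h ^ n) = cl (of_nat (Suc n) * h ^ (Suc n - 1))"
    by (cases n) (simp_all add: A_simps(2,3) algebra_simps)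
  finally show ?case .
qed

lemma kaehler_d_cl_sum:
  "finite I \<Longrightarrow> kaehler_d (cl (\<Sum>i\<in>I. h i)) = (\<Oplus>\<^bsub>kaehler K A\<^esub>i\<in>I. kaehler_d (cl (h i)))"
proof (induction I rule: finite_induct)
  case empty
  then show ?case using kaehler_d_scalar_one[of 0] by (simp add: scalar_one)
next
  case (insert i I)
  then show ?case
    using kaehler_d_add[of "cl (h i)" "cl (\<Sum>i\<in>I. h i)"] by (simp add: A_simps(2) kaehler_d_closed)
qed

text \<open>In characteristic zero, the Euler-type identity \<open>\<Sum>\<^sub>i G\<^sub>i U\<^sub>i = f + 1\<close> with \<open>U\<^sub>i = x\<^sub>i / k\<^sub>i\<close> makes the gradient
  \<open>G\<close> unimodular modulo \<open>f\<close>. It also gives \<open>\<delta>\<^sub>i f = G\<^sub>i - G\<^sub>i (f + 1) = - G\<^sub>i f\<close> for the derivation \<open>\<delta>\<^sub>i\<close> with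
  \<open>\<delta>\<^sub>i x\<^sub>j = (if i = j then 1 else 0) - G\<^sub>i U\<^sub>j\<close>, so that \<open>\<delta>\<^sub>i\<close> descends to the coordinate ring.\<close>

theorem chern1_diagonal_surface:
  assumes f: "f = (\<Sum>i<3. xyz i ^ k i) - 1" and k: "\<And>i. i < 3 \<Longrightarrow> k i > 0"
  shows "chern1 K A (kaehler K A) = \<one>\<^bsub>lr_cohomology K A 2\<^esub>"
proof -
  define G :: "nat \<Rightarrow> 'k poly poly poly" where "G i = of_nat (k i) * xyz i ^ (k i - 1)" for i
  define U :: "nat \<Rightarrow> 'k poly poly poly" where "U i = [:[:[:1 / of_nat (k i):]:]:] * xyz i" for i
  have GU: "G i * U i = xyz i ^ k i" if i: "i < 3" for i
  proof -
    have "of_nat (k i) * [:[:[:1 / of_nat (k i) :: 'k:]:]:] = 1"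
      using k[OF i] by (simp add: of_nat_poly one_pCons)
    moreover have "G i * U i =
        (of_nat (k i) * [:[:[:1 / of_nat (k i) :: 'k:]:]:]) * (xyz i ^ (k i - 1) * xyz i)"
      unfolding G_def U_def by (simp only: mult_ac)
    ultimately show ?thesis using power_minus_mult[OF k[OF i], of "xyz i :: 'k poly poly poly"] by simp
  qed
  have sum_GU: "(\<Sum>i<3. G i * U i) = f + 1" using GU by (simp add: f)
  have "\<exists>D. D \<in> derivations K A \<and>
      (\<forall>j<3. D (cl (xyz j)) = cl ((if i = j then 1 else 0) - G i * U j))" if i: "i < 3" for i
  proof -
    obtain \<delta> where \<delta>: "type_derivation \<delta>" "\<And>c. \<delta> [:[:[:c:]:]:] = 0"
      and \<delta>_xyz: "\<And>j. j < 3 \<Longrightarrow> \<delta> (xyz j) = (if i = j then 1 else 0) - G i * U j"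
      using derivation_prescribed[of "\<lambda>j. (if i = j then 1 else 0) - G i * U j"] by metis
    have "\<delta> f = (\<Sum>j<3. \<delta> (xyz j ^ k j))"
      by (simp add: f type_derivation_diff[OF \<delta>(1)] type_derivation_sum[OF \<delta>(1)]
          type_derivation_one[OF \<delta>(1)])
    also have "\<dots> = (\<Sum>j<3. G j * ((if i = j then 1 else 0) - G i * U j))"
      by (intro sum.cong) (simp_all add: type_derivation_power[OF \<delta>(1)] \<delta>_xyz G_def)
    also have "\<dots> = (\<Sum>j<3. (if i = j then G j else 0) - G i * (G j * U j))"
      by (intro sum.cong) (simp_all add: algebra_simps)
    also have "\<dots> = G i - G i * (f + 1)"
      using i by (simp add: sum_subtractf sum_distrib_left[symmetric] sum_GU)
    finally have "f dvd \<delta> f" by (simp add: algebra_simps)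
    then obtain D where "D \<in> derivations K A" "\<And>h. D (cl h) = cl (\<delta> h)"
      using induced_derivation[OF \<delta>] by metis
    then show ?thesis using \<delta>_xyz by auto
  qed
  then obtain D where D: "\<And>i. i < 3 \<Longrightarrow> D i \<in> derivations K A"
    and D_xyz: "\<And>i j. i < 3 \<Longrightarrow> j < 3 \<Longrightarrow> D i (cl (xyz j)) = cl ((if i = j then 1 else 0) - G i * U j)"
    by metis
  show ?thesis
  proof (rule chern1_kaehler_trivial[where n = 3 and x = "\<lambda>i. cl (xyz i)" and g = "\<lambda>i. cl (G i)"
        and u = "\<lambda>i. cl (U i)" and D = D])
    show "D i (cl (xyz j)) = (if i = j then \<one>\<^bsub>A\<^esub> else \<zero>\<^bsub>A\<^esub>) \<ominus>\<^bsub>A\<^esub> cl (G i) \<otimes>\<^bsub>A\<^esub> cl (U j)"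
      if "i < 3" "j < 3" for i j
      using D_xyz[OF that] by (simp add: A_simps(3,4,5) cl_diff)
    have f1: "f + 1 = (\<Sum>i<3. xyz i ^ k i)" using f by simp
    have "cl (f + 1) = cl 1" by (simp add: cl_eq_iff)
    then show "(\<Oplus>\<^bsub>A\<^esub>i\<in>{..<3}. cl (G i) \<otimes>\<^bsub>A\<^esub> cl (U i)) = \<one>\<^bsub>A\<^esub>"
      by (simp add: A_simps(3,4) cl_sum sum_GU)
    have "kaehler_d (cl (f + 1)) = \<zero>\<^bsub>kaehler K A\<^esub>"
      using kaehler_d_scalar_one[of 1] \<open>cl (f + 1) = cl 1\<close> by (simp add: scalar_one one_pCons)
    moreover have "kaehler_d (cl (f + 1)) = (\<Oplus>\<^bsub>kaehler K A\<^esub>i\<in>{..<3}. kaehler_d (cl (xyz i ^ k i)))"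
      unfolding f1 by (rule kaehler_d_cl_sum) simp
    ultimately show "(\<Oplus>\<^bsub>kaehler K A\<^esub>i\<in>{..<3}. cl (G i) \<odot>\<^bsub>kaehler K A\<^esub> kaehler_d (cl (xyz i))) = \<zero>\<^bsub>kaehler K A\<^esub>"
      by (simp add: kaehler_d_power G_def)
  qed (use D generated_by_coordinates in simp_all)
qed

end

theorem corollary3p9:
  fixes p q r :: nat
    and K :: "'k::field_char_0 ring"
    and A :: "('k, 'k poly poly poly set) module"
  assumes "p \<ge> 2" and "q \<ge> 2" and "r \<ge> 2"
    and "K = ring_of_type_algebra"
    and "A = surface_algebra p q r"
  shows "chern1 K A (kaehler K A) = \<one>\<^bsub>lr_cohomology K A 2\<^esub>"
proof -
  let ?f = "surface_poly p q r :: 'k poly poly poly"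
  have "?f = (\<Sum>i<3. xyz i ^ ([p, q, r] ! i)) - 1"
    by (simp add: surface_poly_def xyz_def Let_def lessThan_3 numeral_2_eq_2 algebra_simps)
  moreover have "[p, q, r] ! i > 0" if "i < 3" for i
  proof -
    have "i \<in> {0, 1, 2}" using that lessThan_3 by blast
    then show ?thesis using assms(1-3) by auto
  qed
  ultimately show ?thesis
    using affine_hypersurface.chern1_diagonal_surface[of ?f "\<lambda>i. [p, q, r] ! i"] assms(4,5)
    by (simp add: affine_hypersurface.A_def affine_hypersurface.K_def surface_algebra_eq)
qed

end
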